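(* Let $(M,F)$ be a Finsler space of Berwald type with constant flag curvature and dimension greater than $2$. Then $(M,F)$ is symmetric.
   Context: Let $M$ be an $n$-dimensional smooth manifold. Local coordinates $(x^i)$ on $M$ induce natural coordinates $(x^i,y^i)$ on $TM$ via $y=y^i\frac{\partial}{\partial x^i}$. Repeated indices are summed. A Finsler structure is a function $F:TM\to[0,\infty)$ that is differentiable (smooth) away from the zero section, satisfies $F(x,\lambda y)=\lambda F(x,y)$ for all $\lambda>0$, and such that the matrix $g_{ij}=\frac12\frac{\partial^2F^2}{\partial y^i\partial y^j}$ is positive-definite at every point of $TM\setminus 0$; $(g^{ij})$ is its inverse. $(M,F)$ is called a Finsler space (Finsler manifold). All tensors below live on $TM\setminus 0$; their indices refer to the pulled-back bundle $\pi^*TM$ and its dual, where $\pi:TM\setminus 0\to M$. Put $N^i_m=\frac14\frac{\partial}{\partial y^m}\Big(g^{is}\big(\frac{\partial g_{sk}}{\partial x^j}+\frac{\partial g_{sj}}{\partial x^k}-\frac{\partial g_{kj}}{\partial x^s}\big)y^jy^k\Big)$ and $\frac{\delta}{\delta x^i}=\frac{\partial}{\partial x^i}-N^m_i\frac{\partial}{\partial y^m}$. The Chern connection $\nabla$ has coefficients $\Gamma^i_{jk}=\frac{g^{is}}2\big(\frac{\delta g_{sj}}{\delta x^k}-\frac{\delta g_{jk}}{\delta x^s}+\frac{\delta g_{ks}}{\delta x^j}\big)$. $\nabla_{\delta/\delta x^h}$ denotes the horizontal covariant derivative along $\frac{\delta}{\delta x^h}$: e.g. $\nabla_{\delta/\delta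 x^h}T^i_j=\frac{\delta T^i_j}{\delta x^h}+T^m_j\Gamma^i_{mh}-T^i_m\Gamma^m_{jh}$, and similarly for other tensor types (one term per index). The hh-curvature is $R^i_{jkl}=\frac{\delta\Gamma^i_{jl}}{\delta x^k}-\frac{\delta\Gamma^i_{jk}}{\delta x^l}+\Gamma^i_{hk}\Gamma^h_{jl}-\Gamma^i_{hl}\Gamma^h_{jk}$. Flag curvature: a nowhere zero vector field $X$ on an open set $O\subset M$ determines the Riemannian metric $g_{ij}(x,X(x))\,dx^i\otimes dx^j$ on $O$; $X$ is a geodesic vector field if its integral curves are geodesics of $F$. For a nonzero $v_m\in T_mM$ and a two-dimensional subspace $P\subset T_mM$ containing $v_m$, take a geodesic vector field $X$ on a neighborhood of $m$ with $X(m)=v_m$; the flag curvature of $M$ at the flag $(P,v_m)$ is the sectional curvature at the plane $P$ of the Riemannian metric associated to $X$. Constant flag curvature means that this number is the same constant $\lambda$ for all flags at all points. $F$ is of Berwald type if the Chern connection coefficients $\Gamma^i_{jk}$, in natural coordinates, have no $y$ dependence. A Finsler space is called symmetric if $\nabla_{\delta/\delta x^l}R^i_{jkh}=0$ identically on $TM\setminus 0$ for all indices. *)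

theory Defs
  imports "HOL-Analysis.Analysis"
begin

section \<open>Smooth maps and smooth manifolds\<close>

(* Ck_on k S f: f is of class C^k on S. It is only used for open S. All iterated directional
   derivatives (equivalently, all iterated partial derivatives) have to exist and be continuous. *)
primrec Ck_on :: "nat \<Rightarrow> 'a::euclidean_space set \<Rightarrow> ('a \<Rightarrow> 'b::real_normed_vector) \<Rightarrow> bool" where
  "Ck_on 0 S f \<longleftrightarrow> continuous_on S f"
| "Ck_on (Suc k) S f \<longleftrightarrow>
     (\<forall>x\<in>S. f differentiable (at x)) \<and>
     (\<forall>v. Ck_on k S (\<lambda>x. frechet_derivative f (at x) v))"

definition smooth_on :: "'a::euclidean_space set \<Rightarrow> ('a \<Rightarrow> 'b::real_normed_vector) \<Rightarrow> bool" where
  "smooth_on S f \<longleftrightarrow> (\<forall>k. Ck_on k S f)"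

(* A chart is a pair (U, phi); the values of phi outside U carry no information. *)
type_synonym ('m, 'n) chart = "'m set \<times> ('m \<Rightarrow> real ^ 'n)"

abbreviation chart_dom :: "('m, 'n) chart \<Rightarrow> 'm set" where
  "chart_dom c \<equiv> fst c"

abbreviation chart_map :: "('m, 'n) chart \<Rightarrow> 'm \<Rightarrow> real ^ 'n" where
  "chart_map c \<equiv> snd c"

definition chart_inv :: "('m, 'n) chart \<Rightarrow> real ^ 'n \<Rightarrow> 'm" where
  "chart_inv c = inv_into (chart_dom c) (chart_map c)"

definition chart_image :: "('m, 'n) chart \<Rightarrow> (real ^ 'n) set" where
  "chart_image c = chart_map c ` chart_dom c"

definition is_chart :: "('m::topological_space, 'n::finite) chart \<Rightarrow> bool" where
  "is_chart c \<longleftrightarrow>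
     open (chart_dom c) \<and> open (chart_image c) \<and>
     homeomorphism (chart_dom c) (chart_image c) (chart_map c) (chart_inv c)"

definition transition :: "('m, 'n) chart \<Rightarrow> ('m, 'n) chart \<Rightarrow> real ^ 'n \<Rightarrow> real ^ 'n" where
  "transition c d = chart_map d \<circ> chart_inv c"

definition compatible_charts :: "('m, 'n::finite) chart \<Rightarrow> ('m, 'n) chart \<Rightarrow> bool" where
  "compatible_charts c d \<longleftrightarrow>
     smooth_on (chart_map c ` (chart_dom c \<inter> chart_dom d)) (transition c d) \<and>
     smooth_on (chart_map d ` (chart_dom c \<inter> chart_dom d)) (transition d c)"

(* A is a maximal smooth atlas, so its members are exactly the local coordinate systems of the
   manifold. The manifold is the whole type 'm (Hausdorff and second countable by its sort in the
   theorem); its dimension is CARD('n). *)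
definition smooth_manifold :: "('m::topological_space, 'n::finite) chart set \<Rightarrow> bool" where
  "smooth_manifold A \<longleftrightarrow>
     (\<forall>c\<in>A. is_chart c) \<and>
     (\<Union>c\<in>A. chart_dom c) = UNIV \<and>
     (\<forall>c\<in>A. \<forall>d\<in>A. compatible_charts c d) \<and>
     (\<forall>c. is_chart c \<and> (\<forall>d\<in>A. compatible_charts c d) \<longrightarrow> c \<in> A)"


section \<open>Tangent vectors\<close>

(* A tangent vector at p is the family of its coordinate columns in all charts around p, related
   by the Jacobians of the transition maps. Its value is set to 0 on everything that is not a
   chart around p, so that a tangent vector is determined by its components. The vector space
   operations are the chartwise ones. *)
type_synonym ('m, 'n) tvec = "('m, 'n) chart \<Rightarrow> real ^ 'n"

definition charts_at :: "('m, 'n) chart set \<Rightarrow> 'm \<Rightarrow> ('m, 'n) chart set" where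
  "charts_at A p = {c \<in> A. p \<in> chart_dom c}"

definition tangent_space ::
    "('m, 'n::finite) chart set \<Rightarrow> 'm \<Rightarrow> ('m, 'n) tvec set" where
  "tangent_space A p =
     {v. (\<forall>c\<in>charts_at A p. \<forall>d\<in>charts_at A p.
            v d = frechet_derivative (transition c d) (at (chart_map c p)) (v c)) \<and>
         (\<forall>c. c \<notin> charts_at A p \<longrightarrow> v c = 0)}"

(* y^i d/dx^i at p, in the coordinates c *)
definition coord_tvec ::
    "('m, 'n::finite) chart set \<Rightarrow> ('m, 'n) chart \<Rightarrow> 'm \<Rightarrow> real ^ 'n \<Rightarrow> ('m, 'n) tvec" where
  "coord_tvec A c p y =
     (\<lambda>d. if d \<in> charts_at A p
          then frechet_derivative (transition c d) (at (chart_map c p)) y else 0)"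

definition tangent_plane ::
    "('m, 'n::finite) chart set \<Rightarrow> 'm \<Rightarrow> ('m, 'n) tvec set \<Rightarrow> bool" where
  "tangent_plane A p P \<longleftrightarrow>
     P \<subseteq> tangent_space A p \<and>
     (\<forall>c\<in>charts_at A p. subspace ((\<lambda>v. v c) ` P) \<and> dim ((\<lambda>v. v c) ` P) = 2)"


section \<open>Tensors of a Finsler function in natural coordinates\<close>

(* Functions on (an open part of) TM in natural coordinates have the type below; points are pairs
   (x, y). In this section L is the coordinate expression of the Finsler function. *)
type_synonym 'n tfun = "(real ^ 'n) \<times> (real ^ 'n) \<Rightarrow> real"

definition dx :: "'n::finite \<Rightarrow> 'n tfun \<Rightarrow> 'n tfun" where
  "dx i f p = frechet_derivative f (at p) (axis i 1, 0)"

definition dy :: "'n::finite \<Rightarrow> 'n tfun \<Rightarrow> 'n tfun" where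
  "dy i f p = frechet_derivative f (at p) (0, axis i 1)"

definition fund :: "'n tfun \<Rightarrow> 'n::finite \<Rightarrow> 'n \<Rightarrow> 'n tfun" where
  "fund L i j p = 1/2 * dy i (dy j (\<lambda>q. (L q)\<^sup>2)) p"

definition fund_inv :: "'n tfun \<Rightarrow> 'n::finite \<Rightarrow> 'n \<Rightarrow> 'n tfun" where
  "fund_inv L i j p = matrix_inv (\<chi> a b. fund L a b p) $ i $ j"

definition Ncoef :: "'n tfun \<Rightarrow> 'n::finite \<Rightarrow> 'n \<Rightarrow> 'n tfun" where
  "Ncoef L i m p =
     1/4 * dy m (\<lambda>q. \<Sum>s\<in>UNIV. \<Sum>j\<in>UNIV. \<Sum>k\<in>UNIV.
        fund_inv L i s q *
        (dx j (fund L s k) q + dx k (fund L s j) q - dx s (fund L k j) q) *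
        (snd q $ j) * (snd q $ k)) p"

definition hdelta :: "'n tfun \<Rightarrow> 'n::finite \<Rightarrow> 'n tfun \<Rightarrow> 'n tfun" where
  "hdelta L i f p = dx i f p - (\<Sum>m\<in>UNIV. Ncoef L m i p * dy m f p)"

definition chern :: "'n tfun \<Rightarrow> 'n::finite \<Rightarrow> 'n \<Rightarrow> 'n \<Rightarrow> 'n tfun" where
  "chern L i j k p =
     (\<Sum>s\<in>UNIV. fund_inv L i s p / 2 *
        (hdelta L k (fund L s j) p - hdelta L s (fund L j k) p + hdelta L j (fund L k s) p))"

definition hh_curv :: "'n tfun \<Rightarrow> 'n::finite \<Rightarrow> 'n \<Rightarrow> 'n \<Rightarrow> 'n \<Rightarrow> 'n tfun" where
  "hh_curv L i j k l p =
     hdelta L k (chern L i j l) p - hdelta L l (chern L i j k) p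
     + (\<Sum>h\<in>UNIV. chern L i h k p * chern L h j l p)
     - (\<Sum>h\<in>UNIV. chern L i h l p * chern L h j k p)"

(* horizontal covariant derivative of a tensor T^i_{jkh} (first index upper) along delta/delta x^l *)
definition hcov :: "'n tfun \<Rightarrow> 'n::finite \<Rightarrow> ('n \<Rightarrow> 'n \<Rightarrow> 'n \<Rightarrow> 'n \<Rightarrow> 'n tfun) \<Rightarrow>
    'n \<Rightarrow> 'n \<Rightarrow> 'n \<Rightarrow> 'n \<Rightarrow> 'n tfun" where
  "hcov L l T i j k h p =
     hdelta L l (T i j k h) p
     + (\<Sum>m\<in>UNIV. T m j k h p * chern L i m l p)
     - (\<Sum>m\<in>UNIV. T i m k h p * chern L m j l p)
     - (\<Sum>m\<in>UNIV. T i j m h p * chern L m k l p)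
     - (\<Sum>m\<in>UNIV. T i j k m p * chern L m h l p)"


section \<open>Finsler structures\<close>

definition natural_dom :: "('m, 'n::finite) chart \<Rightarrow> ((real ^ 'n) \<times> (real ^ 'n)) set" where
  "natural_dom c = chart_image c \<times> (UNIV - {0})"

(* F p v is the value of the Finsler function at the tangent vector v at p; local_expr is its
   expression in the natural coordinates induced by the chart c. *)
definition local_expr ::
    "('m, 'n::finite) chart set \<Rightarrow> ('m \<Rightarrow> ('m, 'n) tvec \<Rightarrow> real) \<Rightarrow> ('m, 'n) chart \<Rightarrow> 'n tfun" where
  "local_expr A F c = (\<lambda>(x, y). F (chart_inv c x) (coord_tvec A c (chart_inv c x) y))"

definition finsler_structure ::
    "('m, 'n::finite) chart set \<Rightarrow> ('m \<Rightarrow> ('m, 'n) tvec \<Rightarrow> real) \<Rightarrow> bool" where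
  "finsler_structure A F \<longleftrightarrow>
     (\<forall>p. \<forall>v\<in>tangent_space A p. 0 \<le> F p v) \<and>
     (\<forall>c\<in>A. smooth_on (natural_dom c) (local_expr A F c)) \<and>
     (\<forall>p. \<forall>v\<in>tangent_space A p. \<forall>r>0. F p (\<lambda>c. r *\<^sub>R v c) = r * F p v) \<and>
     (\<forall>c\<in>A. \<forall>q\<in>natural_dom c. \<forall>w. w \<noteq> 0 \<longrightarrow>
        0 < (\<Sum>i\<in>UNIV. \<Sum>j\<in>UNIV. fund (local_expr A F c) i j q * w $ i * w $ j))"

definition berwald ::
    "('m, 'n::finite) chart set \<Rightarrow> ('m \<Rightarrow> ('m, 'n) tvec \<Rightarrow> real) \<Rightarrow> bool" where
  "berwald A F \<longleftrightarrow>
     (\<forall>c\<in>A. \<forall>x y z. (x, y) \<in> natural_dom c \<and> (x, z) \<in> natural_dom c \<longrightarrow>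
        (\<forall>i j k. chern (local_expr A F c) i j k (x, y) = chern (local_expr A F c) i j k (x, z)))"

definition symmetric_finsler ::
    "('m, 'n::finite) chart set \<Rightarrow> ('m \<Rightarrow> ('m, 'n) tvec \<Rightarrow> real) \<Rightarrow> bool" where
  "symmetric_finsler A F \<longleftrightarrow>
     (\<forall>c\<in>A. \<forall>q\<in>natural_dom c. \<forall>l i j k h.
        hcov (local_expr A F c) l (hh_curv (local_expr A F c)) i j k h q = 0)"


section \<open>Geodesic vector fields\<close>

(* Solutions of x''^i + Gamma^i_{jk}(x, x') x'^j x'^k = 0, i.e. constant speed geodesics.
   A reparametrised field f X with f > 0 determines the same Riemannian metric as X, because
   g_{ij} is homogeneous of degree 0 in y. *)
definition finsler_geodesic ::
    "('m::topological_space, 'n::finite) chart set \<Rightarrow> ('m \<Rightarrow> ('m, 'n) tvec \<Rightarrow> real) \<Rightarrow>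
     real set \<Rightarrow> (real \<Rightarrow> 'm) \<Rightarrow> bool" where
  "finsler_geodesic A F I \<gamma> \<longleftrightarrow>
     continuous_on I \<gamma> \<and>
     (\<forall>t\<in>I. \<forall>c\<in>charts_at A (\<gamma> t).
        (let x = (\<lambda>s. chart_map c (\<gamma> s));
             x' = (\<lambda>s. vector_derivative x (at s))
         in x differentiable (at t) \<and> x' t \<noteq> 0 \<and>
            (x' has_vector_derivative
               (\<chi> i. - (\<Sum>j\<in>UNIV. \<Sum>k\<in>UNIV.
                   chern (local_expr A F c) i j k (x t, x' t) * x' t $ j * x' t $ k))) (at t)))"

definition nonzero_vector_field ::
    "('m, 'n::finite) chart set \<Rightarrow> 'm set \<Rightarrow> ('m \<Rightarrow> ('m, 'n) tvec) \<Rightarrow> bool" where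
  "nonzero_vector_field A W X \<longleftrightarrow>
     (\<forall>p\<in>W. X p \<in> tangent_space A p \<and> X p \<noteq> (\<lambda>_. 0)) \<and>
     (\<forall>c\<in>A. smooth_on (chart_map c ` (chart_dom c \<inter> W)) (\<lambda>x. X (chart_inv c x) c))"

definition integral_curve ::
    "('m::topological_space, 'n::finite) chart set \<Rightarrow> 'm set \<Rightarrow> ('m \<Rightarrow> ('m, 'n) tvec) \<Rightarrow>
     real set \<Rightarrow> (real \<Rightarrow> 'm) \<Rightarrow> bool" where
  "integral_curve A W X I \<gamma> \<longleftrightarrow>
     continuous_on I \<gamma> \<and> \<gamma> ` I \<subseteq> W \<and>
     (\<forall>t\<in>I. \<forall>c\<in>charts_at A (\<gamma> t).
        ((\<lambda>s. chart_map c (\<gamma> s)) has_vector_derivative X (\<gamma> t) c) (at t))"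

definition geodesic_field ::
    "('m::topological_space, 'n::finite) chart set \<Rightarrow> ('m \<Rightarrow> ('m, 'n) tvec \<Rightarrow> real) \<Rightarrow>
     'm set \<Rightarrow> ('m \<Rightarrow> ('m, 'n) tvec) \<Rightarrow> bool" where
  "geodesic_field A F W X \<longleftrightarrow>
     nonzero_vector_field A W X \<and>
     (\<forall>I \<gamma>. open I \<and> is_interval I \<and> integral_curve A W X I \<gamma> \<longrightarrow> finsler_geodesic A F I \<gamma>)"


section \<open>Riemannian metrics and flag curvature\<close>

(* h is the coefficient matrix of a Riemannian metric in a chart. *)
type_synonym 'n metric = "'n \<Rightarrow> 'n \<Rightarrow> real ^ 'n \<Rightarrow> real"

definition pd :: "'n::finite \<Rightarrow> (real ^ 'n \<Rightarrow> real) \<Rightarrow> real ^ 'n \<Rightarrow> real" where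
  "pd i f x = frechet_derivative f (at x) (axis i 1)"

definition christoffel :: "'n::finite metric \<Rightarrow> 'n \<Rightarrow> 'n \<Rightarrow> 'n \<Rightarrow> real ^ 'n \<Rightarrow> real" where
  "christoffel h i j k x =
     (\<Sum>s\<in>UNIV. matrix_inv (\<chi> a b. h a b x) $ i $ s / 2 *
        (pd k (h s j) x - pd s (h j k) x + pd j (h k s) x))"

(* the components of R(d_k, d_l) d_j = riem^i_{jkl} d_i *)
definition riem :: "'n::finite metric \<Rightarrow> 'n \<Rightarrow> 'n \<Rightarrow> 'n \<Rightarrow> 'n \<Rightarrow> real ^ 'n \<Rightarrow> real" where
  "riem h i j k l x =
     pd k (christoffel h i j l) x - pd l (christoffel h i j k) x
     + (\<Sum>m\<in>UNIV. christoffel h i m k x * christoffel h m j l x)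
     - (\<Sum>m\<in>UNIV. christoffel h i m l x * christoffel h m j k x)"

definition metric_at :: "'n::finite metric \<Rightarrow> real ^ 'n \<Rightarrow> real ^ 'n \<Rightarrow> real ^ 'n \<Rightarrow> real" where
  "metric_at h x u w = (\<Sum>i\<in>UNIV. \<Sum>j\<in>UNIV. h i j x * u $ i * w $ j)"

(* <R(u,w)w, u> / (|u|^2 |w|^2 - <u,w>^2) *)
definition sectional_of_basis ::
    "'n::finite metric \<Rightarrow> real ^ 'n \<Rightarrow> real ^ 'n \<Rightarrow> real ^ 'n \<Rightarrow> real" where
  "sectional_of_basis h x u w =
     metric_at h x
       (\<chi> i. \<Sum>j\<in>UNIV. \<Sum>k\<in>UNIV. \<Sum>l\<in>UNIV. riem h i j k l x * w $ j * u $ k * w $ l) u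
     / (metric_at h x u u * metric_at h x w w - (metric_at h x u w)\<^sup>2)"

(* The value does not depend on the basis (u, w) of the plane Q that is picked. *)
definition sectional_curvature ::
    "'n::finite metric \<Rightarrow> real ^ 'n \<Rightarrow> (real ^ 'n) set \<Rightarrow> real" where
  "sectional_curvature h x Q =
     (let (u, w) = (SOME (u, w). u \<noteq> w \<and> independent {u, w} \<and> span {u, w} = Q)
      in sectional_of_basis h x u w)"

(* the coefficients g_{ij}(x, X(x)) in the chart c *)
definition field_metric ::
    "('m, 'n::finite) chart set \<Rightarrow> ('m \<Rightarrow> ('m, 'n) tvec \<Rightarrow> real) \<Rightarrow>
     ('m \<Rightarrow> ('m, 'n) tvec) \<Rightarrow> ('m, 'n) chart \<Rightarrow> 'n metric" where
  "field_metric A F X c i j x = fund (local_expr A F c) i j (x, X (chart_inv c x) c)"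

(* K is the flag curvature at the flag (P, v), P a plane in the tangent space at p: it is the
   sectional curvature at P of the metric of a geodesic field X, defined around p, with X(p) = v.
   Such an X always exists locally, and neither the choice of X nor that of the chart matters. *)
definition has_flag_curvature ::
    "('m::topological_space, 'n::finite) chart set \<Rightarrow> ('m \<Rightarrow> ('m, 'n) tvec \<Rightarrow> real) \<Rightarrow>
     'm \<Rightarrow> ('m, 'n) tvec set \<Rightarrow> ('m, 'n) tvec \<Rightarrow> real \<Rightarrow> bool" where
  "has_flag_curvature A F p P v K \<longleftrightarrow>
     (\<exists>W X. open W \<and> p \<in> W \<and> geodesic_field A F W X \<and> X p = v \<and>
        (\<forall>c\<in>charts_at A p.
           sectional_curvature (field_metric A F X c) (chart_map c p) ((\<lambda>u. u c) ` P) = K))"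

definition constant_flag_curvature ::
    "('m::topological_space, 'n::finite) chart set \<Rightarrow> ('m \<Rightarrow> ('m, 'n) tvec \<Rightarrow> real) \<Rightarrow> bool" where
  "constant_flag_curvature A F \<longleftrightarrow>
     (\<exists>r. \<forall>p P v. tangent_plane A p P \<and> v \<in> P \<and> v \<noteq> (\<lambda>_. 0) \<longrightarrow>
        has_flag_curvature A F p P v r)"

end

theory Submission
  imports Defs
begin

text \<open>
  Why the theorem holds. In a Berwald space the coefficients of the Chern connection are functions of
  the position \<open>x\<close> only, so the hh-curvature \<open>R\<close> is the curvature of an ordinary torsion-free affine
  connection and has no \<open>y\<close>-dependence.

  Flag curvature is defined through Riemannian metrics \<open>g(x, X(x))\<close> of geodesic fields \<open>X\<close>. The
  Levi-Civita connection of such a metric differs from the Chern connection by terms with the Cartan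
  tensor, which annihilates its base point; together with the geodesic equation this implies that
  both connections give the same covariant derivative of \<open>X\<close>
  (\<open>christoffel_section_contract\<close>). By the Ricci identity the two curvatures then have the same Jacobi
  operator \<open>u \<mapsto> R(u, X) X\<close> (\<open>jacobi_operator_section\<close>). The geodesic equation is needed as a
  differential equation for \<open>X\<close>, whereas geodesic fields are given by their integral curves, so the
  existence of integral curves enters (\<open>integral_curve_through_point_exists\<close>,
  \<open>geodesic_field_equation\<close>).

  A Jacobi operator is symmetric, hence determined by the sectional curvatures of the planes through
  the flagpole. Constant flag curvature \<open>r\<close> thus reads, for all \<open>y \<noteq> 0\<close>,
  \<open>R\<^sup>i\<^sub>j\<^sub>k\<^sub>l y\<^sup>j y\<^sup>l = r (g\<^sub>a\<^sub>b y\<^sup>a y\<^sup>b \<delta>\<^sup>i\<^sub>k - y\<^sup>i g\<^sub>k\<^sub>m y\<^sup>m)\<close>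
  (\<open>jacobi_operator_of_constant_flag\<close>). The left-hand side is a quadratic form in \<open>y\<close> with coefficients
  independent of \<open>y\<close>. Differentiating twice in \<open>y\<close> and taking the trace shows that \<open>r g\<close> does not
  depend on \<open>y\<close>, and the first Bianchi identity yields
  \<open>R\<^sup>i\<^sub>j\<^sub>k\<^sub>l = r (g\<^sub>j\<^sub>l \<delta>\<^sup>i\<^sub>k - g\<^sub>j\<^sub>k \<delta>\<^sup>i\<^sub>l)\<close> (\<open>curv_of_constant_flag\<close>). The cases of vanishing \<open>r\<close>, where the
  space is flat, and of nonvanishing \<open>r\<close>, where it is Riemannian, need no distinction. Finally the Chern
  connection is horizontally metric, so this tensor is horizontally parallel
  (\<open>hcov_of_constant_curvature\<close>).
\<close>

section \<open>Calculus of smooth maps\<close>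

lemma Ck_on_cong:
  assumes "open S" "\<And>x. x \<in> S \<Longrightarrow> f x = g x" "Ck_on k S f"
  shows "Ck_on k S g"
  using assms(2,3)
proof (induction k arbitrary: f g)
  case 0
  then show ?case using continuous_on_cong by force
next
  case (Suc k)
  have diff: "g differentiable (at x)" if "x \<in> S" for x
  proof -
    have "(f has_derivative frechet_derivative f (at x)) (at x)"
      using Suc.prems(2) that frechet_derivative_works by auto
    then have "(g has_derivative frechet_derivative f (at x)) (at x)"
      using has_derivative_transform_within_open[OF _ assms(1) that] Suc.prems(1) by metis
    then show ?thesis by (rule differentiableI)
  qed
  have "frechet_derivative f (at x) v = frechet_derivative g (at x) v" if "x \<in> S" for x v
    using frechet_derivative_transform_within_open[of f x S g] Suc.prems assms(1) that
    by auto
  then have "Ck_on k S (\<lambda>x. frechet_derivative g (at x) v)" for v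
    using Suc.IH[of "\<lambda>x. frechet_derivative f (at x) v" "\<lambda>x. frechet_derivative g (at x) v"]
      Suc.prems by auto
  with diff show ?case by simp
qed

lemma Ck_on_SucD: "Ck_on (Suc k) S f \<Longrightarrow> Ck_on k S f"
proof (induction k arbitrary: f)
  case 0
  then show ?case
    by (simp add: continuous_at_imp_continuous_on differentiable_imp_continuous_within)
next
  case (Suc k)
  then show ?case by (metis Ck_on.simps(2))
qed

text \<open>Saves identifying a derivative with \<^const>\<open>frechet_derivative\<close> in each closure property.\<close>

lemma Ck_on_SucI:
  assumes "open S" "\<And>x. x \<in> S \<Longrightarrow> (f has_derivative f' x) (at x)"
    and "\<And>v. Ck_on k S (\<lambda>x. f' x v)"
  shows "Ck_on (Suc k) S f"
proof -
  have "f' x = frechet_derivative f (at x)" if "x \<in> S" for x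
    using assms(2) that frechet_derivative_at by blast
  then have "Ck_on k S (\<lambda>x. frechet_derivative f (at x) v)" for v
    using Ck_on_cong[OF assms(1) _ assms(3)[of v]] by simp
  moreover have "f differentiable (at x)" if "x \<in> S" for x
    using assms(2)[OF that] by (rule differentiableI)
  ultimately show ?thesis by simp
qed

lemma Ck_on_const: "Ck_on k S (\<lambda>_. c)"
  by (induction k arbitrary: c) (auto simp: frechet_derivative_const)

lemma Ck_on_has_derivative:
  "Ck_on (Suc k) S f \<Longrightarrow> x \<in> S \<Longrightarrow> (f has_derivative frechet_derivative f (at x)) (at x)"
  using frechet_derivative_works by auto

lemma Ck_on_bounded_linear:
  assumes "bounded_linear l" "open S" "Ck_on k S f"
  shows "Ck_on k S (\<lambda>x. l (f x))"
  using assms(3)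
proof (induction k arbitrary: f)
  case 0
  then show ?case using assms(1) bounded_linear.continuous_on by auto
next
  case (Suc k)
  show ?case
    by (rule Ck_on_SucI[OF assms(2) bounded_linear.has_derivative[OF assms(1)
          Ck_on_has_derivative[OF Suc.prems]]])
      (use Suc in auto)
qed

lemma Ck_on_add:
  assumes "open S" "Ck_on k S f" "Ck_on k S g"
  shows "Ck_on k S (\<lambda>x. f x + g x)"
  using assms(2,3)
proof (induction k arbitrary: f g)
  case 0
  then show ?case using continuous_on_add by auto
next
  case (Suc k)
  show ?case
    by (rule Ck_on_SucI[OF assms(1) has_derivative_add[OF
          Ck_on_has_derivative[OF Suc.prems(1)] Ck_on_has_derivative[OF Suc.prems(2)]]])
      (use Suc in auto)
qed

lemma Ck_on_bounded_bilinear: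
  assumes "bounded_bilinear b" "open S" "Ck_on k S f" "Ck_on k S g"
  shows "Ck_on k S (\<lambda>x. b (f x) (g x))"
  using assms(3,4)
proof (induction k arbitrary: f g)
  case 0
  then show ?case using assms(1) bounded_bilinear.continuous_on by auto
next
  case (Suc k)
  have fg: "Ck_on k S f" "Ck_on k S g" using Suc.prems Ck_on_SucD by auto
  show ?case
    by (rule Ck_on_SucI[OF assms(2) bounded_bilinear.FDERIV[OF assms(1)
          Ck_on_has_derivative[OF Suc.prems(1)] Ck_on_has_derivative[OF Suc.prems(2)]]])
      (use Suc fg in \<open>auto intro!: Ck_on_add assms(2)\<close>)
qed

lemma Ck_on_sum:
  assumes "open S" "\<And>i. i \<in> I \<Longrightarrow> Ck_on k S (f i)"
  shows "Ck_on k S (\<lambda>x. \<Sum>i\<in>I. f i x)"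
proof (cases "finite I")
  case True
  then show ?thesis using assms(2)
    by (induction I) (auto intro!: Ck_on_add Ck_on_const assms(1))
next
  case False
  then show ?thesis using Ck_on_const[of k S 0] by simp
qed

text \<open>The class is defined through directional derivatives with a fixed direction. The chain rule
  differentiates the outer function in the variable direction given by the derivative of the inner
  one, so that direction is expanded in the standard basis before the induction hypothesis applies.\<close>

lemma Ck_on_compose:
  fixes g :: "'a::euclidean_space \<Rightarrow> 'b::euclidean_space" and f :: "'b \<Rightarrow> 'c::real_normed_vector"
  assumes "open S" "open T" "g ` S \<subseteq> T" "Ck_on k T f" "Ck_on k S g"
  shows "Ck_on k S (\<lambda>x. f (g x))"
  using assms(4,5)
proof (induction k arbitrary: f)
  case 0
  then show ?case using assms(3) continuous_on_compose2 by (metis Ck_on.simps(1))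
next
  case (Suc k)
  have g: "Ck_on k S g" using Suc.prems Ck_on_SucD by auto
  have lin: "linear (frechet_derivative f (at (g x)))" if "x \<in> S" for x
    using Suc.prems(1) assms(3) that by (auto intro!: linear_frechet_derivative)
  define D where "D x v = (\<Sum>b\<in>Basis. (frechet_derivative g (at x) v \<bullet> b) *\<^sub>R
      frechet_derivative f (at (g x)) b)" for x v
  have "((\<lambda>x. f (g x)) has_derivative D x) (at x)" if "x \<in> S" for x
  proof -
    have "(f has_derivative frechet_derivative f (at (g x))) (at (g x))"
      using Ck_on_has_derivative[OF Suc.prems(1)] assms(3) that by auto
    then have "((\<lambda>x. f (g x)) has_derivative
        (\<lambda>v. frechet_derivative f (at (g x)) (frechet_derivative g (at x) v))) (at x)"
      using diff_chain_at[OF Ck_on_has_derivative[OF Suc.prems(2) that]] by (simp add: o_def)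
    moreover have "frechet_derivative f (at (g x)) (frechet_derivative g (at x) v) = D x v" for v
    proof -
      have "frechet_derivative f (at (g x)) (frechet_derivative g (at x) v) =
        frechet_derivative f (at (g x)) (\<Sum>b\<in>Basis. (frechet_derivative g (at x) v \<bullet> b) *\<^sub>R b)"
        by (simp only: euclidean_representation)
      also have "\<dots> = D x v"
        unfolding D_def by (simp add: linear_sum[OF lin[OF that]] linear_scale[OF lin[OF that]])
      finally show ?thesis .
    qed
    ultimately show ?thesis by (simp only: ext)
  qed
  moreover have "Ck_on k S (\<lambda>x. D x v)" for v
    unfolding D_def
  proof (intro Ck_on_sum Ck_on_bounded_bilinear[OF bounded_bilinear_scaleR] assms(1))
    fix b :: 'b
    show "Ck_on k S (\<lambda>x. frechet_derivative g (at x) v \<bullet> b)"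
      using Suc.prems by (auto intro!: Ck_on_bounded_linear[OF bounded_linear_inner_left] assms(1))
    show "Ck_on k S (\<lambda>x. frechet_derivative f (at (g x)) b)"
      using Suc.IH[of "\<lambda>z. frechet_derivative f (at z) b"] Suc.prems g by auto
  qed
  ultimately show ?case by (rule Ck_on_SucI[OF assms(1)])
qed

lemma Ck_on_inverse_real: "Ck_on k (- {0}) (inverse :: real \<Rightarrow> real)"
proof (induction k)
  case 0
  then show ?case by (auto intro!: continuous_intros)
next
  case (Suc k)
  have "(inverse has_derivative (\<lambda>v. - (inverse x * v * inverse x))) (at x)"
    if "x \<in> - {0}" for x :: real
    using that has_derivative_inverse'[of x UNIV] by auto
  then show ?case
    by (rule Ck_on_SucI[rotated])
      (auto intro!: Ck_on_bounded_linear[OF bounded_linear_minus[OF bounded_linear_ident]]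
        Ck_on_bounded_bilinear[OF bounded_bilinear_mult] Suc Ck_on_const)
qed

lemma smooth_on_cong:
  "open S \<Longrightarrow> smooth_on S f \<Longrightarrow> (\<And>x. x \<in> S \<Longrightarrow> f x = g x) \<Longrightarrow> smooth_on S g"
  unfolding smooth_on_def using Ck_on_cong by blast

lemma smooth_on_const: "smooth_on S (\<lambda>_. c)"
  unfolding smooth_on_def using Ck_on_const by blast

lemma smooth_on_bounded_linear:
  "bounded_linear l \<Longrightarrow> open S \<Longrightarrow> smooth_on S f \<Longrightarrow> smooth_on S (\<lambda>x. l (f x))"
  unfolding smooth_on_def using Ck_on_bounded_linear by blast

lemma smooth_on_ident:
  assumes "open S"
  shows "smooth_on S (\<lambda>x. x)"
  unfolding smooth_on_def
proof
  fix k
  show "Ck_on k S (\<lambda>x. x)"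
  proof (cases k)
    case 0
    then show ?thesis by (simp add: continuous_on_id)
  next
    case (Suc j)
    then show ?thesis
      using Ck_on_SucI[OF assms has_derivative_ident Ck_on_const] by (simp only:)
  qed
qed

lemma smooth_on_add:
  "open S \<Longrightarrow> smooth_on S f \<Longrightarrow> smooth_on S g \<Longrightarrow> smooth_on S (\<lambda>x. f x + g x)"
  unfolding smooth_on_def using Ck_on_add by blast

lemma smooth_on_minus: "open S \<Longrightarrow> smooth_on S f \<Longrightarrow> smooth_on S (\<lambda>x. - f x)"
  by (rule smooth_on_bounded_linear[OF bounded_linear_minus[OF bounded_linear_ident]])

lemma smooth_on_diff:
  "open S \<Longrightarrow> smooth_on S f \<Longrightarrow> smooth_on S g \<Longrightarrow> smooth_on S (\<lambda>x. f x - g x)"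
  using smooth_on_add[of S f "\<lambda>x. - g x"] smooth_on_minus[of S g] by simp

lemma smooth_on_mult:
  fixes f g :: "_ \<Rightarrow> real"
  shows "open S \<Longrightarrow> smooth_on S f \<Longrightarrow> smooth_on S g \<Longrightarrow> smooth_on S (\<lambda>x. f x * g x)"
  unfolding smooth_on_def using Ck_on_bounded_bilinear[OF bounded_bilinear_mult] by blast

lemma smooth_on_power:
  fixes f :: "_ \<Rightarrow> real"
  shows "open S \<Longrightarrow> smooth_on S f \<Longrightarrow> smooth_on S (\<lambda>x. f x ^ n)"
  by (induction n) (auto intro: smooth_on_const smooth_on_mult)

lemma smooth_on_sum:
  assumes "open S" "\<And>i. i \<in> I \<Longrightarrow> smooth_on S (f i)"
  shows "smooth_on S (\<lambda>x. \<Sum>i\<in>I. f i x)"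
  unfolding smooth_on_def
proof
  fix k
  show "Ck_on k S (\<lambda>x. \<Sum>i\<in>I. f i x)"
    by (rule Ck_on_sum) (use assms in \<open>simp_all add: smooth_on_def\<close>)
qed

lemma smooth_on_prod:
  fixes f :: "_ \<Rightarrow> _ \<Rightarrow> real"
  assumes "open S" "\<And>i. i \<in> I \<Longrightarrow> smooth_on S (f i)"
  shows "smooth_on S (\<lambda>x. \<Prod>i\<in>I. f i x)"
proof (cases "finite I")
  case True
  then show ?thesis using assms(2)
  proof (induction I)
    case empty
    show ?case by (simp add: smooth_on_const)
  next
    case (insert i I)
    then show ?case by (simp add: smooth_on_mult assms(1))
  qed
next
  case False
  then show ?thesis using smooth_on_const[of S 1] by simp
qed

lemma smooth_on_compose:
  fixes g :: "'a::euclidean_space \<Rightarrow> 'b::euclidean_space" and f :: "'b \<Rightarrow> 'c::real_normed_vector"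
  assumes "open S" "open T" "g ` S \<subseteq> T" "smooth_on T f" "smooth_on S g"
  shows "smooth_on S (\<lambda>x. f (g x))"
  unfolding smooth_on_def
proof
  fix k
  show "Ck_on k S (\<lambda>x. f (g x))"
    using assms(4,5) unfolding smooth_on_def by (intro Ck_on_compose[OF assms(1-3), of k f]) blast+
qed

lemma smooth_on_divide:
  fixes f g :: "_ \<Rightarrow> real"
  assumes "open S" "smooth_on S f" "smooth_on S g" "\<And>x. x \<in> S \<Longrightarrow> g x \<noteq> 0"
  shows "smooth_on S (\<lambda>x. f x / g x)"
proof -
  have "open (- {0 :: real})" by (simp add: open_Compl)
  moreover have "g ` S \<subseteq> - {0}" using assms(4) by auto
  moreover have "smooth_on (- {0}) (inverse :: real \<Rightarrow> real)"
    unfolding smooth_on_def by (rule allI) (rule Ck_on_inverse_real)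
  ultimately have "smooth_on S (\<lambda>x. inverse (g x))"
    using assms(1,3) smooth_on_compose[of S "- {0}" g inverse] by simp
  from smooth_on_mult[OF assms(1,2) this] show ?thesis
    unfolding divide_inverse .
qed

lemma smooth_on_Pair:
  assumes "open S" "smooth_on S f" "smooth_on S g"
  shows "smooth_on S (\<lambda>x. (f x, g x))"
proof -
  have "bounded_linear (\<lambda>z. (z, 0))" "bounded_linear (\<lambda>z. (0, z))"
    by (rule bounded_linear_Pair[OF bounded_linear_ident bounded_linear_zero])
      (rule bounded_linear_Pair[OF bounded_linear_zero bounded_linear_ident])
  then have "smooth_on S (\<lambda>x. (f x, 0))" "smooth_on S (\<lambda>x. (0, g x))"
    using assms smooth_on_bounded_linear by fast+
  from smooth_on_add[OF assms(1) this] show ?thesis by simp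
qed

lemma smooth_on_nth: "open S \<Longrightarrow> smooth_on S f \<Longrightarrow> smooth_on S (\<lambda>x. f x $ i)"
  by (rule smooth_on_bounded_linear[OF bounded_linear_vec_nth])

lemma smooth_on_frechet_derivative:
  assumes "smooth_on S f"
  shows "smooth_on S (\<lambda>x. frechet_derivative f (at x) v)"
  unfolding smooth_on_def
proof
  fix k
  have "Ck_on (Suc k) S f" using assms by (simp only: smooth_on_def)
  then show "Ck_on k S (\<lambda>x. frechet_derivative f (at x) v)" by simp
qed

lemma smooth_on_has_derivative:
  "smooth_on S f \<Longrightarrow> x \<in> S \<Longrightarrow> (f has_derivative frechet_derivative f (at x)) (at x)"
  unfolding smooth_on_def by (rule Ck_on_has_derivative) auto

lemma smooth_on_differentiable: "smooth_on S f \<Longrightarrow> x \<in> S \<Longrightarrow> f differentiable (at x)"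
  using smooth_on_has_derivative differentiableI by blast

lemma smooth_on_continuous_on:
  assumes "smooth_on S f"
  shows "continuous_on S f"
proof -
  have "Ck_on 0 S f" using assms by (simp only: smooth_on_def)
  then show ?thesis by simp
qed

lemma has_vector_derivative_compose_at:
  assumes "(\<gamma> has_vector_derivative v) (at t)" "(f has_derivative f') (at (\<gamma> t))"
  shows "((f \<circ> \<gamma>) has_vector_derivative f' v) (at t)"
proof -
  have "f' (r *\<^sub>R v) = r *\<^sub>R f' v" for r
    by (rule linear_scale[OF has_derivative_linear[OF assms(2)]])
  then show ?thesis
    using diff_chain_at[OF assms(1)[unfolded has_vector_derivative_def] assms(2)]
    by (simp add: has_vector_derivative_def o_def)
qed

text \<open>The mean value theorem, applied once in each of the directions \<^term>\<open>u\<close> and \<^term>\<open>v\<close>, turns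
  the second difference quotient of \<^term>\<open>f\<close> into an iterated derivative at some point of the
  parallelogram spanned by \<^term>\<open>t *\<^sub>R u\<close> and \<^term>\<open>t *\<^sub>R v\<close>.\<close>

lemma second_difference_mean_value:
  fixes f :: "'a::euclidean_space \<Rightarrow> real"
  assumes "smooth_on S f" "0 < t"
    and S: "\<And>a b. 0 \<le> a \<Longrightarrow> a \<le> t \<Longrightarrow> 0 \<le> b \<Longrightarrow> b \<le> t \<Longrightarrow> x + a *\<^sub>R u + b *\<^sub>R v \<in> S"
  obtains a b where "0 \<le> a" "a \<le> t" "0 \<le> b" "b \<le> t"
    and "f (x + t *\<^sub>R u + t *\<^sub>R v) - f (x + t *\<^sub>R u) - f (x + t *\<^sub>R v) + f x =
      t * t * frechet_derivative (\<lambda>z. frechet_derivative f (at z) u) (at (x + a *\<^sub>R u + b *\<^sub>R v)) v"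
proof -
  let ?D = "\<lambda>w z. frechet_derivative f (at z) w"
  have D: "(f has_derivative frechet_derivative f (at z)) (at z)" if "z \<in> S" for z
    using smooth_on_has_derivative[OF assms(1) that] .
  have DD: "(?D u has_derivative frechet_derivative (?D u) (at z)) (at z)" if "z \<in> S" for z
    using smooth_on_has_derivative[OF smooth_on_frechet_derivative[OF assms(1)] that] .
  have line: "((\<lambda>a. h (c + a *\<^sub>R w)) has_real_derivative h' w) (at a)"
    if "(h has_derivative h') (at (c + a *\<^sub>R w))" for h :: "'a \<Rightarrow> real" and h' c a w
  proof -
    have "((\<lambda>a. h (c + a *\<^sub>R w)) has_derivative (\<lambda>s. h' (s *\<^sub>R w))) (at a)"
    proof -
      have "((\<lambda>a. c + a *\<^sub>R w) has_derivative (\<lambda>s. s *\<^sub>R w)) (at a)"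
        by (auto intro!: derivative_eq_intros)
      from diff_chain_at[OF this that] show ?thesis by (simp add: o_def)
    qed
    moreover have "h' (s *\<^sub>R w) = h' w * s" for s
      using linear_scale[OF has_derivative_linear[OF that]] by simp
    ultimately show ?thesis by (simp add: has_field_derivative_def)
  qed
  have 1: "((\<lambda>a. f (x + a *\<^sub>R u + t *\<^sub>R v) - f (x + a *\<^sub>R u)) has_real_derivative
      (?D u (x + a *\<^sub>R u + t *\<^sub>R v) - ?D u (x + a *\<^sub>R u))) (at a)" if "0 \<le> a" "a \<le> t" for a
  proof -
    have swap: "x + t *\<^sub>R v + a *\<^sub>R u = x + a *\<^sub>R u + t *\<^sub>R v" for a by simp
    have "((\<lambda>a. f (x + a *\<^sub>R u + t *\<^sub>R v)) has_real_derivative ?D u (x + a *\<^sub>R u + t *\<^sub>R v)) (at a)"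
      using line[of f _ "x + t *\<^sub>R v" a u, OF D] S[of a t] that assms(2)
      unfolding swap by simp
    moreover have "((\<lambda>a. f (x + a *\<^sub>R u)) has_real_derivative ?D u (x + a *\<^sub>R u)) (at a)"
      using line[of f _ x a u, OF D] S[of a 0] that assms(2) by simp
    ultimately show ?thesis by (rule DERIV_diff)
  qed
  obtain a where a: "0 < a" "a < t"
    "f (x + t *\<^sub>R u + t *\<^sub>R v) - f (x + t *\<^sub>R u) - (f (x + 0 *\<^sub>R u + t *\<^sub>R v) - f (x + 0 *\<^sub>R u)) =
      (t - 0) * (?D u (x + a *\<^sub>R u + t *\<^sub>R v) - ?D u (x + a *\<^sub>R u))"
    using MVT2[OF assms(2) 1] by blast
  have 2: "((\<lambda>b. ?D u (x + a *\<^sub>R u + b *\<^sub>R v)) has_real_derivative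
      frechet_derivative (?D u) (at (x + a *\<^sub>R u + b *\<^sub>R v)) v) (at b)" if "0 \<le> b" "b \<le> t" for b
    using line[of "?D u" _ "x + a *\<^sub>R u" b v, OF DD] S[of a b] a that by simp
  obtain b where b: "0 < b" "b < t"
    "?D u (x + a *\<^sub>R u + t *\<^sub>R v) - ?D u (x + a *\<^sub>R u + 0 *\<^sub>R v) =
      (t - 0) * frechet_derivative (?D u) (at (x + a *\<^sub>R u + b *\<^sub>R v)) v"
    using MVT2[OF assms(2) 2] by blast
  show ?thesis
    using a b by (intro that[of a b]) auto
qed

text \<open>The second difference quotient is symmetric in \<^term>\<open>u\<close> and \<^term>\<open>v\<close>, and by continuity both
  iterated derivatives are its limit when the parallelogram shrinks to \<^term>\<open>x\<close>.\<close>

lemma frechet_derivative_commute: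
  fixes f :: "'a::euclidean_space \<Rightarrow> real"
  assumes "open S" "smooth_on S f" "x \<in> S"
  shows "frechet_derivative (\<lambda>z. frechet_derivative f (at z) u) (at x) v =
         frechet_derivative (\<lambda>z. frechet_derivative f (at z) v) (at x) u"
proof -
  let ?H = "\<lambda>u v x. frechet_derivative (\<lambda>z. frechet_derivative f (at z) u) (at x) v"
  have cont: "isCont (?H u v) x" for u v
    using smooth_on_continuous_on[OF smooth_on_frechet_derivative[OF
          smooth_on_frechet_derivative[OF assms(2)]]] assms(1,3)
    by (simp add: continuous_on_eq_continuous_at)
  have "\<bar>?H u v x - ?H v u x\<bar> < e" if "0 < e" for e
  proof -
    have lim: "(?H u v \<longlongrightarrow> ?H u v x) (nhds x)" for u v
      using cont[of u v] unfolding isCont_def by (rule iffD1[OF tendsto_at_iff_tendsto_nhds])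
    have "\<forall>\<^sub>F z in nhds x. \<bar>?H u v z - ?H u v x\<bar> < e/2 \<and> \<bar>?H v u z - ?H v u x\<bar> < e/2 \<and> z \<in> S"
      using tendstoD[OF lim[of u v], of "e/2"] tendstoD[OF lim[of v u], of "e/2"] that
        eventually_nhds_in_open[OF assms(1,3)]
      by (simp add: dist_real_def eventually_conj)
    then obtain d where d: "0 < d" and
      near: "\<And>z. dist z x < d \<Longrightarrow>
        \<bar>?H u v z - ?H u v x\<bar> < e/2 \<and> \<bar>?H v u z - ?H v u x\<bar> < e/2 \<and> z \<in> S"
      unfolding eventually_nhds_metric by blast
    define t where "t = d / (2 * (norm u + norm v + 1))"
    have t: "0 < t" using d by (simp add: t_def add_nonneg_pos)
    have close: "dist (x + a *\<^sub>R u + b *\<^sub>R v) x < d"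
      if "0 \<le> a" "a \<le> t" "0 \<le> b" "b \<le> t" for a b
    proof -
      have "dist (x + a *\<^sub>R u + b *\<^sub>R v) x \<le> a * norm u + b * norm v"
        using norm_triangle_ineq[of "a *\<^sub>R u" "b *\<^sub>R v"] that by (simp add: dist_norm algebra_simps)
      also have "\<dots> \<le> t * (norm u + norm v + 1)"
        using mult_right_mono[of a t "norm u"] mult_right_mono[of b t "norm v"] that t
        by (simp add: distrib_left)
      also have "\<dots> = d / 2"
      proof -
        have "norm u + norm v + 1 \<noteq> 0"
          using norm_ge_zero[of u] norm_ge_zero[of v] by linarith
        then show ?thesis unfolding t_def by (metis (no_types) divide_divide_eq_left'
              nonzero_eq_divide_eq mult.commute)
      qed
      finally show ?thesis using d by simp
    qed
    then have close': "dist (x + a *\<^sub>R v + b *\<^sub>R u) x < d"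
      if "0 \<le> a" "a \<le> t" "0 \<le> b" "b \<le> t" for a b
      using that by (simp add: add.assoc add.commute[of "a *\<^sub>R v"])
    obtain a b where ab: "0 \<le> a" "a \<le> t" "0 \<le> b" "b \<le> t"
      and eq1: "f (x + t *\<^sub>R u + t *\<^sub>R v) - f (x + t *\<^sub>R u) - f (x + t *\<^sub>R v) + f x =
        t * t * ?H u v (x + a *\<^sub>R u + b *\<^sub>R v)"
      by (rule second_difference_mean_value[OF assms(2) t, of x u v]) (use close near in auto)
    obtain a' b' where ab': "0 \<le> a'" "a' \<le> t" "0 \<le> b'" "b' \<le> t"
      and eq2: "f (x + t *\<^sub>R v + t *\<^sub>R u) - f (x + t *\<^sub>R v) - f (x + t *\<^sub>R u) + f x =
        t * t * ?H v u (x + a' *\<^sub>R v + b' *\<^sub>R u)"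
      by (rule second_difference_mean_value[OF assms(2) t, of x v u]) (use close' near in auto)
    have "t * t * ?H u v (x + a *\<^sub>R u + b *\<^sub>R v) = t * t * ?H v u (x + a' *\<^sub>R v + b' *\<^sub>R u)"
      using eq1 eq2 by (simp add: algebra_simps)
    then have "?H u v (x + a *\<^sub>R u + b *\<^sub>R v) = ?H v u (x + a' *\<^sub>R v + b' *\<^sub>R u)"
      using t by simp
    then show ?thesis
      using near[OF close[OF ab]] near[OF close'[OF ab']] by linarith
  qed
  then show ?thesis by (metis abs_zero eq_iff_diff_eq_0 less_irrefl zero_less_abs_iff)
qed

section \<open>Integral curves\<close>

lemma smooth_on_lipschitz_on_compact_convex:
  fixes f :: "'a::euclidean_space \<Rightarrow> 'b::real_normed_vector"
  assumes "smooth_on S f" "B \<subseteq> S" "compact B" "convex B"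
  obtains K where "0 \<le> K" "\<And>x y. x \<in> B \<Longrightarrow> y \<in> B \<Longrightarrow> norm (f x - f y) \<le> K * norm (x - y)"
proof -
  have "\<exists>M. \<forall>x\<in>B. norm (frechet_derivative f (at x) b) \<le> M" for b
  proof -
    have "continuous_on B (\<lambda>x. frechet_derivative f (at x) b)"
      using smooth_on_continuous_on[OF smooth_on_frechet_derivative[OF assms(1)]] assms(2)
        continuous_on_subset by blast
    then have "bounded ((\<lambda>x. frechet_derivative f (at x) b) ` B)"
      using compact_continuous_image[OF _ assms(3)] compact_imp_bounded by blast
    then show ?thesis by (auto simp: bounded_iff)
  qed
  then obtain M where M: "\<And>b x. x \<in> B \<Longrightarrow> norm (frechet_derivative f (at x) b) \<le> M b"
    by metis
  define K where "K = (\<Sum>b\<in>Basis. \<bar>M b\<bar>)"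
  have D: "(f has_derivative frechet_derivative f (at x)) (at x)" if "x \<in> B" for x
    using smooth_on_has_derivative[OF assms(1)] assms(2) that by blast
  have bound: "onorm (frechet_derivative f (at x)) \<le> K" if x: "x \<in> B" for x
  proof (rule onorm_le)
    fix v
    have lin: "linear (frechet_derivative f (at x))"
      using D[OF x] has_derivative_linear by blast
    have "frechet_derivative f (at x) v = frechet_derivative f (at x) (\<Sum>b\<in>Basis. (v \<bullet> b) *\<^sub>R b)"
      by (simp only: euclidean_representation)
    also have "\<dots> = (\<Sum>b\<in>Basis. (v \<bullet> b) *\<^sub>R frechet_derivative f (at x) b)"
      by (simp add: linear_sum[OF lin] linear_scale[OF lin])
    also have "norm \<dots> \<le> (\<Sum>b\<in>Basis. norm v * \<bar>M b\<bar>)"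
    proof (rule sum_norm_le)
      fix b :: 'a assume "b \<in> Basis"
      then have "\<bar>v \<bullet> b\<bar> \<le> norm v" by (rule Basis_le_norm)
      moreover have "norm (frechet_derivative f (at x) b) \<le> \<bar>M b\<bar>"
        using M[OF x, of b] by linarith
      ultimately show "norm ((v \<bullet> b) *\<^sub>R frechet_derivative f (at x) b) \<le> norm v * \<bar>M b\<bar>"
        by (simp add: mult_mono)
    qed
    also have "\<dots> = K * norm v" by (simp add: K_def sum_distrib_left mult.commute)
    finally show "norm (frechet_derivative f (at x) v) \<le> K * norm v" .
  qed
  have "norm (f x - f y) \<le> K * norm (x - y)" if "x \<in> B" "y \<in> B" for x y
    using differentiable_bound[OF assms(4) has_derivative_at_withinI[OF D] bound that(2,1)]
    by (simp add: norm_minus_commute)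
  moreover have "0 \<le> K" by (simp add: K_def sum_nonneg)
  ultimately show ?thesis using that by blast
qed

text \<open>The estimate behind both facts that Picard iteration needs: applied to one integrand it keeps the
  curve in the ball, applied to a difference of two integrands it gives the contraction.\<close>

lemma norm_primitive_increment_le:
  fixes h :: "real \<Rightarrow> 'a::banach"
  assumes "\<And>s. s \<in> {-e..e} \<Longrightarrow> (J has_vector_derivative h s) (at s within {-e..e})"
    and "\<And>s. s \<in> {-e..e} \<Longrightarrow> norm (h s) \<le> C" and "t \<in> {-e..e}"
  shows "norm (J t - J 0) \<le> C * e"
proof -
  have e: "0 \<le> e" "\<bar>t\<bar> \<le> e" using assms(3) by auto
  have C: "0 \<le> C" using assms(2)[OF assms(3)] norm_ge_zero order_trans by blast
  have "norm (J t - J 0) \<le> C * norm (t - 0)"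
  proof (rule differentiable_bound[of "{-e..e}" J "\<lambda>s r. r *\<^sub>R h s"])
    show "(J has_derivative (\<lambda>r. r *\<^sub>R h s)) (at s within {-e..e})" if "s \<in> {-e..e}" for s
      using assms(1)[OF that] by (simp add: has_vector_derivative_def)
    show "onorm (\<lambda>r. r *\<^sub>R h s) \<le> C" if "s \<in> {-e..e}" for s
      using assms(2)[OF that]
      by (intro onorm_le) (simp add: mult.commute[of C] mult_left_mono)
  qed (use assms(3) e in auto)
  also have "\<dots> \<le> C * e" using C e by (simp add: mult_left_mono)
  finally show ?thesis .
qed

text \<open>Picard iteration. The vector field is first replaced by its composition with the projection
  to a closed ball around the initial point; this makes it bounded and globally Lipschitz, so that
  for short times the integral operator is a contraction of the whole space of bounded continuous curves, and its
  fixed point does not leave the ball, where nothing was changed. Curves are extended by constants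
  outside the time interval.\<close>

lemma integral_curve_through_point_exists:
  fixes f :: "'a::euclidean_space \<Rightarrow> 'a"
  assumes "open S" "smooth_on S f" "x0 \<in> S"
  obtains e \<gamma> where "0 < e" "\<gamma> 0 = x0" "\<And>t. t \<in> {-e<..<e} \<Longrightarrow> \<gamma> t \<in> S"
    and "\<And>t. t \<in> {-e<..<e} \<Longrightarrow> (\<gamma> has_vector_derivative f (\<gamma> t)) (at t)"
proof -
  obtain r where r: "0 < r" "cball x0 r \<subseteq> S"
    using assms(1,3) open_contains_cball by blast
  let ?B = "cball x0 r"
  obtain K where K: "0 \<le> K"
    "\<And>x y. x \<in> ?B \<Longrightarrow> y \<in> ?B \<Longrightarrow> norm (f x - f y) \<le> K * norm (x - y)"
    using smooth_on_lipschitz_on_compact_convex[OF assms(2) r(2)] by auto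
  have "bounded (f ` ?B)"
    using compact_continuous_image[of ?B f] continuous_on_subset[OF smooth_on_continuous_on[OF
          assms(2)] r(2)] compact_imp_bounded by auto
  then obtain M where M: "0 < M" "\<And>x. x \<in> ?B \<Longrightarrow> norm (f x) \<le> M"
    unfolding bounded_pos by auto
  define Y where "Y z = f (closest_point ?B z)" for z
  have proj: "closest_point ?B z \<in> ?B" for z
    using r(1) by (intro closest_point_in_set) auto
  have Y_lip: "norm (Y z - Y w) \<le> K * norm (z - w)" for z w
  proof -
    have "norm (Y z - Y w) \<le> K * norm (closest_point ?B z - closest_point ?B w)"
      unfolding Y_def by (rule K(2)[OF proj proj])
    also have "\<dots> \<le> K * norm (z - w)"
      using closest_point_lipschitz[of ?B z w] r(1) K(1) by (simp add: dist_norm mult_left_mono)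
    finally show ?thesis .
  qed
  have Y_bound: "norm (Y z) \<le> M" for z unfolding Y_def by (rule M(2)[OF proj])
  have "continuous_on ?B f"
    using continuous_on_subset[OF smooth_on_continuous_on[OF assms(2)] r(2)] .
  moreover have "continuous_on UNIV (closest_point ?B)"
    using r(1) by (intro continuous_on_closest_point) auto
  ultimately have Y_cont: "continuous_on UNIV Y"
    unfolding Y_def by (rule continuous_on_compose2) (use proj in blast)
  \<comment> \<open>The first bound keeps the curve in the ball, the second one makes the integral operator a
    contraction with constant \<open>1/2\<close>.\<close>
  define e where "e = min (r / M) (1 / (2 * (K + 1)))"
  have e: "0 < e" "M * e \<le> r" "K * e \<le> 1/2"
  proof -
    show "0 < e" using r(1) M(1) K(1) by (simp add: e_def)
    have "e \<le> r / M" by (simp add: e_def)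
    then show "M * e \<le> r" using M(1) by (simp add: pos_le_divide_eq mult.commute)
    have "e \<le> 1 / (2 * (K + 1))" by (simp add: e_def)
    then have "e * (2 * (K + 1)) \<le> 1" using K(1) by (simp add: pos_le_divide_eq)
    then show "K * e \<le> 1/2" using \<open>0 < e\<close> by (simp add: algebra_simps)
  qed
  define c where "c t = max (-e) (min e t)" for t
  have c: "c t \<in> {-e..e}" for t using e(1) by (auto simp: c_def)
  have c_id: "c t = t" if "t \<in> {-e..e}" for t using that by (auto simp: c_def)
  have c_cont: "continuous_on UNIV c" unfolding c_def by (intro continuous_intros)
  define J where "J \<gamma> t = integral {-e..t} (\<lambda>s. Y (apply_bcontfun \<gamma> s))"
    for \<gamma> :: "real \<Rightarrow>\<^sub>C 'a" and t
  define T where "T \<gamma> t = x0 + (J \<gamma> (c t) - J \<gamma> 0)" for \<gamma> t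
  have J_deriv: "(J \<gamma> has_vector_derivative Y (apply_bcontfun \<gamma> t)) (at t within {-e..e})"
    if "t \<in> {-e..e}" for \<gamma> t
  proof -
    have "continuous_on {-e..e} (\<lambda>s. Y (apply_bcontfun \<gamma> s))"
      by (rule continuous_on_compose2[OF Y_cont]) auto
    from integral_has_vector_derivative[OF this that] show ?thesis
      unfolding J_def .
  qed
  have T_near: "norm (T \<gamma> t - x0) \<le> r" for \<gamma> t
    using norm_primitive_increment_le[OF J_deriv Y_bound c, of \<gamma> t] e(2) by (simp add: T_def)
  have T_cont: "continuous_on UNIV (T \<gamma>)" for \<gamma>
  proof -
    have "continuous_on {-e..e} (J \<gamma>)" using J_deriv by (rule continuous_on_vector_derivative)
    then have "continuous_on UNIV (\<lambda>t. J \<gamma> (c t))"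
      using c_cont by (rule continuous_on_compose2) (use c in blast)
    then show ?thesis unfolding T_def by (intro continuous_intros)
  qed
  have T_bcontfun: "T \<gamma> \<in> bcontfun" for \<gamma>
  proof (rule bcontfun_normI[OF T_cont])
    show "norm (T \<gamma> t) \<le> norm x0 + r" for t
      using T_near[of \<gamma> t] norm_triangle_ineq[of x0 "T \<gamma> t - x0"] by simp
  qed
  define P where "P \<gamma> = Bcontfun (T \<gamma>)" for \<gamma>
  have P: "apply_bcontfun (P \<gamma>) = T \<gamma>" for \<gamma>
    unfolding P_def by (rule Bcontfun_inverse[OF T_bcontfun])
  have contraction: "dist (P \<gamma>) (P \<eta>) \<le> 1/2 * dist \<gamma> \<eta>" for \<gamma> \<eta>
  proof (rule dist_bound)
    fix t
    have diff_bound: "norm (Y (apply_bcontfun \<gamma> s) - Y (apply_bcontfun \<eta> s)) \<le> K * dist \<gamma> \<eta>" for s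
      using Y_lip[of "apply_bcontfun \<gamma> s" "apply_bcontfun \<eta> s"] dist_bounded[of \<gamma> s \<eta>] K(1)
      by (smt (verit) dist_norm mult_left_mono)
    have diff_deriv: "((\<lambda>s. J \<gamma> s - J \<eta> s) has_vector_derivative
        Y (apply_bcontfun \<gamma> s) - Y (apply_bcontfun \<eta> s)) (at s within {-e..e})"
      if "s \<in> {-e..e}" for s
      by (intro has_vector_derivative_diff J_deriv that)
    have "norm ((J \<gamma> (c t) - J \<eta> (c t)) - (J \<gamma> 0 - J \<eta> 0)) \<le> K * dist \<gamma> \<eta> * e"
      by (rule norm_primitive_increment_le[OF diff_deriv diff_bound c])
    also have "\<dots> \<le> 1/2 * dist \<gamma> \<eta>"
      using mult_right_mono[OF e(3), of "dist \<gamma> \<eta>"] by (simp add: ac_simps)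
    finally show "dist (apply_bcontfun (P \<gamma>) t) (apply_bcontfun (P \<eta>) t) \<le> 1/2 * dist \<gamma> \<eta>"
      by (simp add: P T_def dist_norm algebra_simps)
  qed
  obtain \<gamma> where \<gamma>: "P \<gamma> = \<gamma>"
    using banach_fix_type[of "1/2" P] contraction by auto
  have fixed: "apply_bcontfun \<gamma> t = T \<gamma> t" for t using P[of \<gamma>] \<gamma> by simp
  have in_B: "apply_bcontfun \<gamma> t \<in> ?B" for t
    using T_near[of \<gamma> t] by (simp add: fixed dist_norm norm_minus_commute)
  have "(apply_bcontfun \<gamma> has_vector_derivative f (apply_bcontfun \<gamma> t)) (at t)"
    if t: "t \<in> {-e<..<e}" for t
  proof -
    have "t \<in> interior {-e..e}" using t by simp
    then have "(J \<gamma> has_vector_derivative Y (apply_bcontfun \<gamma> t)) (at t)"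
      using J_deriv[of t \<gamma>] t unfolding at_within_interior[OF \<open>t \<in> interior {-e..e}\<close>] by auto
    then have "((\<lambda>s. x0 + (J \<gamma> s - J \<gamma> 0)) has_vector_derivative Y (apply_bcontfun \<gamma> t)) (at t)"
      by (auto intro!: derivative_eq_intros)
    moreover have "x0 + (J \<gamma> s - J \<gamma> 0) = apply_bcontfun \<gamma> s" if "s \<in> {-e<..<e}" for s
      using that by (simp add: fixed T_def c_id)
    ultimately have "(apply_bcontfun \<gamma> has_vector_derivative Y (apply_bcontfun \<gamma> t)) (at t)"
      by (rule has_vector_derivative_transform_within_open[OF _ open_greaterThanLessThan t])
    moreover have "Y (apply_bcontfun \<gamma> t) = f (apply_bcontfun \<gamma> t)"
      using in_B by (simp add: Y_def closest_point_self)
    ultimately show ?thesis by simp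
  qed
  moreover have "apply_bcontfun \<gamma> 0 = x0" using e(1) by (simp add: fixed T_def c_id)
  moreover have "apply_bcontfun \<gamma> t \<in> S" for t using in_B r(2) by (rule subsetD[rotated])
  ultimately show ?thesis by (intro that[of e "apply_bcontfun \<gamma>"] e(1))
qed

section \<open>Linear algebra of metric coefficients\<close>

definition pos_def_matrix :: "real ^ 'n ^ 'n \<Rightarrow> bool" where
  "pos_def_matrix M \<longleftrightarrow> (\<forall>w. w \<noteq> 0 \<longrightarrow> 0 < (\<Sum>i\<in>UNIV. \<Sum>j\<in>UNIV. M $ i $ j * w $ i * w $ j))"

lemma pos_def_matrix_invertible:
  fixes M :: "real ^ 'n::finite ^ 'n"
  assumes "pos_def_matrix M"
  shows "invertible M"
proof -
  have "w = 0" if "M *v w = 0" for w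
  proof (rule ccontr)
    assume "w \<noteq> 0"
    then have "0 < (\<Sum>i\<in>UNIV. \<Sum>j\<in>UNIV. M $ i $ j * w $ i * w $ j)"
      using assms by (simp add: pos_def_matrix_def)
    also have "\<dots> = (\<Sum>i\<in>UNIV. (M *v w) $ i * w $ i)"
      by (simp add: matrix_vector_mult_def sum_distrib_right sum_distrib_left ac_simps)
    also have "\<dots> = 0" by (simp add: that)
    finally show False by simp
  qed
  then show ?thesis
    using matrix_left_invertible_ker invertible_left_inverse by metis
qed

lemma matrix_inv_both:
  assumes "invertible M"
  shows "M ** matrix_inv M = mat 1" "matrix_inv M ** M = mat 1"
proof -
  have "\<exists>B. M ** B = mat 1 \<and> B ** M = mat 1" using assms by (simp add: invertible_def)
  from someI_ex[OF this] show "M ** matrix_inv M = mat 1" "matrix_inv M ** M = mat 1"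
    by (simp_all add: matrix_inv_def)
qed

lemma matrix_inv_index:
  fixes M :: "real ^ 'n::finite ^ 'n"
  assumes "invertible M"
  shows "(\<Sum>s\<in>UNIV. M $ i $ s * matrix_inv M $ s $ j) = (if i = j then 1 else 0)"
    and "(\<Sum>s\<in>UNIV. matrix_inv M $ i $ s * M $ s $ j) = (if i = j then 1 else 0)"
proof -
  have "(M ** matrix_inv M) $ i $ j = (if i = j then 1 else 0)"
    "(matrix_inv M ** M) $ i $ j = (if i = j then 1 else 0)"
    using matrix_inv_both[OF assms] by (simp_all add: mat_def)
  then show "(\<Sum>s\<in>UNIV. M $ i $ s * matrix_inv M $ s $ j) = (if i = j then 1 else 0)"
    "(\<Sum>s\<in>UNIV. matrix_inv M $ i $ s * M $ s $ j) = (if i = j then 1 else 0)"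
    by (simp_all add: matrix_matrix_mult_def)
qed

lemma sum_delta_mult:
  fixes f :: "'n::finite \<Rightarrow> real"
  shows "(\<Sum>i\<in>UNIV. (if i = k then 1 else 0) * f i) = f k"
    and "(\<Sum>i\<in>UNIV. (if k = i then 1 else 0) * f i) = f k"
    and "(\<Sum>i\<in>UNIV. f i * (if i = k then 1 else 0)) = f k"
    and "(\<Sum>i\<in>UNIV. f i * (if k = i then 1 else 0)) = f k"
  by (simp_all add: if_distrib if_distribR cong: if_cong)

lemma lower_raised_index:
  fixes M :: "real ^ 'n::finite ^ 'n"
  assumes "invertible M"
  shows "(\<Sum>i\<in>UNIV. M $ a $ i * (\<Sum>s\<in>UNIV. matrix_inv M $ i $ s / 2 * c s)) = c a / 2"
proof -
  have "(\<Sum>i\<in>UNIV. M $ a $ i * (\<Sum>s\<in>UNIV. matrix_inv M $ i $ s / 2 * c s)) =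
        (\<Sum>i\<in>UNIV. \<Sum>s\<in>UNIV. (M $ a $ i * matrix_inv M $ i $ s) * (c s / 2))"
    by (simp add: sum_distrib_left ac_simps)
  also have "\<dots> = (\<Sum>s\<in>UNIV. (\<Sum>i\<in>UNIV. M $ a $ i * matrix_inv M $ i $ s) * (c s / 2))"
    unfolding sum_distrib_right by (rule sum.swap)
  also have "\<dots> = c a / 2" by (simp only: matrix_inv_index[OF assms] sum_delta_mult)
  finally show ?thesis .
qed

text \<open>Tensor identities are checked with all indices lowered, where the inverse matrix in the connection
  coefficients has disappeared; the metric is invertible, so nothing is lost.\<close>

lemma lowered_index_eqD:
  fixes M :: "real ^ 'n::finite ^ 'n"
  assumes "invertible M" "\<And>a. (\<Sum>i\<in>UNIV. M $ a $ i * u i) = (\<Sum>i\<in>UNIV. M $ a $ i * w i)"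
  shows "u k = w k"
proof -
  have raise: "(\<Sum>a\<in>UNIV. matrix_inv M $ k $ a * (\<Sum>i\<in>UNIV. M $ a $ i * f i)) = f k" for f
  proof -
    have "(\<Sum>a\<in>UNIV. matrix_inv M $ k $ a * (\<Sum>i\<in>UNIV. M $ a $ i * f i)) =
      (\<Sum>i\<in>UNIV. (\<Sum>a\<in>UNIV. matrix_inv M $ k $ a * M $ a $ i) * f i)"
      unfolding sum_distrib_left sum_distrib_right
      by (subst sum.swap) (simp add: ac_simps)
    then show ?thesis by (simp only: matrix_inv_index[OF assms(1)] sum_delta_mult)
  qed
  show ?thesis using raise[of u] raise[of w] assms(2) by simp
qed

text \<open>By Cramer's rule the entries of the inverse are quotients of polynomials in the entries.\<close>

lemma matrix_inv_cramer:
  fixes M :: "real ^ 'n::finite ^ 'n"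
  assumes "invertible M"
  shows "matrix_inv M $ k $ l =
    det (\<chi> i j. if j = k then (if i = l then 1 else 0) else M $ i $ j) / det M"
proof -
  have "M *v (matrix_inv M *v axis l 1) = axis l 1"
    by (simp add: matrix_vector_mul_assoc matrix_inv_both(1)[OF assms])
  then have "(matrix_inv M *v axis l 1) $ k =
      det (\<chi> i j. if j = k then axis l 1 $ i else M $ i $ j) / det M"
    using cramer[of M "matrix_inv M *v axis l 1" "axis l 1"] assms
    by (simp add: invertible_det_nz)
  moreover have "(matrix_inv M *v axis l 1) $ k = matrix_inv M $ k $ l"
    by (simp add: matrix_vector_mult_basis column_def)
  moreover have "axis l (1::real) $ i = (if i = l then 1 else 0)" for i
    by (simp add: axis_def)
  ultimately show ?thesis by (simp only:)
qed

lemma smooth_on_det: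
  fixes a :: "'n::finite \<Rightarrow> 'n \<Rightarrow> 'a::euclidean_space \<Rightarrow> real"
  assumes "open S" "\<And>i j. smooth_on S (a i j)"
  shows "smooth_on S (\<lambda>x. det (\<chi> i j. a i j x))"
  unfolding det_def
  using assms
  by (auto intro!: smooth_on_sum smooth_on_mult smooth_on_const smooth_on_prod)

lemma smooth_on_matrix_inv:
  fixes a :: "'n::finite \<Rightarrow> 'n \<Rightarrow> 'a::euclidean_space \<Rightarrow> real"
  assumes "open S" "\<And>i j. smooth_on S (a i j)"
    and inv: "\<And>x. x \<in> S \<Longrightarrow> invertible (\<chi> i j. a i j x)"
  shows "smooth_on S (\<lambda>x. matrix_inv (\<chi> i j. a i j x) $ k $ l)"
proof -
  let ?b = "\<lambda>i j x. if j = k then (if i = l then 1 else 0) else a i j x"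
  have "smooth_on S (?b i j)" for i j
    using assms(2)[of i j] by (cases "j = k") (auto intro: smooth_on_const)
  then have "smooth_on S (\<lambda>x. det (\<chi> i j. ?b i j x) / det (\<chi> i j. a i j x))"
    using assms inv invertible_det_nz
    by (intro smooth_on_divide[OF assms(1)] smooth_on_det[OF assms(1)]) blast+
  then show ?thesis
    by (rule smooth_on_cong[OF assms(1)]) (simp only: matrix_inv_cramer[OF inv] vec_lambda_beta)
qed

section \<open>Levi-Civita coefficients and curvature\<close>

text \<open>The common shape of the Christoffel symbols of a Riemannian metric and of the coefficients of
  the Chern connection: \<^term>\<open>d k i j\<close> stands for the derivative of the metric coefficient of
  index \<open>i, j\<close> in direction \<open>k\<close>, along the coordinate or the horizontal frame.\<close>

definition levi_civita_coeff ::
    "real ^ 'n ^ 'n \<Rightarrow> ('n \<Rightarrow> 'n \<Rightarrow> 'n \<Rightarrow> real) \<Rightarrow> 'n \<Rightarrow> 'n \<Rightarrow> 'n::finite \<Rightarrow> real" where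
  "levi_civita_coeff M d i j k =
     (\<Sum>s\<in>UNIV. matrix_inv M $ i $ s / 2 * (d k s j - d s j k + d j k s))"

lemma levi_civita_coeff_lower:
  assumes "invertible M"
  shows "(\<Sum>i\<in>UNIV. M $ a $ i * levi_civita_coeff M d i j k) = (d k a j - d a j k + d j k a) / 2"
  unfolding levi_civita_coeff_def by (rule lower_raised_index[OF assms])

lemma levi_civita_coeff_commute:
  assumes "\<And>k i j. d k i j = d k j i"
  shows "levi_civita_coeff M d i j k = levi_civita_coeff M d i k j"
  unfolding levi_civita_coeff_def
proof (rule sum.cong[OF refl])
  fix s
  show "matrix_inv M $ i $ s / 2 * (d k s j - d s j k + d j k s) =
    matrix_inv M $ i $ s / 2 * (d j s k - d s k j + d k j s)"
    using assms[of k s j] assms[of s j k] assms[of j k s] by simp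
qed

text \<open>The connection is compatible with the metric. Only the defining formula enters, so this holds for
  the coordinate frame of a Riemannian metric and for the horizontal frame of a Finsler function.\<close>

lemma levi_civita_coeff_metric:
  assumes "invertible M" "\<And>k i j. d k i j = d k j i"
  shows "d k i j = (\<Sum>s\<in>UNIV. M $ i $ s * levi_civita_coeff M d s j k) +
    (\<Sum>s\<in>UNIV. M $ j $ s * levi_civita_coeff M d s i k)"
  unfolding levi_civita_coeff_lower[OF assms(1)]
  using assms(2)[of k j i] assms(2)[of i j k] assms(2)[of j k i] by (simp add: field_simps)

text \<open>Curvature of the connection with coefficients \<^term>\<open>G\<close>; \<^term>\<open>dG k i j l\<close> is the derivative
  of \<^term>\<open>G i j l\<close> in direction \<^term>\<open>k\<close>.\<close>

definition conn_curvature :: "('n \<Rightarrow> 'n \<Rightarrow> 'n \<Rightarrow> 'n \<Rightarrow> real) \<Rightarrow> ('n \<Rightarrow> 'n \<Rightarrow> 'n \<Rightarrow> real) \<Rightarrow>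
    'n \<Rightarrow> 'n \<Rightarrow> 'n \<Rightarrow> 'n::finite \<Rightarrow> real" where
  "conn_curvature dG G i j k l = dG k i j l - dG l i j k
     + (\<Sum>m\<in>UNIV. G i m k * G m j l) - (\<Sum>m\<in>UNIV. G i m l * G m j k)"

lemma conn_curvature_antisym: "conn_curvature dG G i j k l = - conn_curvature dG G i j l k"
  by (simp add: conn_curvature_def)

lemma conn_curvature_bianchi:
  assumes "\<And>i j k. G i j k = G i k j" "\<And>l i j k. dG l i j k = dG l i k j"
  shows "conn_curvature dG G i j k l + conn_curvature dG G i k l j + conn_curvature dG G i l j k = 0"
proof -
  have "(\<Sum>m\<in>UNIV. G i m a * G m b c) = (\<Sum>m\<in>UNIV. G i m a * G m c b)" for a b c
    using assms(1) by metis
  from this[of k j l] this[of l j k] this[of j k l] assms(2)[of k i j l] assms(2)[of l i j k]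
    assms(2)[of j i k l]
  show ?thesis by (simp add: conn_curvature_def)
qed

text \<open>The octahedron argument: the four Bianchi identities in which one of the indices is kept in
  front combine into the symmetry under exchange of the two pairs.\<close>

lemma curvature_pair_symmetry:
  fixes R :: "'n \<Rightarrow> 'n \<Rightarrow> 'n \<Rightarrow> 'n \<Rightarrow> real"
  assumes "\<And>i j k l. R i j k l = - R i j l k" "\<And>i j k l. R i j k l = - R j i k l"
    and "\<And>i j k l. R i j k l + R i k l j + R i l j k = 0"
  shows "R i j k l = R k l i j"
proof -
  note flip = assms(1)[of i k l j] assms(1)[of j k l i] assms(2)[of j i k l] assms(2)[of k i j l]
    assms(1)[of k j l i] assms(2)[of k j i l] assms(2)[of l i j k] assms(1)[of l j k i]
    assms(2)[of l j i k] assms(2)[of l k i j]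
  have "R i j k l - R i k j l + R i l j k = 0" using assms(3)[of i j k l] flip by linarith
  moreover have "- R j k i l + R j l i k - R i j k l = 0" using assms(3)[of j k l i] flip by linarith
  moreover have "R k l i j - R i k j l + R j k i l = 0" using assms(3)[of k l i j] flip by linarith
  moreover have "- R i l j k + R j l i k - R k l i j = 0" using assms(3)[of l i j k] flip by linarith
  ultimately show ?thesis by linarith
qed

text \<open>Differentiating the compatibility of metric and connection once more expresses the second derivatives
  of the metric by the connection. The commutator of these second derivatives, which vanishes by the
  last assumption, is the part of the lowered curvature symmetric in the first two indices: the terms
  quadratic in the connection coefficients cancel.\<close>

lemma lowered_curvature_antisym:
  fixes M :: "real ^ 'n::finite ^ 'n"
  assumes G: "\<And>i j k. d k i j = (\<Sum>s\<in>UNIV. M $ i $ s * G s j k) + (\<Sum>s\<in>UNIV. M $ j $ s * G s i k)"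
    and M: "\<And>i j. M $ i $ j = M $ j $ i"
    and dd: "\<And>k l i j. (\<Sum>s\<in>UNIV. d k i s * G s j l + M $ i $ s * dG k s j l)
        + (\<Sum>s\<in>UNIV. d k j s * G s i l + M $ j $ s * dG k s i l)
      = (\<Sum>s\<in>UNIV. d l i s * G s j k + M $ i $ s * dG l s j k)
        + (\<Sum>s\<in>UNIV. d l j s * G s i k + M $ j $ s * dG l s i k)"
  shows "(\<Sum>a\<in>UNIV. M $ i $ a * conn_curvature dG G a j k l) =
       - (\<Sum>a\<in>UNIV. M $ j $ a * conn_curvature dG G a i k l)"
proof -
  define Q where "Q i j k l = (\<Sum>a\<in>UNIV. \<Sum>m\<in>UNIV. M $ i $ a * (G a m k * G m j l))" for i j k l
  define E where "E i k j l = (\<Sum>s\<in>UNIV. \<Sum>a\<in>UNIV. M $ s $ a * (G a i k * G s j l))" for i j k l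
  define D where "D k i j l = (\<Sum>s\<in>UNIV. M $ i $ s * dG k s j l)" for k i j l
  have curv: "(\<Sum>a\<in>UNIV. M $ i $ a * conn_curvature dG G a j k l) =
      D k i j l - D l i j k + Q i j k l - Q i j l k" for i j k l
    unfolding conn_curvature_def D_def Q_def
    by (simp add: algebra_simps sum.distrib sum_subtractf sum_distrib_left)
  have first: "(\<Sum>s\<in>UNIV. d k i s * G s j l + M $ i $ s * dG k s j l) =
      Q i j k l + E i k j l + D k i j l" for i j k l
  proof -
    have "(\<Sum>s\<in>UNIV. d k i s * G s j l) =
      (\<Sum>s\<in>UNIV. \<Sum>a\<in>UNIV. M $ i $ a * (G a s k * G s j l)) + E i k j l"
      unfolding G E_def
      by (simp add: algebra_simps sum.distrib sum_distrib_left)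
    also have "(\<Sum>s\<in>UNIV. \<Sum>a\<in>UNIV. M $ i $ a * (G a s k * G s j l)) = Q i j k l"
      unfolding Q_def by (rule sum.swap)
    finally show ?thesis by (simp add: D_def sum.distrib)
  qed
  have E_swap: "E i k j l = E j l i k" for i j k l
    unfolding E_def by (subst sum.swap) (simp add: M ac_simps)
  have "Q i j k l + E i k j l + D k i j l + (Q j i k l + E j k i l + D k j i l) =
    Q i j l k + E i l j k + D l i j k + (Q j i l k + E j l i k + D l j i k)"
    using dd[of k i j l] unfolding first .
  then show ?thesis
    unfolding curv using E_swap[of i k j l] E_swap[of i l j k] by linarith
qed

section \<open>Derivatives in coordinate directions\<close>

lemma frechet_derivative_cong_open:
  assumes "open S" "x \<in> S" "\<And>z. z \<in> S \<Longrightarrow> f z = g z"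
  shows "frechet_derivative f (at x) = frechet_derivative g (at x)"
proof -
  have "(f has_derivative f') (at x) \<longleftrightarrow> (g has_derivative f') (at x)" for f'
    using has_derivative_transform_within_open[of f f' x UNIV S g]
      has_derivative_transform_within_open[of g f' x UNIV S f] assms by auto
  then show ?thesis by (simp add: frechet_derivative_def)
qed

lemma pd_cong:
  assumes "open S" "x \<in> S" "\<And>z. z \<in> S \<Longrightarrow> f z = g z"
  shows "pd k f x = pd k g x"
  unfolding pd_def by (simp only: frechet_derivative_cong_open[OF assms])

lemma frechet_derivative_add_apply:
  assumes "f differentiable (at x)" "g differentiable (at x)"
  shows "frechet_derivative (\<lambda>z. f z + g z) (at x) v =
    frechet_derivative f (at x) v + frechet_derivative g (at x) v"
  unfolding frechet_derivative_at[OF has_derivative_add[OF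
        assms[unfolded frechet_derivative_works]], symmetric] ..

lemma frechet_derivative_mult_apply:
  fixes f g :: "_ \<Rightarrow> real"
  assumes "f differentiable (at x)" "g differentiable (at x)"
  shows "frechet_derivative (\<lambda>z. f z * g z) (at x) v =
    frechet_derivative f (at x) v * g x + f x * frechet_derivative g (at x) v"
  unfolding frechet_derivative_at[OF has_derivative_mult[OF
        assms[unfolded frechet_derivative_works]], symmetric] by (rule add.commute)

lemma frechet_derivative_sum_apply:
  assumes "\<And>i. i \<in> I \<Longrightarrow> f i differentiable (at x)"
  shows "frechet_derivative (\<lambda>z. \<Sum>i\<in>I. f i z) (at x) v =
    (\<Sum>i\<in>I. frechet_derivative (f i) (at x) v)"
proof -
  have "((\<lambda>z. \<Sum>i\<in>I. f i z) has_derivative (\<lambda>v. \<Sum>i\<in>I. frechet_derivative (f i) (at x) v)) (at x)"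
    using assms by (intro has_derivative_sum) (simp add: frechet_derivative_works)
  from frechet_derivative_at[OF this] show ?thesis by metis
qed

lemma frechet_derivative_sum_mult:
  fixes f g :: "'i \<Rightarrow> _ \<Rightarrow> real"
  assumes "\<And>s. s \<in> I \<Longrightarrow> f s differentiable (at x)" "\<And>s. s \<in> I \<Longrightarrow> g s differentiable (at x)"
  shows "frechet_derivative (\<lambda>z. \<Sum>s\<in>I. f s z * g s z) (at x) v =
    (\<Sum>s\<in>I. frechet_derivative (f s) (at x) v * g s x + f s x * frechet_derivative (g s) (at x) v)"
  using assms by (subst frechet_derivative_sum_apply)
    (auto intro!: sum.cong frechet_derivative_mult_apply differentiable_mult)

lemma pd_add:
  "f differentiable (at x) \<Longrightarrow> g differentiable (at x) \<Longrightarrow>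
    pd k (\<lambda>z. f z + g z) x = pd k f x + pd k g x"
  unfolding pd_def by (rule frechet_derivative_add_apply)

lemma pd_mult:
  "f differentiable (at x) \<Longrightarrow> g differentiable (at x) \<Longrightarrow>
    pd k (\<lambda>z. f z * g z) x = pd k f x * g x + f x * pd k g x"
  unfolding pd_def by (rule frechet_derivative_mult_apply)

lemma pd_const: "pd k (\<lambda>_. c) x = 0"
  by (simp add: pd_def)

lemma pd_scale: "f differentiable (at x) \<Longrightarrow> pd k (\<lambda>z. c * f z) x = c * pd k f x"
  using pd_mult[of "\<lambda>_. c" x f k] by (simp add: pd_const)

lemma pd_diff:
  "f differentiable (at x) \<Longrightarrow> g differentiable (at x) \<Longrightarrow>
    pd k (\<lambda>z. f z - g z) x = pd k f x - pd k g x"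
  using pd_add[of f x "\<lambda>z. (-1) * g z" k] pd_scale[of g x k "-1"] by simp

lemma pd_sum_mult:
  "(\<And>s. f s differentiable (at x)) \<Longrightarrow> (\<And>s. g s differentiable (at x)) \<Longrightarrow>
    pd k (\<lambda>z. \<Sum>s\<in>I. f s z * g s z) x = (\<Sum>s\<in>I. pd k (f s) x * g s x + f s x * pd k (g s) x)"
  unfolding pd_def by (rule frechet_derivative_sum_mult)

lemma differentiable_nth: "(\<lambda>z::real ^ 'n::finite. z $ j) differentiable (at y)"
  by (rule bounded_linear_imp_differentiable[OF bounded_linear_vec_nth])

lemma pd_nth: "pd m (\<lambda>z::real ^ 'n::finite. z $ j) y = (if j = m then 1 else 0)"
proof -
  have "((\<lambda>z::real ^ 'n. z $ j) has_derivative (\<lambda>v. v $ j)) (at y)"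
    by (rule bounded_linear.has_derivative[OF bounded_linear_vec_nth has_derivative_ident])
  then show ?thesis
    unfolding pd_def by (simp add: frechet_derivative_at[symmetric] axis_def)
qed

lemma pd_linear_form:
  fixes y :: "real ^ 'n::finite"
  shows "pd m (\<lambda>z. \<Sum>k\<in>UNIV. c k * z $ k) y = c m"
  by (simp only: pd_sum_mult[OF differentiable_const differentiable_nth] pd_const pd_nth
      mult_zero_left add_0 sum_delta_mult)

lemma pd_quadratic_form:
  fixes y :: "real ^ 'n::finite"
  shows "pd m (\<lambda>z. \<Sum>j\<in>UNIV. \<Sum>k\<in>UNIV. c j k * z $ j * z $ k) y =
    (\<Sum>k\<in>UNIV. (c m k + c k m) * y $ k)"
proof -
  have lin: "(\<lambda>z::real ^ 'n. \<Sum>k\<in>UNIV. c j k * z $ k) differentiable (at y)" for j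
    by (intro differentiable_sum finite ballI differentiable_mult differentiable_const differentiable_nth)
  have "(\<lambda>z::real ^ 'n. \<Sum>j\<in>UNIV. \<Sum>k\<in>UNIV. c j k * z $ j * z $ k) =
    (\<lambda>z. \<Sum>j\<in>UNIV. z $ j * (\<Sum>k\<in>UNIV. c j k * z $ k))"
    by (simp add: sum_distrib_left ac_simps)
  then have "pd m (\<lambda>z. \<Sum>j\<in>UNIV. \<Sum>k\<in>UNIV. c j k * z $ j * z $ k) y =
    (\<Sum>j\<in>UNIV. (if j = m then 1 else 0) * (\<Sum>k\<in>UNIV. c j k * y $ k) + y $ j * c j m)"
    by (simp only: pd_sum_mult[OF differentiable_nth lin] pd_nth pd_linear_form)
  also have "\<dots> = (\<Sum>k\<in>UNIV. c m k * y $ k) + (\<Sum>j\<in>UNIV. y $ j * c j m)"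
    by (simp only: sum.distrib sum_delta_mult)
  also have "\<dots> = (\<Sum>k\<in>UNIV. (c m k + c k m) * y $ k)"
    unfolding distrib_right sum.distrib by (simp only: mult.commute)
  finally show ?thesis .
qed

lemma frechet_derivative_components:
  fixes X :: "real ^ 'n::finite \<Rightarrow> real ^ 'n"
  assumes "X differentiable (at x)"
  shows "frechet_derivative X (at x) v $ i = (\<Sum>m\<in>UNIV. v $ m * pd m (\<lambda>z. X z $ i) x)"
proof -
  have X: "(X has_derivative frechet_derivative X (at x)) (at x)"
    using assms by (simp only: frechet_derivative_works)
  have lin: "linear (\<lambda>v. frechet_derivative X (at x) v $ i)"
    using has_derivative_linear[OF bounded_linear.has_derivative[OF bounded_linear_vec_nth X]] .
  have pd: "frechet_derivative X (at x) (axis m 1) $ i = pd m (\<lambda>z. X z $ i) x" for m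
    unfolding pd_def frechet_derivative_at[OF bounded_linear.has_derivative[OF
          bounded_linear_vec_nth X], symmetric] ..
  have expand: "v = (\<Sum>m\<in>UNIV. v $ m *\<^sub>R axis m 1)"
    using basis_expansion[of v] by (simp add: scalar_mult_eq_scaleR)
  have "frechet_derivative X (at x) v $ i =
      frechet_derivative X (at x) (\<Sum>m\<in>UNIV. v $ m *\<^sub>R axis m 1) $ i"
    using expand by metis
  also have "\<dots> = (\<Sum>m\<in>UNIV. v $ m * pd m (\<lambda>z. X z $ i) x)"
    by (simp add: linear_sum[OF lin] linear_scale[OF lin] pd)
  finally show ?thesis .
qed

section \<open>Curvature of a Riemannian metric in a chart\<close>

definition multilinear4 ::
    "('n \<Rightarrow> 'n \<Rightarrow> 'n \<Rightarrow> 'n \<Rightarrow> real) \<Rightarrow> real ^ 'n \<Rightarrow> real ^ 'n \<Rightarrow> real ^ 'n \<Rightarrow> real ^ 'n::finite \<Rightarrow> real" where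
  "multilinear4 R a b c d =
     (\<Sum>i\<in>UNIV. \<Sum>j\<in>UNIV. \<Sum>k\<in>UNIV. \<Sum>l\<in>UNIV. R i j k l * a $ i * b $ j * c $ k * d $ l)"

lemma multilinear4_comb1:
  "multilinear4 R (\<alpha> *\<^sub>R u + \<beta> *\<^sub>R w) b c d = \<alpha> * multilinear4 R u b c d + \<beta> * multilinear4 R w b c d"
  by (simp add: multilinear4_def algebra_simps sum.distrib sum_distrib_left)

lemma multilinear4_comb2:
  "multilinear4 R a (\<alpha> *\<^sub>R u + \<beta> *\<^sub>R w) c d = \<alpha> * multilinear4 R a u c d + \<beta> * multilinear4 R a w c d"
  by (simp add: multilinear4_def algebra_simps sum.distrib sum_distrib_left)

lemma multilinear4_comb3:
  "multilinear4 R a b (\<alpha> *\<^sub>R u + \<beta> *\<^sub>R w) d = \<alpha> * multilinear4 R a b u d + \<beta> * multilinear4 R a b w d"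
  by (simp add: multilinear4_def algebra_simps sum.distrib sum_distrib_left)

lemma multilinear4_comb4:
  "multilinear4 R a b c (\<alpha> *\<^sub>R u + \<beta> *\<^sub>R w) = \<alpha> * multilinear4 R a b c u + \<beta> * multilinear4 R a b c w"
  by (simp add: multilinear4_def algebra_simps sum.distrib sum_distrib_left)

lemma multilinear4_antisym12:
  assumes "\<And>i j k l. R i j k l = - R j i k l"
  shows "multilinear4 R a b c d = - multilinear4 R b a c d"
proof -
  have "multilinear4 R a b c d =
     (\<Sum>j\<in>UNIV. \<Sum>i\<in>UNIV. \<Sum>k\<in>UNIV. \<Sum>l\<in>UNIV. R i j k l * a $ i * b $ j * c $ k * d $ l)"
    unfolding multilinear4_def by (rule sum.swap)
  also have "\<dots> = (\<Sum>j\<in>UNIV. \<Sum>i\<in>UNIV. \<Sum>k\<in>UNIV. \<Sum>l\<in>UNIV. - (R j i k l * b $ j * a $ i * c $ k * d $ l))"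
    by (intro sum.cong refl) (subst assms, simp)
  also have "\<dots> = - multilinear4 R b a c d" by (simp add: multilinear4_def sum_negf)
  finally show ?thesis .
qed

lemma multilinear4_antisym34:
  assumes "\<And>i j k l. R i j k l = - R i j l k"
  shows "multilinear4 R a b c d = - multilinear4 R a b d c"
proof -
  have "multilinear4 R a b c d =
     (\<Sum>i\<in>UNIV. \<Sum>j\<in>UNIV. \<Sum>l\<in>UNIV. \<Sum>k\<in>UNIV. R i j k l * a $ i * b $ j * c $ k * d $ l)"
    unfolding multilinear4_def by (intro sum.cong refl sum.swap)
  also have "\<dots> = (\<Sum>i\<in>UNIV. \<Sum>j\<in>UNIV. \<Sum>l\<in>UNIV. \<Sum>k\<in>UNIV. - (R i j l k * a $ i * b $ j * d $ l * c $ k))"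
    by (intro sum.cong refl) (subst assms, simp)
  also have "\<dots> = - multilinear4 R a b d c" by (simp add: multilinear4_def sum_negf)
  finally show ?thesis .
qed

text \<open>A form that is alternating in both pairs sees a change of basis of a plane only through the
  determinant.\<close>

lemma multilinear4_change_basis:
  assumes "\<And>i j k l. R i j k l = - R j i k l" "\<And>i j k l. R i j k l = - R i j l k"
    and "u' = \<alpha> *\<^sub>R u + \<beta> *\<^sub>R w" "w' = \<gamma> *\<^sub>R u + \<delta> *\<^sub>R w"
  shows "multilinear4 R u' w' u' w' = (\<alpha> * \<delta> - \<beta> * \<gamma>)\<^sup>2 * multilinear4 R u w u w"
proof -
  note A = multilinear4_antisym12[of R, OF assms(1)] and B = multilinear4_antisym34[of R, OF assms(2)]
  have A0: "multilinear4 R a a c d = 0" for a c d using A[of a a c d] by simp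
  have B0: "multilinear4 R a b c c = 0" for a b c using B[of a b c c] by simp
  have 1: "multilinear4 R u' w' c d = (\<alpha> * \<delta> - \<beta> * \<gamma>) * multilinear4 R u w c d" for c d
    unfolding assms(3,4) multilinear4_comb1 multilinear4_comb2 A0 A[of w u c d]
    by (simp add: algebra_simps)
  have 2: "multilinear4 R a b u' w' = (\<alpha> * \<delta> - \<beta> * \<gamma>) * multilinear4 R a b u w" for a b
    unfolding assms(3,4) multilinear4_comb3 multilinear4_comb4 B0 B[of a b w u]
    by (simp add: algebra_simps)
  show ?thesis unfolding 1 2 by (simp add: power2_eq_square)
qed

lemma metric_at_comb1:
  "metric_at h x (\<alpha> *\<^sub>R u + \<beta> *\<^sub>R w) v = \<alpha> * metric_at h x u v + \<beta> * metric_at h x w v"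
  by (simp add: metric_at_def algebra_simps sum.distrib sum_distrib_left)

lemma metric_at_comb2:
  "metric_at h x v (\<alpha> *\<^sub>R u + \<beta> *\<^sub>R w) = \<alpha> * metric_at h x v u + \<beta> * metric_at h x v w"
  by (simp add: metric_at_def algebra_simps sum.distrib sum_distrib_left)

lemma metric_at_axis: "metric_at h x (axis i 1) (axis k 1) = h i k x"
proof -
  have "metric_at h x (axis i 1) (axis k 1) =
    (\<Sum>a\<in>UNIV. (\<Sum>b\<in>UNIV. h a b x * (if b = k then 1 else 0)) * (if a = i then 1 else 0))"
    unfolding metric_at_def axis_def sum_distrib_right by (simp add: ac_simps)
  then show ?thesis by (simp only: sum_delta_mult)
qed

text \<open>Polarisation: the quadratic form on basis vectors and on sums of two of them already contains all
  coefficients of a symmetric form.\<close>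

lemma symmetric_form_determined:
  assumes "\<And>i k. C i k x = C k i x" "\<And>i k. E i k x = E k i x"
    and eq: "\<And>u. metric_at C x u u = metric_at E x u u"
  shows "C i k x = E i k x"
proof -
  have sum: "metric_at h x (axis i 1 + axis k 1) (axis i 1 + axis k 1) =
    h i i x + h i k x + h k i x + h k k x" for h :: "'a metric" and i k
    using metric_at_comb1[of h x 1 "axis i 1" 1 "axis k 1" "axis i 1 + axis k 1"]
      metric_at_comb2[of h x _ 1 "axis i 1" 1 "axis k 1"]
    by (simp add: metric_at_axis)
  have "C i i x = E i i x" "C k k x = E k k x"
    using eq[of "axis i 1"] eq[of "axis k 1"] by (simp_all add: metric_at_axis)
  then show ?thesis
    using eq[of "axis i 1 + axis k 1"] assms(1)[of i k] assms(2)[of i k] unfolding sum by simp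
qed

locale riemannian_chart =
  fixes h :: "'n::finite metric" and V :: "(real ^ 'n) set"
  assumes open_V: "open V"
    and smooth_h: "smooth_on V (h i j)"
    and h_sym: "x \<in> V \<Longrightarrow> h i j x = h j i x"
    and h_pos: "x \<in> V \<Longrightarrow> pos_def_matrix (\<chi> a b. h a b x)"
begin

lemma invertible_h: "x \<in> V \<Longrightarrow> invertible (\<chi> a b. h a b x)"
  using h_pos pos_def_matrix_invertible by blast

lemma pd_h_sym: "x \<in> V \<Longrightarrow> pd k (h i j) x = pd k (h j i) x"
  by (rule pd_cong[OF open_V _ h_sym])

lemma christoffel_levi_civita:
  "christoffel h i j k x = levi_civita_coeff (\<chi> a b. h a b x) (\<lambda>k i j. pd k (h i j) x) i j k"
  by (simp add: christoffel_def levi_civita_coeff_def)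

lemma riem_conn_curvature:
  "riem h i j k l x = conn_curvature (\<lambda>k i j l. pd k (christoffel h i j l) x)
     (\<lambda>i j k. christoffel h i j k x) i j k l"
  by (simp add: riem_def conn_curvature_def)

lemma christoffel_sym: "x \<in> V \<Longrightarrow> christoffel h i j k x = christoffel h i k j x"
  unfolding christoffel_levi_civita by (rule levi_civita_coeff_commute) (rule pd_h_sym)

lemma smooth_christoffel: "smooth_on V (christoffel h i j k)"
proof -
  have pd: "smooth_on V (pd k (h i j))" for i j k
    unfolding pd_def[abs_def] by (rule smooth_on_frechet_derivative[OF smooth_h])
  have inv: "smooth_on V (\<lambda>x. matrix_inv (\<chi> a b. h a b x) $ i $ s)" for i s
    using invertible_h by (intro smooth_on_matrix_inv open_V smooth_h)
  show ?thesis
    unfolding christoffel_def[abs_def] divide_inverse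
    by (intro smooth_on_sum smooth_on_mult smooth_on_add smooth_on_diff smooth_on_const inv pd open_V)
qed

lemma pd_christoffel_sym: "x \<in> V \<Longrightarrow> pd l (christoffel h i j k) x = pd l (christoffel h i k j) x"
  by (rule pd_cong[OF open_V _ christoffel_sym])

lemma pd_h:
  assumes "x \<in> V"
  shows "pd k (h i j) x = (\<Sum>s\<in>UNIV. h i s x * christoffel h s j k x) +
    (\<Sum>s\<in>UNIV. h j s x * christoffel h s i k x)"
  using levi_civita_coeff_metric[OF invertible_h[OF assms], of "\<lambda>k i j. pd k (h i j) x",
      OF pd_h_sym[OF assms], of k i j]
  unfolding christoffel_levi_civita by simp

definition lowered_riem :: "real ^ 'n \<Rightarrow> 'n \<Rightarrow> 'n \<Rightarrow> 'n \<Rightarrow> 'n \<Rightarrow> real" where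
  "lowered_riem x i j k l = (\<Sum>a\<in>UNIV. h i a x * riem h a j k l x)"

lemma lowered_riem_antisym12:
  assumes x: "x \<in> V"
  shows "lowered_riem x i j k l = - lowered_riem x j i k l"
proof -
  have dh: "h i j differentiable (at x)" for i j
    by (rule smooth_on_differentiable[OF smooth_h x])
  have dC: "christoffel h i j k differentiable (at x)" for i j k
    by (rule smooth_on_differentiable[OF smooth_christoffel x])
  have second: "pd k (pd l (h i j)) x =
     (\<Sum>s\<in>UNIV. pd k (h i s) x * christoffel h s j l x + h i s x * pd k (christoffel h s j l) x)
     + (\<Sum>s\<in>UNIV. pd k (h j s) x * christoffel h s i l x + h j s x * pd k (christoffel h s i l) x)"
    for k l i j
  proof -
    have "pd k (pd l (h i j)) x = pd k (\<lambda>z. (\<Sum>s\<in>UNIV. h i s z * christoffel h s j l z) +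
      (\<Sum>s\<in>UNIV. h j s z * christoffel h s i l z)) x"
      by (rule pd_cong[OF open_V x pd_h])
    also have "\<dots> = pd k (\<lambda>z. \<Sum>s\<in>UNIV. h i s z * christoffel h s j l z) x +
      pd k (\<lambda>z. \<Sum>s\<in>UNIV. h j s z * christoffel h s i l z) x"
      unfolding pd_def using dh dC
      by (intro frechet_derivative_add_apply differentiable_sum) (auto intro!: differentiable_mult)
    finally show ?thesis
      unfolding pd_def frechet_derivative_sum_mult[OF dh dC] .
  qed
  have commute: "pd k (pd l (h i j)) x = pd l (pd k (h i j)) x" for k l i j
    unfolding pd_def by (rule frechet_derivative_commute[OF open_V smooth_h x])
  show ?thesis
    using lowered_curvature_antisym[of "\<lambda>k i j. pd k (h i j) x" "\<chi> a b. h a b x"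
        "\<lambda>i j k. christoffel h i j k x" "\<lambda>k i j l. pd k (christoffel h i j l) x" i j k l]
      pd_h[OF x] h_sym[OF x] commute second
    by (simp add: lowered_riem_def riem_conn_curvature)
qed

lemma lowered_riem_antisym34: "lowered_riem x i j k l = - lowered_riem x i j l k"
  unfolding lowered_riem_def riem_conn_curvature
  by (subst conn_curvature_antisym) (simp add: sum_negf)

lemma lowered_riem_bianchi:
  assumes "x \<in> V"
  shows "lowered_riem x i j k l + lowered_riem x i k l j + lowered_riem x i l j k = 0"
proof -
  have "riem h a j k l x + riem h a k l j x + riem h a l j k x = 0" for a
    unfolding riem_conn_curvature
    by (rule conn_curvature_bianchi) (rule christoffel_sym pd_christoffel_sym; rule assms)+
  then have "(\<Sum>a\<in>UNIV. h i a x * (riem h a j k l x + riem h a k l j x + riem h a l j k x)) = 0"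
    by simp
  then show ?thesis by (simp add: lowered_riem_def distrib_left sum.distrib)
qed

lemma lowered_riem_pair_sym: "x \<in> V \<Longrightarrow> lowered_riem x i j k l = lowered_riem x k l i j"
  by (rule curvature_pair_symmetry)
    (rule lowered_riem_antisym34 lowered_riem_antisym12 lowered_riem_bianchi; assumption)+

end

lemma in_span_two: "z \<in> span {u, w} \<Longrightarrow> \<exists>\<alpha> \<beta>. z = \<alpha> *\<^sub>R u + \<beta> *\<^sub>R w"
  unfolding span_insert span_singleton by (auto simp: algebra_simps)

lemma sum_rotate_inward:
  fixes f :: "'n::finite \<Rightarrow> 'n \<Rightarrow> 'n \<Rightarrow> 'n \<Rightarrow> real"
  shows "(\<Sum>a\<in>UNIV. \<Sum>j\<in>UNIV. \<Sum>k\<in>UNIV. \<Sum>l\<in>UNIV. f a j k l) =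
    (\<Sum>j\<in>UNIV. \<Sum>k\<in>UNIV. \<Sum>l\<in>UNIV. \<Sum>a\<in>UNIV. f a j k l)"
proof -
  have "(\<Sum>a\<in>UNIV. \<Sum>j\<in>UNIV. \<Sum>k\<in>UNIV. \<Sum>l\<in>UNIV. f a j k l) =
      (\<Sum>j\<in>UNIV. \<Sum>a\<in>UNIV. \<Sum>k\<in>UNIV. \<Sum>l\<in>UNIV. f a j k l)" by (rule sum.swap)
  also have "\<dots> = (\<Sum>j\<in>UNIV. \<Sum>k\<in>UNIV. \<Sum>a\<in>UNIV. \<Sum>l\<in>UNIV. f a j k l)"
    by (rule sum.cong[OF refl], rule sum.swap)
  also have "\<dots> = (\<Sum>j\<in>UNIV. \<Sum>k\<in>UNIV. \<Sum>l\<in>UNIV. \<Sum>a\<in>UNIV. f a j k l)"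
    by (rule sum.cong[OF refl], rule sum.cong[OF refl], rule sum.swap)
  finally show ?thesis .
qed

definition gram :: "'n::finite metric \<Rightarrow> real ^ 'n \<Rightarrow> real ^ 'n \<Rightarrow> real ^ 'n \<Rightarrow> real" where
  "gram h x u w = metric_at h x u u * metric_at h x w w - (metric_at h x u w)\<^sup>2"

definition jacobi_form :: "'n::finite metric \<Rightarrow> real ^ 'n \<Rightarrow> 'n metric" where
  "jacobi_form h w i k x = (\<Sum>a\<in>UNIV. h i a x *
     (\<Sum>j\<in>UNIV. \<Sum>l\<in>UNIV. riem h a j k l x * w $ j * w $ l))"

context riemannian_chart
begin

lemma metric_at_sym: "x \<in> V \<Longrightarrow> metric_at h x u w = metric_at h x w u"
  unfolding metric_at_def by (subst sum.swap) (simp add: h_sym[of x] ac_simps)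

lemma metric_at_pos: "x \<in> V \<Longrightarrow> w \<noteq> 0 \<Longrightarrow> 0 < metric_at h x w w"
  using h_pos by (simp add: metric_at_def pos_def_matrix_def)

text \<open>The strict Cauchy-Schwarz inequality: up to a positive factor the Gram determinant is the square
  norm of the component of \<^term>\<open>u\<close> orthogonal to \<^term>\<open>w\<close>.\<close>

lemma gram_pos:
  assumes x: "x \<in> V" and "u \<noteq> w" "independent {u, w}"
  shows "0 < gram h x u w"
proof -
  have w: "w \<noteq> 0" using assms(3) dependent_zero by blast
  have Gw: "0 < metric_at h x w w" by (rule metric_at_pos[OF x w])
  define z where "z = metric_at h x w w *\<^sub>R u + (- metric_at h x u w) *\<^sub>R w"
  have "z \<noteq> 0"
  proof
    assume "z = 0"
    then have "metric_at h x w w *\<^sub>R u = metric_at h x u w *\<^sub>R w" by (simp add: z_def)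
    moreover have "u = inverse (metric_at h x w w) *\<^sub>R (metric_at h x w w *\<^sub>R u)"
      using Gw by simp
    moreover have "inverse (metric_at h x w w) *\<^sub>R (metric_at h x u w *\<^sub>R w) \<in> span {w}"
      by (intro span_scale span_base) simp
    ultimately have "u \<in> span {w}" by metis
    then show False using assms(2,3) by (simp add: independent_insert)
  qed
  then have "0 < metric_at h x z z" by (rule metric_at_pos[OF x])
  also have "metric_at h x z z = metric_at h x w w * gram h x u w"
    unfolding z_def metric_at_comb1 metric_at_comb2 gram_def metric_at_sym[OF x, of w u]
    by (simp add: algebra_simps power2_eq_square)
  finally show ?thesis using Gw by (simp add: zero_less_mult_iff)
qed

lemma sectional_of_basis_multilinear:
  assumes x: "x \<in> V"
  shows "sectional_of_basis h x u w = multilinear4 (lowered_riem x) u w u w / gram h x u w"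
proof -
  define A where "A i = (\<Sum>j\<in>UNIV. \<Sum>k\<in>UNIV. \<Sum>l\<in>UNIV. riem h i j k l x * w $ j * u $ k * w $ l)" for i
  have "metric_at h x (\<chi> i. A i) u = (\<Sum>p\<in>UNIV. \<Sum>i\<in>UNIV. h i p x * A i * u $ p)"
    unfolding metric_at_def by (subst sum.swap) simp
  also have "\<dots> = (\<Sum>p\<in>UNIV. \<Sum>i\<in>UNIV. \<Sum>j\<in>UNIV. \<Sum>k\<in>UNIV. \<Sum>l\<in>UNIV.
      h p i x * riem h i j k l x * u $ p * w $ j * u $ k * w $ l)"
    unfolding A_def sum_distrib_left sum_distrib_right
    by (intro sum.cong refl) (simp add: h_sym[OF x] ac_simps)
  also have "\<dots> = multilinear4 (lowered_riem x) u w u w"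
    unfolding multilinear4_def lowered_riem_def sum_distrib_right
    by (intro sum.cong[OF refl] sum_rotate_inward)
  finally show ?thesis
    by (simp add: sectional_of_basis_def gram_def A_def)
qed

lemma gram_change_basis:
  assumes "x \<in> V" "u' = \<alpha> *\<^sub>R u + \<beta> *\<^sub>R w" "w' = \<gamma> *\<^sub>R u + \<delta> *\<^sub>R w"
  shows "gram h x u' w' = (\<alpha> * \<delta> - \<beta> * \<gamma>)\<^sup>2 * gram h x u w"
  unfolding gram_def assms(2,3) metric_at_comb1 metric_at_comb2 metric_at_sym[OF assms(1), of w u]
  by (simp add: algebra_simps power2_eq_square)

text \<open>\<^const>\<open>sectional_curvature\<close> is evaluated on an unspecified basis of the plane. Numerator and
  denominator scale by the same square of a determinant, so any given basis may be used instead.\<close>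

lemma sectional_curvature_span:
  assumes x: "x \<in> V" and uw: "u \<noteq> w" "independent {u, w}"
    and r: "sectional_curvature h x (span {u, w}) = r"
  shows "multilinear4 (lowered_riem x) u w u w = r * gram h x u w"
proof -
  let ?P = "\<lambda>(a, b). a \<noteq> b \<and> independent {a, b} \<and> span {a, b} = span {u, w}"
  obtain u' w' where some: "(SOME p. ?P p) = (u', w')" by fastforce
  have "?P (SOME p. ?P p)" by (rule someI[of ?P "(u, w)"]) (use uw in simp)
  then have uw': "u' \<noteq> w'" "independent {u', w'}" "span {u', w'} = span {u, w}"
    unfolding some by simp_all
  have "u' \<in> span {u, w}" "w' \<in> span {u, w}"
    unfolding uw'(3)[symmetric] by (simp_all add: span_base)
  then obtain \<alpha> \<beta> \<gamma> \<delta> where comb: "u' = \<alpha> *\<^sub>R u + \<beta> *\<^sub>R w" "w' = \<gamma> *\<^sub>R u + \<delta> *\<^sub>R w"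
    using in_span_two by metis
  let ?d = "(\<alpha> * \<delta> - \<beta> * \<gamma>)\<^sup>2"
  have G: "gram h x u' w' = ?d * gram h x u w" by (rule gram_change_basis[OF x comb])
  have N: "multilinear4 (lowered_riem x) u' w' u' w' = ?d * multilinear4 (lowered_riem x) u w u w"
    by (rule multilinear4_change_basis[OF lowered_riem_antisym12[OF x] lowered_riem_antisym34 comb])
  have "r = sectional_of_basis h x u' w'"
    using r unfolding sectional_curvature_def some by simp
  also have "\<dots> = ?d * multilinear4 (lowered_riem x) u w u w / (?d * gram h x u w)"
    unfolding sectional_of_basis_multilinear[OF x] N G ..
  finally have eq: "r = ?d * multilinear4 (lowered_riem x) u w u w / (?d * gram h x u w)" .
  have nz: "?d * gram h x u w \<noteq> 0" using gram_pos[OF x uw'(1,2)] unfolding G by (rule less_imp_neq[symmetric])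
  then have "r * (?d * gram h x u w) = ?d * multilinear4 (lowered_riem x) u w u w"
    unfolding eq by (rule nonzero_eq_divide_eq[THEN iffD1, OF _ refl])
  then have "?d * multilinear4 (lowered_riem x) u w u w = ?d * (r * gram h x u w)"
    by (simp only: ac_simps)
  moreover have "?d \<noteq> 0" using nz by (rule contrapos_nn) simp
  ultimately show ?thesis by (rule mult_left_cancel[THEN iffD1, rotated])
qed

lemma jacobi_form_lowered_riem:
  "jacobi_form h w i k x = (\<Sum>j\<in>UNIV. \<Sum>l\<in>UNIV. lowered_riem x i j k l * w $ j * w $ l)"
proof -
  have "jacobi_form h w i k x =
    (\<Sum>a\<in>UNIV. \<Sum>j\<in>UNIV. \<Sum>l\<in>UNIV. h i a x * riem h a j k l x * w $ j * w $ l)"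
    by (simp add: jacobi_form_def sum_distrib_left ac_simps)
  also have "\<dots> = (\<Sum>j\<in>UNIV. \<Sum>a\<in>UNIV. \<Sum>l\<in>UNIV. h i a x * riem h a j k l x * w $ j * w $ l)"
    by (rule sum.swap)
  also have "\<dots> = (\<Sum>j\<in>UNIV. \<Sum>l\<in>UNIV. \<Sum>a\<in>UNIV. h i a x * riem h a j k l x * w $ j * w $ l)"
    by (rule sum.cong[OF refl], rule sum.swap)
  finally show ?thesis unfolding lowered_riem_def sum_distrib_right .
qed

lemma jacobi_form_sym:
  assumes x: "x \<in> V"
  shows "jacobi_form h w i k x = jacobi_form h w k i x"
proof -
  have "jacobi_form h w i k x = (\<Sum>j\<in>UNIV. \<Sum>l\<in>UNIV. lowered_riem x k l i j * w $ l * w $ j)"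
    unfolding jacobi_form_lowered_riem
    by (intro sum.cong refl) (simp add: lowered_riem_pair_sym[OF x, of i _ k] ac_simps)
  also have "\<dots> = jacobi_form h w k i x" unfolding jacobi_form_lowered_riem by (rule sum.swap)
  finally show ?thesis .
qed

lemma metric_at_jacobi_form:
  "metric_at (jacobi_form h w) x u u = multilinear4 (lowered_riem x) u w u w"
proof -
  have "multilinear4 (lowered_riem x) u w u w = (\<Sum>i\<in>UNIV. \<Sum>k\<in>UNIV. \<Sum>j\<in>UNIV. \<Sum>l\<in>UNIV.
      lowered_riem x i j k l * u $ i * w $ j * u $ k * w $ l)"
    unfolding multilinear4_def by (rule sum.cong[OF refl], rule sum.swap)
  also have "\<dots> = metric_at (jacobi_form h w) x u u"
    unfolding metric_at_def jacobi_form_lowered_riem sum_distrib_right by (simp add: ac_simps)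
  finally show ?thesis by simp
qed

lemma jacobi_form_of_sectional_curvature:
  assumes "x \<in> V" "u \<noteq> w" "independent {u, w}" "sectional_curvature h x (span {u, w}) = r"
  shows "metric_at (jacobi_form h w) x u u = r * gram h x u w"
  unfolding metric_at_jacobi_form by (rule sectional_curvature_span[OF assms])

text \<open>The endomorphism \<open>u \<mapsto> R(u, w) w\<close> is symmetric, hence determined by its quadratic form.\<close>

lemma jacobi_operator_of_constant_form:
  assumes x: "x \<in> V" and w: "w \<noteq> 0"
    and r: "\<And>u. u \<noteq> w \<Longrightarrow> independent {u, w} \<Longrightarrow>
      metric_at (jacobi_form h w) x u u = r * gram h x u w"
  shows "(\<Sum>j\<in>UNIV. \<Sum>l\<in>UNIV. riem h i j k l x * w $ j * w $ l) =
    r * ((if i = k then metric_at h x w w else 0) - w $ i * (\<Sum>m\<in>UNIV. h k m x * w $ m))"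
proof -
  define low where "low k = (\<Sum>m\<in>UNIV. h k m x * w $ m)" for k
  define E :: "'n metric" where "E i k z = r * (h i k x * metric_at h x w w - low i * low k)" for i k z
  have E_sym: "E i k x = E k i x" for i k by (simp add: E_def h_sym[OF x, of i k])
  have low: "(\<Sum>i\<in>UNIV. low i * u $ i) = metric_at h x u w" for u
    unfolding low_def metric_at_def sum_distrib_right by (simp add: ac_simps)
  have E: "metric_at E x u u = r * gram h x u w" for u
  proof -
    have "metric_at E x u u = r * (metric_at h x w w * metric_at h x u u
        - (\<Sum>i\<in>UNIV. \<Sum>k\<in>UNIV. (low i * u $ i) * (low k * u $ k)))"
      unfolding E_def metric_at_def[of _ x u u]
      by (simp add: algebra_simps sum_subtractf sum_distrib_left)
    also have "(\<Sum>i\<in>UNIV. \<Sum>k\<in>UNIV. (low i * u $ i) * (low k * u $ k)) = (metric_at h x u w)\<^sup>2"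
      unfolding sum_product[symmetric] low power2_eq_square ..
    finally show ?thesis by (simp add: gram_def mult.commute)
  qed
  have "metric_at (jacobi_form h w) x u u = metric_at E x u u" for u
  proof (cases "u \<in> span {w}")
    case True
    then obtain c where u: "u = c *\<^sub>R w + 0 *\<^sub>R w" by (auto simp: span_singleton)
    have w': "w = 0 *\<^sub>R w + 1 *\<^sub>R w" by simp
    have "multilinear4 (lowered_riem x) w w w w = 0"
      using multilinear4_antisym12[of "lowered_riem x" w w w w, OF lowered_riem_antisym12[OF x]]
      by simp
    then have "multilinear4 (lowered_riem x) u w u w = 0"
      using multilinear4_change_basis[OF lowered_riem_antisym12[OF x] lowered_riem_antisym34 u w']
      by simp
    moreover have "gram h x u w = 0"
      using gram_change_basis[OF x u w'] by (simp add: gram_def power2_eq_square)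
    ultimately show ?thesis unfolding metric_at_jacobi_form E by simp
  next
    case False
    then have "u \<noteq> w" "independent {u, w}"
      using w by (auto simp: independent_insert span_base)
    then show ?thesis unfolding E by (rule r)
  qed
  then have form: "jacobi_form h w i k x = E i k x" for i k
    by (rule symmetric_form_determined[of "jacobi_form h w" x E, OF jacobi_form_sym[OF x] E_sym])
  let ?lhs = "\<lambda>i. \<Sum>j\<in>UNIV. \<Sum>l\<in>UNIV. riem h i j k l x * w $ j * w $ l"
  let ?rhs = "\<lambda>i. r * ((if i = k then metric_at h x w w else 0) - w $ i * low k)"
  have lowered: "(\<Sum>i\<in>UNIV. h a i x * ?lhs i) = (\<Sum>i\<in>UNIV. h a i x * ?rhs i)" for a
  proof -
    have "(\<Sum>i\<in>UNIV. h a i x * ?lhs i) = E a k x"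
      unfolding form[symmetric] jacobi_form_def ..
    also have "\<dots> = (\<Sum>i\<in>UNIV. h a i x * ?rhs i)"
    proof -
      have "(\<Sum>i\<in>UNIV. h a i x * ?rhs i) =
        r * metric_at h x w w * (\<Sum>i\<in>UNIV. h a i x * (if i = k then 1 else 0)) -
        r * (\<Sum>i\<in>UNIV. h a i x * w $ i) * low k"
        unfolding sum_distrib_left sum_distrib_right sum_subtractf[symmetric]
        by (rule sum.cong[OF refl]) (simp add: algebra_simps)
      then show ?thesis
        unfolding sum_delta_mult low_def[of a, symmetric] E_def by (simp add: algebra_simps)
    qed
    finally show ?thesis .
  qed
  have "?lhs i = ?rhs i"
    by (rule lowered_index_eqD[OF invertible_h[OF x], of ?lhs ?rhs]) (simp only: vec_lambda_beta lowered)
  then show ?thesis by (simp add: low_def)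
qed

end

section \<open>The Chern connection of a Finsler function in natural coordinates\<close>

lemma frechet_derivative_slices:
  assumes "f differentiable (at (x, y))"
  shows "frechet_derivative (\<lambda>z. f (x, z)) (at y) v = frechet_derivative f (at (x, y)) (0, v)"
    and "frechet_derivative (\<lambda>z. f (z, y)) (at x) u = frechet_derivative f (at (x, y)) (u, 0)"
proof -
  have f: "(f has_derivative frechet_derivative f (at (x, y))) (at (x, y))"
    using assms by (simp only: frechet_derivative_works)
  have "(Pair x has_derivative (\<lambda>v. (0, v))) (at y)"
    by (rule has_derivative_Pair[OF has_derivative_const has_derivative_ident])
  from frechet_derivative_at[OF diff_chain_at[OF this f]]
  show "frechet_derivative (\<lambda>z. f (x, z)) (at y) v = frechet_derivative f (at (x, y)) (0, v)"
    by (simp add: o_def fun_eq_iff)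
  have "((\<lambda>z. (z, y)) has_derivative (\<lambda>u. (u, 0))) (at x)"
    by (rule has_derivative_Pair[OF has_derivative_ident has_derivative_const])
  from frechet_derivative_at[OF diff_chain_at[OF this f]]
  show "frechet_derivative (\<lambda>z. f (z, y)) (at x) u = frechet_derivative f (at (x, y)) (u, 0)"
    by (simp add: o_def fun_eq_iff)
qed

lemma dy_slice: "f differentiable (at (x, y)) \<Longrightarrow> dy m f (x, y) = pd m (\<lambda>z. f (x, z)) y"
  by (simp only: dy_def pd_def frechet_derivative_slices)

lemma dx_slice: "f differentiable (at (x, y)) \<Longrightarrow> dx m f (x, y) = pd m (\<lambda>z. f (z, y)) x"
  by (simp only: dx_def pd_def frechet_derivative_slices)

lemma frechet_derivative_fibre_direction:
  assumes "f differentiable (at p)"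
  shows "frechet_derivative f (at p) (0, v) = (\<Sum>m\<in>UNIV. v $ m * dy m f p)"
proof -
  have lin: "linear (frechet_derivative f (at p))" by (rule linear_frechet_derivative[OF assms])
  have expand: "(0, v) = (\<Sum>m\<in>UNIV. v $ m *\<^sub>R (0, axis m 1))"
  proof -
    have "(\<Sum>m\<in>UNIV. v $ m *\<^sub>R axis m 1) = v"
      using basis_expansion[of v] by (simp add: scalar_mult_eq_scaleR)
    then show ?thesis by (simp add: prod_eq_iff fst_sum snd_sum)
  qed
  show ?thesis
    by (subst expand) (simp only: linear_sum[OF lin] linear_scale[OF lin] dy_def real_scaleR_def)
qed

lemma dx_dy_along_section:
  assumes f: "f differentiable (at (x, X x))" and X: "X differentiable (at x)"
  shows "pd k (\<lambda>z. f (z, X z)) x =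
    dx k f (x, X x) + (\<Sum>m\<in>UNIV. dy m f (x, X x) * pd k (\<lambda>z. X z $ m) x)"
proof -
  have X': "(X has_derivative frechet_derivative X (at x)) (at x)"
    using X by (simp only: frechet_derivative_works)
  have "((\<lambda>z. (z, X z)) has_derivative (\<lambda>u. (u, frechet_derivative X (at x) u))) (at x)"
    by (rule has_derivative_Pair[OF has_derivative_ident X'])
  moreover have "(f has_derivative frechet_derivative f (at (x, X x))) (at (x, X x))"
    using f by (simp only: frechet_derivative_works)
  ultimately have "((\<lambda>z. f (z, X z)) has_derivative
      (\<lambda>u. frechet_derivative f (at (x, X x)) (u, frechet_derivative X (at x) u))) (at x)"
    using diff_chain_at[of "\<lambda>z. (z, X z)" _ x f] by (simp add: o_def)
  from frechet_derivative_at[OF this]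
  have "pd k (\<lambda>z. f (z, X z)) x = frechet_derivative f (at (x, X x))
      (axis k 1, frechet_derivative X (at x) (axis k 1))"
    unfolding pd_def by (simp add: fun_eq_iff)
  also have "\<dots> = frechet_derivative f (at (x, X x)) ((axis k 1, 0)
      + (0, frechet_derivative X (at x) (axis k 1)))" by simp
  also have "\<dots> = dx k f (x, X x) +
      (\<Sum>m\<in>UNIV. frechet_derivative X (at x) (axis k 1) $ m * dy m f (x, X x))"
    unfolding linear_add[OF linear_frechet_derivative[OF f]]
      frechet_derivative_fibre_direction[OF f] dx_def ..
  finally have pd: "pd k (\<lambda>z. f (z, X z)) x = dx k f (x, X x) +
      (\<Sum>m\<in>UNIV. frechet_derivative X (at x) (axis k 1) $ m * dy m f (x, X x))" .
  have "frechet_derivative X (at x) (axis k 1) $ m = pd k (\<lambda>z. X z $ m) x" for m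
    using frechet_derivative_at[OF bounded_linear.has_derivative[OF bounded_linear_vec_nth X', of m]]
    by (simp add: pd_def fun_eq_iff)
  then show ?thesis unfolding pd by (simp add: mult.commute)
qed

lemma dx_cong:
  assumes "open S" "p \<in> S" "\<And>z. z \<in> S \<Longrightarrow> f z = g z"
  shows "dx k f p = dx k g p"
  unfolding dx_def by (simp only: frechet_derivative_cong_open[OF assms])

lemma dy_cong:
  assumes "open S" "p \<in> S" "\<And>z. z \<in> S \<Longrightarrow> f z = g z"
  shows "dy k f p = dy k g p"
  unfolding dy_def by (simp only: frechet_derivative_cong_open[OF assms])

lemma dy_scale: "f differentiable (at p) \<Longrightarrow> dy k (\<lambda>q. c * f q) p = c * dy k f p"
  unfolding dy_def using frechet_derivative_mult_apply[of "\<lambda>_. c" p f "(0, axis k 1)"] by simp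

lemma smooth_on_dx: "smooth_on S f \<Longrightarrow> smooth_on S (dx k f)"
  unfolding dx_def[abs_def] by (rule smooth_on_frechet_derivative)

lemma smooth_on_dy: "smooth_on S f \<Longrightarrow> smooth_on S (dy k f)"
  unfolding dy_def[abs_def] by (rule smooth_on_frechet_derivative)

locale finsler_chart =
  fixes L :: "'n::finite tfun" and U :: "(real ^ 'n) set"
  assumes open_U: "open U"
    and smooth_L: "smooth_on (U \<times> (UNIV - {0})) L"
    and homog: "x \<in> U \<Longrightarrow> y \<noteq> 0 \<Longrightarrow> 0 < r \<Longrightarrow> L (x, r *\<^sub>R y) = r * L (x, y)"
    and pos: "q \<in> U \<times> (UNIV - {0}) \<Longrightarrow> pos_def_matrix (\<chi> a b. fund L a b q)"
begin

abbreviation slit :: "((real ^ 'n) \<times> (real ^ 'n)) set" where "slit \<equiv> U \<times> (UNIV - {0})"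

lemma open_slit: "open slit"
  by (intro open_Times open_U open_Diff open_UNIV closed_singleton)

lemma smooth_L2: "smooth_on slit (\<lambda>q. (L q)\<^sup>2)"
  by (rule smooth_on_power[OF open_slit smooth_L])

lemma smooth_fund: "smooth_on slit (fund L i j)"
  unfolding fund_def[abs_def]
  by (intro smooth_on_mult smooth_on_const smooth_on_dy smooth_L2 open_slit)

lemma fund_sym: "q \<in> slit \<Longrightarrow> fund L i j q = fund L j i q"
  unfolding fund_def dy_def using frechet_derivative_commute[OF open_slit smooth_L2, of q] by simp

lemma invertible_fund: "q \<in> slit \<Longrightarrow> invertible (\<chi> a b. fund L a b q)"
  by (rule pos_def_matrix_invertible[OF pos])

lemma smooth_fund_inv: "smooth_on slit (fund_inv L i j)"
  unfolding fund_inv_def[abs_def]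
  by (rule smooth_on_matrix_inv[OF open_slit smooth_fund invertible_fund])

lemma smooth_snd_nth: "smooth_on slit (\<lambda>q. snd q $ j)"
  by (intro smooth_on_nth smooth_on_bounded_linear[OF bounded_linear_snd] smooth_on_ident open_slit)

lemma smooth_Ncoef: "smooth_on slit (Ncoef L i m)"
  unfolding Ncoef_def[abs_def]
  by (intro smooth_on_mult smooth_on_const smooth_on_dy smooth_on_sum smooth_fund_inv smooth_on_add
      smooth_on_diff smooth_on_dx smooth_fund smooth_snd_nth open_slit)

lemma smooth_hdelta: "smooth_on slit f \<Longrightarrow> smooth_on slit (hdelta L k f)"
  unfolding hdelta_def[abs_def]
  by (intro smooth_on_diff smooth_on_dx smooth_on_sum smooth_on_mult smooth_Ncoef smooth_on_dy open_slit)

lemma smooth_chern: "smooth_on slit (chern L i j k)"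
  unfolding chern_def[abs_def] divide_inverse
  by (intro smooth_on_sum smooth_on_mult smooth_fund_inv smooth_on_const smooth_on_add smooth_on_diff
      smooth_hdelta smooth_fund open_slit)

text \<open>Differentiation along the fibre lowers the degree of homogeneity by one. The factor is \<^term>\<open>c\<close>
  rather than a power of \<^term>\<open>r\<close>, so that the lemma can be iterated.\<close>

lemma dy_of_homogeneous:
  assumes f: "smooth_on slit f" and r: "0 < r" and q: "(x, y) \<in> slit"
    and hom: "\<And>x y. (x, y) \<in> slit \<Longrightarrow> f (x, r *\<^sub>R y) = c * f (x, y)"
  shows "r * dy j f (x, r *\<^sub>R y) = c * dy j f (x, y)"
proof -
  let ?m = "\<lambda>q. (fst q, r *\<^sub>R snd q) :: (real ^ 'n) \<times> (real ^ 'n)"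
  have rq: "(x, r *\<^sub>R y) \<in> slit" using q r by auto
  have "(?m has_derivative (\<lambda>v. (fst v, r *\<^sub>R snd v))) (at (x, y))"
    by (auto intro!: derivative_eq_intros)
  moreover have "(f has_derivative frechet_derivative f (at (x, r *\<^sub>R y))) (at (?m (x, y)))"
    using smooth_on_has_derivative[OF f rq] by simp
  ultimately have "((\<lambda>q. f (?m q)) has_derivative
      (\<lambda>v. frechet_derivative f (at (x, r *\<^sub>R y)) (fst v, r *\<^sub>R snd v))) (at (x, y))"
    using diff_chain_at[of ?m _ "(x, y)" f] by (simp add: o_def)
  from frechet_derivative_at[OF this]
  have "dy j (\<lambda>q. f (?m q)) (x, y) = frechet_derivative f (at (x, r *\<^sub>R y)) (0, r *\<^sub>R axis j 1)"
    by (simp add: dy_def fun_eq_iff)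
  also have "\<dots> = frechet_derivative f (at (x, r *\<^sub>R y)) (r *\<^sub>R (0, axis j 1))" by simp
  also have "\<dots> = r * dy j f (x, r *\<^sub>R y)"
    unfolding linear_scale[OF linear_frechet_derivative[OF smooth_on_differentiable[OF f rq]]]
    by (simp add: dy_def)
  finally have "r * dy j f (x, r *\<^sub>R y) = dy j (\<lambda>q. f (?m q)) (x, y)" by simp
  also have "\<dots> = dy j (\<lambda>q. c * f q) (x, y)"
    by (rule dy_cong[OF open_slit q]) (auto simp: hom)
  also have "\<dots> = c * dy j f (x, y)"
    by (rule dy_scale[OF smooth_on_differentiable[OF f q]])
  finally show ?thesis .
qed

lemma fund_homog:
  assumes r: "0 < r" and q: "(x, y) \<in> slit"
  shows "fund L i j (x, r *\<^sub>R y) = fund L i j (x, y)"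
proof -
  have "r * dy j (\<lambda>q. (L q)\<^sup>2) (x, r *\<^sub>R y) = r\<^sup>2 * dy j (\<lambda>q. (L q)\<^sup>2) (x, y)"
    if "(x, y) \<in> slit" for x y
    by (rule dy_of_homogeneous[OF smooth_L2 r that]) (use r in \<open>auto simp: homog power_mult_distrib\<close>)
  then have "dy j (\<lambda>q. (L q)\<^sup>2) (x, r *\<^sub>R y) = r * dy j (\<lambda>q. (L q)\<^sup>2) (x, y)"
    if "(x, y) \<in> slit" for x y
    using that r by (simp add: power2_eq_square)
  from dy_of_homogeneous[OF smooth_on_dy[OF smooth_L2] r q this, of i]
  show ?thesis using r by (simp add: fund_def)
qed

text \<open>The Cartan tensor (the derivative of the fundamental tensor along the fibre) is totally
  symmetric and, by Euler's relation for the \<open>0\<close>-homogeneous fundamental tensor, annihilates the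
  position vector of the fibre.\<close>

lemma dy_fund_total_sym:
  assumes q: "q \<in> slit"
  shows "dy m (fund L i j) q = dy i (fund L m j) q"
proof -
  have half: "dy m (fund L i j) q = 1/2 * dy m (dy i (dy j (\<lambda>q. (L q)\<^sup>2))) q" for i m
    unfolding fund_def[abs_def]
    by (rule dy_scale[OF smooth_on_differentiable[OF smooth_on_dy[OF smooth_on_dy[OF smooth_L2]] q]])
  have "dy m (dy i (dy j (\<lambda>q. (L q)\<^sup>2))) q = dy i (dy m (dy j (\<lambda>q. (L q)\<^sup>2))) q"
    unfolding dy_def[of m] dy_def[of i] dy_def[of m, abs_def] dy_def[of i, abs_def]
    by (rule frechet_derivative_commute[OF open_slit smooth_on_dy[OF smooth_L2] q])
  then show ?thesis by (simp only: half)
qed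

lemma dy_fund_sym: "q \<in> slit \<Longrightarrow> dy m (fund L i j) q = dy m (fund L j i) q"
  by (rule dy_cong[OF open_slit _ fund_sym])

lemma dy_fund_euler:
  assumes q: "(x, y) \<in> slit"
  shows "(\<Sum>m\<in>UNIV. y $ m * dy m (fund L i j) (x, y)) = 0"
proof -
  have f: "fund L i j differentiable (at (x, y))" by (rule smooth_on_differentiable[OF smooth_fund q])
  have "((\<lambda>r. (x, r *\<^sub>R y)) has_derivative (\<lambda>r. (0, r *\<^sub>R y))) (at 1)"
    by (auto intro!: derivative_eq_intros)
  moreover have "(fund L i j has_derivative frechet_derivative (fund L i j) (at (x, y))) (at (x, 1 *\<^sub>R y))"
    using f by (simp add: frechet_derivative_works)
  ultimately have D: "((\<lambda>r. fund L i j (x, r *\<^sub>R y)) has_derivative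
      (\<lambda>r. frechet_derivative (fund L i j) (at (x, y)) (0, r *\<^sub>R y))) (at 1)"
    using diff_chain_at[of "\<lambda>r. (x, r *\<^sub>R y)" _ 1 "fund L i j"] by (simp add: o_def)
  have "((\<lambda>r. fund L i j (x, r *\<^sub>R y)) has_derivative (\<lambda>_. 0)) (at 1)"
    by (rule has_derivative_transform_within_open[OF has_derivative_const open_greaterThan[of 0],
          of 1 "fund L i j (x, y)"]) (use fund_homog[OF _ q] in auto)
  from has_derivative_unique[OF D this]
  have "frechet_derivative (fund L i j) (at (x, y)) (0, 1 *\<^sub>R y) = 0" by metis
  then show ?thesis using frechet_derivative_fibre_direction[OF f] by simp
qed

lemma dy_fund_euler2:
  assumes q: "(x, y) \<in> slit"
  shows "(\<Sum>j\<in>UNIV. y $ j * dy m (fund L i j) (x, y)) = 0"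
proof -
  have "(\<Sum>j\<in>UNIV. y $ j * dy m (fund L i j) (x, y)) = (\<Sum>j\<in>UNIV. y $ j * dy j (fund L m i) (x, y))"
    using dy_fund_sym[OF q] dy_fund_total_sym[OF q] by simp
  then show ?thesis by (simp only: dy_fund_euler[OF q])
qed

lemma dx_fund_sym: "q \<in> slit \<Longrightarrow> dx k (fund L i j) q = dx k (fund L j i) q"
  by (rule dx_cong[OF open_slit _ fund_sym])

lemma hdelta_fund_sym: "q \<in> slit \<Longrightarrow> hdelta L k (fund L i j) q = hdelta L k (fund L j i) q"
  unfolding hdelta_def using dy_fund_sym[of q _ i j] dx_fund_sym[of q k i j] by simp

lemma chern_levi_civita:
  "chern L i j k q = levi_civita_coeff (\<chi> a b. fund L a b q) (\<lambda>k i j. hdelta L k (fund L i j) q) i j k"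
  by (simp add: chern_def levi_civita_coeff_def fund_inv_def)

lemma chern_sym: "q \<in> slit \<Longrightarrow> chern L i j k q = chern L i k j q"
  unfolding chern_levi_civita by (rule levi_civita_coeff_commute) (rule hdelta_fund_sym)

lemma hdelta_fund:
  assumes "q \<in> slit"
  shows "hdelta L k (fund L i j) q = (\<Sum>s\<in>UNIV. fund L i s q * chern L s j k q) +
    (\<Sum>s\<in>UNIV. fund L j s q * chern L s i k q)"
  using levi_civita_coeff_metric[OF invertible_fund[OF assms], of "\<lambda>k i j. hdelta L k (fund L i j) q",
      OF hdelta_fund_sym[OF assms], of k i j]
  unfolding chern_levi_civita by simp

text \<open>Contracted with the fibre coordinate, the horizontal derivative of the fundamental tensor
  loses its fibre part. Hence the Chern connection has the spray of the formal Christoffel symbols,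
  and the nonlinear connection is half the fibre derivative of that spray.\<close>

lemma hdelta_fund_contract:
  assumes q: "(x, y) \<in> slit"
  shows "(\<Sum>j\<in>UNIV. y $ j * hdelta L k (fund L s j) (x, y)) =
    (\<Sum>j\<in>UNIV. y $ j * dx k (fund L s j) (x, y))"
proof -
  have "(\<Sum>j\<in>UNIV. y $ j * (\<Sum>m\<in>UNIV. Ncoef L m k (x, y) * dy m (fund L s j) (x, y))) =
    (\<Sum>m\<in>UNIV. Ncoef L m k (x, y) * (\<Sum>j\<in>UNIV. y $ j * dy m (fund L s j) (x, y)))"
    unfolding sum_distrib_left by (subst sum.swap) (simp add: ac_simps)
  also have "\<dots> = 0" by (simp only: dy_fund_euler2[OF q]) simp
  finally show ?thesis by (simp add: hdelta_def right_diff_distrib sum_subtractf)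
qed

lemma chern_spray:
  assumes q: "q \<in> slit"
  shows "(\<Sum>j\<in>UNIV. \<Sum>k\<in>UNIV. chern L i j k q * snd q $ j * snd q $ k) =
    1/2 * (\<Sum>s\<in>UNIV. \<Sum>j\<in>UNIV. \<Sum>k\<in>UNIV. fund_inv L i s q *
        (dx j (fund L s k) q + dx k (fund L s j) q - dx s (fund L k j) q) * (snd q $ j) * (snd q $ k))"
proof -
  obtain x y where xy: "q = (x, y)" by fastforce
  have H1: "(\<Sum>j\<in>UNIV. \<Sum>k\<in>UNIV. y $ k * (y $ j * hdelta L k (fund L s j) q)) =
      (\<Sum>j\<in>UNIV. \<Sum>k\<in>UNIV. y $ k * (y $ j * dx k (fund L s j) q))" for s
    by (subst (1 2) sum.swap)
      (simp only: sum_distrib_left[symmetric] xy hdelta_fund_contract[OF q[unfolded xy]])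
  have H2: "(\<Sum>j\<in>UNIV. \<Sum>k\<in>UNIV. y $ j * (y $ k * hdelta L s (fund L j k) q)) =
      (\<Sum>j\<in>UNIV. \<Sum>k\<in>UNIV. y $ j * (y $ k * dx s (fund L j k) q))" for s
    by (simp only: sum_distrib_left[symmetric] xy hdelta_fund_contract[OF q[unfolded xy]])
  have H3: "(\<Sum>j\<in>UNIV. \<Sum>k\<in>UNIV. y $ j * (y $ k * hdelta L j (fund L s k) q)) =
      (\<Sum>j\<in>UNIV. \<Sum>k\<in>UNIV. y $ j * (y $ k * dx j (fund L s k) q))" for s
    by (simp only: sum_distrib_left[symmetric] xy hdelta_fund_contract[OF q[unfolded xy]])
  have inner: "(\<Sum>j\<in>UNIV. \<Sum>k\<in>UNIV. (hdelta L k (fund L s j) q - hdelta L s (fund L j k) q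
        + hdelta L j (fund L k s) q) * y $ j * y $ k) =
      (\<Sum>j\<in>UNIV. \<Sum>k\<in>UNIV. (dx j (fund L s k) q + dx k (fund L s j) q - dx s (fund L k j) q) * y $ j * y $ k)"
    (is "?l = ?r") for s
  proof -
    have "?l = (\<Sum>j\<in>UNIV. \<Sum>k\<in>UNIV. y $ k * (y $ j * hdelta L k (fund L s j) q))
      - (\<Sum>j\<in>UNIV. \<Sum>k\<in>UNIV. y $ j * (y $ k * hdelta L s (fund L j k) q))
      + (\<Sum>j\<in>UNIV. \<Sum>k\<in>UNIV. y $ j * (y $ k * hdelta L j (fund L s k) q))"
      unfolding sum_subtractf[symmetric] sum.distrib[symmetric]
      by (intro sum.cong refl) (simp add: hdelta_fund_sym[OF q, of _ _ s] algebra_simps)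
    also have "\<dots> = ?r"
      unfolding H1 H2 H3 sum_subtractf[symmetric] sum.distrib[symmetric]
    proof (intro sum.cong refl)
      fix j k
      show "y $ k * (y $ j * dx k (fund L s j) q) - y $ j * (y $ k * dx s (fund L j k) q) +
         y $ j * (y $ k * dx j (fund L s k) q) =
         (dx j (fund L s k) q + dx k (fund L s j) q - dx s (fund L k j) q) * y $ j * y $ k"
        unfolding dx_fund_sym[OF q, of s k j] by (simp add: algebra_simps)
    qed
    finally show ?thesis .
  qed
  have "(\<Sum>j\<in>UNIV. \<Sum>k\<in>UNIV. chern L i j k q * y $ j * y $ k) =
    (\<Sum>j\<in>UNIV. \<Sum>k\<in>UNIV. \<Sum>s\<in>UNIV. fund_inv L i s q / 2 * ((hdelta L k (fund L s j) q
      - hdelta L s (fund L j k) q + hdelta L j (fund L k s) q) * y $ j * y $ k))"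
    unfolding chern_def sum_distrib_right by (simp only: mult.assoc)
  also have "\<dots> = (\<Sum>j\<in>UNIV. \<Sum>s\<in>UNIV. \<Sum>k\<in>UNIV. fund_inv L i s q / 2 * ((hdelta L k (fund L s j) q
      - hdelta L s (fund L j k) q + hdelta L j (fund L k s) q) * y $ j * y $ k))"
    by (rule sum.cong[OF refl], rule sum.swap)
  also have "\<dots> = (\<Sum>s\<in>UNIV. \<Sum>j\<in>UNIV. \<Sum>k\<in>UNIV. fund_inv L i s q / 2 * ((hdelta L k (fund L s j) q
      - hdelta L s (fund L j k) q + hdelta L j (fund L k s) q) * y $ j * y $ k))"
    by (rule sum.swap)
  also have "\<dots> = (\<Sum>s\<in>UNIV. fund_inv L i s q / 2 * (\<Sum>j\<in>UNIV. \<Sum>k\<in>UNIV.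
      (dx j (fund L s k) q + dx k (fund L s j) q - dx s (fund L k j) q) * y $ j * y $ k))"
    by (simp only: sum_distrib_left[symmetric] inner)
  finally show ?thesis
    unfolding xy snd_conv by (simp add: sum_distrib_left mult.assoc)
qed

lemma Ncoef_chern:
  assumes "q \<in> slit"
  shows "Ncoef L i m q = 1/2 * dy m (\<lambda>q. \<Sum>j\<in>UNIV. \<Sum>k\<in>UNIV. chern L i j k q * snd q $ j * snd q $ k) q"
proof -
  let ?S = "\<lambda>q. \<Sum>j\<in>UNIV. \<Sum>k\<in>UNIV. chern L i j k q * snd q $ j * snd q $ k"
  have S: "?S differentiable (at q)"
    by (rule smooth_on_differentiable[OF _ assms])
      (intro smooth_on_sum smooth_on_mult smooth_chern smooth_snd_nth open_slit)
  have "Ncoef L i m q = 1/4 * dy m (\<lambda>q. 2 * ?S q) q"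
    unfolding Ncoef_def by (subst dy_cong[OF open_slit assms]) (auto simp: chern_spray)
  then show ?thesis using dy_scale[OF S, of m 2] by simp
qed

end

section \<open>Berwald spaces and geodesic fields\<close>

text \<open>The commutator of second covariant derivatives of a vector field is its curvature term. The
  field enters the right-hand side only through its derivative \<open>W\<close>, so two connections that differ but
  assign the same derivative to \<^term>\<open>X\<close> can be compared through this formula.\<close>

lemma ricci_identity:
  fixes X :: "real ^ 'n::finite \<Rightarrow> real ^ 'n" and G :: "'n \<Rightarrow> 'n \<Rightarrow> 'n \<Rightarrow> real ^ 'n \<Rightarrow> real"
  assumes V: "open V" "x \<in> V" and X: "smooth_on V X"
    and G: "\<And>i j k. G i j k differentiable (at x)"
    and W: "\<And>i l z. W i l z = pd l (\<lambda>z. X z $ i) z + (\<Sum>j\<in>UNIV. G i j l z * X z $ j)"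
  shows "(\<Sum>j\<in>UNIV. conn_curvature (\<lambda>k i j l. pd k (G i j l) x) (\<lambda>i j k. G i j k x) i j k l * X x $ j) =
    pd k (W i l) x - pd l (W i k) x
    + (\<Sum>m\<in>UNIV. G i m k x * W m l x) - (\<Sum>m\<in>UNIV. G i m l x * W m k x)"
proof -
  have Xi: "smooth_on V (\<lambda>z. X z $ i)" for i by (rule smooth_on_nth[OF V(1) X])
  have dX: "(\<lambda>z. X z $ i) differentiable (at x)" for i by (rule smooth_on_differentiable[OF Xi V(2)])
  have ddX: "pd l (\<lambda>z. X z $ i) differentiable (at x)" for i l
    unfolding pd_def[abs_def] by (rule smooth_on_differentiable[OF smooth_on_frechet_derivative[OF Xi] V(2)])
  have dGX: "(\<lambda>z. \<Sum>j\<in>UNIV. G i j l z * X z $ j) differentiable (at x)" for i l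
    by (intro differentiable_sum finite ballI differentiable_mult G dX)
  define A where "A k l = (\<Sum>j\<in>UNIV. pd k (G i j l) x * X x $ j)" for k l
  define B where "B k l = (\<Sum>j\<in>UNIV. G i j l x * pd k (\<lambda>z. X z $ j) x)" for k l
  define Q where "Q k l = (\<Sum>m\<in>UNIV. \<Sum>j\<in>UNIV. G i m k x * (G m j l x * X x $ j))" for k l
  have pdW: "pd k (W i l) x = pd k (pd l (\<lambda>z. X z $ i)) x + (A k l + B k l)" for k l
  proof -
    have "W i l = (\<lambda>z. pd l (\<lambda>z. X z $ i) z + (\<Sum>j\<in>UNIV. G i j l z * X z $ j))"
      by (rule ext) (rule W)
    then show ?thesis
      by (simp only: pd_add[OF ddX dGX] pd_sum_mult[OF G dX] A_def B_def sum.distrib)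
  qed
  have GW: "(\<Sum>m\<in>UNIV. G i m k x * W m l x) = B l k + Q k l" for k l
    by (simp add: W B_def Q_def distrib_left sum.distrib sum_distrib_left)
  have quad: "(\<Sum>j\<in>UNIV. (\<Sum>m\<in>UNIV. G i m k x * G m j l x) * X x $ j) = Q k l" for k l
    unfolding Q_def sum_distrib_right by (subst sum.swap) (simp add: mult.assoc)
  have curv: "(\<Sum>j\<in>UNIV. conn_curvature (\<lambda>k i j l. pd k (G i j l) x) (\<lambda>i j k. G i j k x) i j k l * X x $ j)
      = A k l - A l k + Q k l - Q l k"
    unfolding conn_curvature_def left_diff_distrib distrib_right sum_subtractf sum.distrib quad A_def ..
  have "pd k (pd l (\<lambda>z. X z $ i)) x = pd l (pd k (\<lambda>z. X z $ i)) x"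
    unfolding pd_def by (rule frechet_derivative_commute[OF V(1) Xi V(2)])
  then show ?thesis unfolding curv pdW GW by simp
qed

locale berwald_chart = finsler_chart L U for L :: "'n::finite tfun" and U +
  assumes chern_fibre_const:
    "x \<in> U \<Longrightarrow> y \<noteq> 0 \<Longrightarrow> z \<noteq> 0 \<Longrightarrow> chern L i j k (x, y) = chern L i j k (x, z)"
begin

text \<open>Every nonzero vector serves equally well as the point of evaluation.\<close>

definition conn :: "'n \<Rightarrow> 'n \<Rightarrow> 'n \<Rightarrow> real ^ 'n \<Rightarrow> real" where
  "conn i j k x = chern L i j k (x, axis undefined 1)"

lemma chern_conn: "(x, y) \<in> slit \<Longrightarrow> chern L i j k (x, y) = conn i j k x"
  unfolding conn_def by (rule chern_fibre_const) (auto simp: axis_eq_0_iff)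

lemma conn_sym: "x \<in> U \<Longrightarrow> conn i j k x = conn i k j x"
  unfolding conn_def by (rule chern_sym) (auto simp: axis_eq_0_iff)

lemma smooth_conn: "smooth_on U (conn i j k)"
  unfolding conn_def[abs_def]
  by (rule smooth_on_compose[OF open_U open_slit _ smooth_chern
        smooth_on_Pair[OF open_U smooth_on_ident[OF open_U] smooth_on_const]])
    (auto simp: axis_eq_0_iff)

lemma open_punctured: "open (UNIV - {0 :: real ^ 'n})"
  by (intro open_Diff open_UNIV closed_singleton)

text \<open>The spray is quadratic along the fibre, and half of its fibre derivative is linear.\<close>

lemma Ncoef_conn:
  assumes q: "(x, y) \<in> slit"
  shows "Ncoef L i m (x, y) = (\<Sum>k\<in>UNIV. conn i m k x * y $ k)"
proof -
  let ?S = "\<lambda>q. \<Sum>j\<in>UNIV. \<Sum>k\<in>UNIV. chern L i j k q * snd q $ j * snd q $ k"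
  have S: "?S differentiable (at (x, y))"
    by (rule smooth_on_differentiable[OF _ q])
      (intro smooth_on_sum smooth_on_mult smooth_chern smooth_snd_nth open_slit)
  have "dy m ?S (x, y) = pd m (\<lambda>z. ?S (x, z)) y" by (rule dy_slice[OF S])
  also have "\<dots> = pd m (\<lambda>z. \<Sum>j\<in>UNIV. \<Sum>k\<in>UNIV. conn i j k x * z $ j * z $ k) y"
    by (rule pd_cong[OF open_punctured]) (use q in \<open>auto simp: chern_conn\<close>)
  also have "\<dots> = (\<Sum>k\<in>UNIV. (conn i m k x + conn i k m x) * y $ k)" by (rule pd_quadratic_form)
  also have "\<dots> = 2 * (\<Sum>k\<in>UNIV. conn i m k x * y $ k)"
    using q conn_sym[of x i _ m] by (simp add: sum_distrib_left mult.assoc)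
  finally show ?thesis unfolding Ncoef_chern[OF q] by simp
qed

text \<open>Functions of the position alone have no fibre derivative, so the horizontal derivative is a partial
  derivative and the hh-curvature becomes the curvature of an ordinary affine connection.\<close>

lemma hdelta_chern:
  assumes q: "(x, y) \<in> slit"
  shows "hdelta L k (chern L i j l) (x, y) = pd k (conn i j l) x"
proof -
  have c: "chern L i j l differentiable (at (x, y))"
    by (rule smooth_on_differentiable[OF smooth_chern q])
  have "dx k (chern L i j l) (x, y) = pd k (conn i j l) x"
    unfolding dx_slice[OF c] by (rule pd_cong[OF open_U]) (use q in \<open>auto simp: chern_conn\<close>)
  moreover have "dy m (chern L i j l) (x, y) = pd m (\<lambda>_. conn i j l x) y" for m
    unfolding dy_slice[OF c] by (rule pd_cong[OF open_punctured]) (use q in \<open>auto simp: chern_conn\<close>)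
  ultimately show ?thesis by (simp add: hdelta_def pd_const)
qed

definition curv :: "real ^ 'n \<Rightarrow> 'n \<Rightarrow> 'n \<Rightarrow> 'n \<Rightarrow> 'n \<Rightarrow> real" where
  "curv x = conn_curvature (\<lambda>k i j l. pd k (conn i j l) x) (\<lambda>i j k. conn i j k x)"

lemma hh_curv_conn: "(x, y) \<in> slit \<Longrightarrow> hh_curv L i j k l (x, y) = curv x i j k l"
  by (simp add: hh_curv_def curv_def conn_curvature_def hdelta_chern chern_conn)

end

locale geodesic_section = berwald_chart L U for L :: "'n::finite tfun" and U +
  fixes V :: "(real ^ 'n) set" and X :: "real ^ 'n \<Rightarrow> real ^ 'n"
  assumes open_V: "open V" and V_subset: "V \<subseteq> U" and smooth_X: "smooth_on V X"
    and X_nonzero: "x \<in> V \<Longrightarrow> X x \<noteq> 0"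
    and geodesic: "x \<in> V \<Longrightarrow> (\<Sum>m\<in>UNIV. X x $ m * pd m (\<lambda>z. X z $ i) x) =
      - (\<Sum>j\<in>UNIV. \<Sum>k\<in>UNIV. chern L i j k (x, X x) * X x $ j * X x $ k)"
begin

definition section_metric :: "'n metric" where
  "section_metric i j x = fund L i j (x, X x)"

lemma section_in_slit: "x \<in> V \<Longrightarrow> (x, X x) \<in> slit"
  using V_subset X_nonzero by auto

sublocale metric_on_section: riemannian_chart section_metric V
proof
  show "open V" by (rule open_V)
  show "smooth_on V (section_metric i j)" for i j
    unfolding section_metric_def[abs_def]
    by (rule smooth_on_compose[OF open_V open_slit _ smooth_fund
          smooth_on_Pair[OF open_V smooth_on_ident[OF open_V] smooth_X]])
      (use section_in_slit in blast)
  show "section_metric i j x = section_metric j i x" if "x \<in> V" for i j x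
    unfolding section_metric_def by (rule fund_sym[OF section_in_slit[OF that]])
  show "pos_def_matrix (\<chi> a b. section_metric a b x)" if "x \<in> V" for x
    unfolding section_metric_def by (rule pos[OF section_in_slit[OF that]])
qed

definition cov :: "'n \<Rightarrow> 'n \<Rightarrow> real ^ 'n \<Rightarrow> real" where
  "cov m k z = pd k (\<lambda>z. X z $ m) z + (\<Sum>j\<in>UNIV. conn m j k z * X z $ j)"

lemma cov_along_itself:
  assumes x: "x \<in> V"
  shows "(\<Sum>k\<in>UNIV. X x $ k * cov m k x) = 0"
proof -
  have "(\<Sum>k\<in>UNIV. X x $ k * (\<Sum>j\<in>UNIV. conn m j k x * X x $ j)) =
    (\<Sum>j\<in>UNIV. \<Sum>k\<in>UNIV. chern L m j k (x, X x) * X x $ j * X x $ k)"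
    unfolding sum_distrib_left by (subst sum.swap) (simp add: chern_conn[OF section_in_slit[OF x]] ac_simps)
  then show ?thesis
    unfolding cov_def distrib_left sum.distrib geodesic[OF x] by simp
qed

lemma pd_section_metric:
  assumes x: "x \<in> V"
  shows "pd k (section_metric i j) x = hdelta L k (fund L i j) (x, X x) +
    (\<Sum>m\<in>UNIV. dy m (fund L i j) (x, X x) * cov m k x)"
proof -
  have xU: "x \<in> U" using x V_subset by blast
  have "pd k (section_metric i j) x = dx k (fund L i j) (x, X x) +
      (\<Sum>m\<in>UNIV. dy m (fund L i j) (x, X x) * pd k (\<lambda>z. X z $ m) x)"
    unfolding section_metric_def[abs_def]
    by (rule dx_dy_along_section[OF smooth_on_differentiable[OF smooth_fund section_in_slit[OF x]]
          smooth_on_differentiable[OF smooth_X x]])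
  moreover have "Ncoef L m k (x, X x) = (\<Sum>j\<in>UNIV. conn m j k x * X x $ j)" for m
    unfolding Ncoef_conn[OF section_in_slit[OF x]] using conn_sym[OF xU, of m k] by simp
  ultimately show ?thesis
    by (simp add: hdelta_def cov_def distrib_left sum.distrib mult.commute)
qed

text \<open>The Levi-Civita connection of the section metric and the Chern connection differ by the Cartan
  tensor contracted with the covariant derivative of the section. Of the three terms of the
  difference, applied to the section itself, two vanish since the Cartan tensor annihilates its base
  point, and the third one since the section is geodesic.\<close>

lemma christoffel_section_contract:
  assumes x: "x \<in> V"
  shows "(\<Sum>j\<in>UNIV. christoffel section_metric i j k x * X x $ j) =
    (\<Sum>j\<in>UNIV. conn i j k x * X x $ j)"
proof -
  note q = section_in_slit[OF x]
  define D where "D k a b = (\<Sum>m\<in>UNIV. dy m (fund L a b) (x, X x) * cov m k x)" for k a b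
  have D1: "(\<Sum>j\<in>UNIV. D k a j * X x $ j) = 0" for k a
  proof -
    have "(\<Sum>j\<in>UNIV. D k a j * X x $ j) =
      (\<Sum>m\<in>UNIV. (\<Sum>j\<in>UNIV. X x $ j * dy m (fund L a j) (x, X x)) * cov m k x)"
      unfolding D_def sum_distrib_right by (subst sum.swap) (simp add: ac_simps)
    then show ?thesis by (simp only: dy_fund_euler2[OF q]) simp
  qed
  have D2: "(\<Sum>j\<in>UNIV. D j a b * X x $ j) = 0" for a b
  proof -
    have "(\<Sum>j\<in>UNIV. D j a b * X x $ j) =
      (\<Sum>m\<in>UNIV. dy m (fund L a b) (x, X x) * (\<Sum>j\<in>UNIV. X x $ j * cov m j x))"
      unfolding D_def sum_distrib_right sum_distrib_left by (subst sum.swap) (simp add: ac_simps)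
    then show ?thesis by (simp only: cov_along_itself[OF x]) simp
  qed
  have D_sym: "D k a b = D k b a" for k a b
    unfolding D_def using dy_fund_sym[OF q, of _ a b] by simp
  have contract: "(\<Sum>i\<in>UNIV. M $ a $ i * (\<Sum>j\<in>UNIV. levi_civita_coeff M d i j k * X x $ j)) =
      (\<Sum>j\<in>UNIV. (d k a j - d a j k + d j k a) / 2 * X x $ j)" if "invertible M" for M d a k
  proof -
    have "(\<Sum>i\<in>UNIV. M $ a $ i * (\<Sum>j\<in>UNIV. levi_civita_coeff M d i j k * X x $ j)) =
      (\<Sum>j\<in>UNIV. (\<Sum>i\<in>UNIV. M $ a $ i * levi_civita_coeff M d i j k) * X x $ j)"
      unfolding sum_distrib_left sum_distrib_right by (subst sum.swap) (simp add: ac_simps)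
    then show ?thesis by (simp only: levi_civita_coeff_lower[OF that])
  qed
  let ?M = "\<chi> a b. fund L a b (x, X x)"
  have M: "(\<chi> a b. section_metric a b x) = ?M" by (simp add: section_metric_def)
  show ?thesis
  proof (rule lowered_index_eqD[OF invertible_fund[OF q],
        of "\<lambda>i. \<Sum>j\<in>UNIV. christoffel section_metric i j k x * X x $ j"
        "\<lambda>i. \<Sum>j\<in>UNIV. conn i j k x * X x $ j"])
    fix a
    have "(\<Sum>i\<in>UNIV. ?M $ a $ i * (\<Sum>j\<in>UNIV. christoffel section_metric i j k x * X x $ j)) =
      (\<Sum>j\<in>UNIV. (pd k (section_metric a j) x - pd a (section_metric j k) x + pd j (section_metric k a) x) / 2 * X x $ j)"
      unfolding metric_on_section.christoffel_levi_civita M by (rule contract[OF invertible_fund[OF q]])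
    also have "\<dots> = (\<Sum>j\<in>UNIV. (hdelta L k (fund L a j) (x, X x) - hdelta L a (fund L j k) (x, X x)
        + hdelta L j (fund L k a) (x, X x)) / 2 * X x $ j)
        + ((\<Sum>j\<in>UNIV. D k a j * X x $ j) - (\<Sum>j\<in>UNIV. D a k j * X x $ j)
        + (\<Sum>j\<in>UNIV. D j k a * X x $ j)) / 2"
      unfolding pd_section_metric[OF x] D_def[symmetric] sum.distrib[symmetric] sum_subtractf[symmetric]
        sum_divide_distrib D_sym[of a k]
      by (rule sum.cong[OF refl]) (simp add: field_simps)
    also have "\<dots> = (\<Sum>j\<in>UNIV. (hdelta L k (fund L a j) (x, X x) - hdelta L a (fund L j k) (x, X x)
        + hdelta L j (fund L k a) (x, X x)) / 2 * X x $ j)"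
      unfolding D1 D2 by simp
    also have "\<dots> = (\<Sum>i\<in>UNIV. ?M $ a $ i * (\<Sum>j\<in>UNIV. conn i j k x * X x $ j))"
      unfolding chern_conn[OF q, symmetric] chern_levi_civita
      by (rule contract[OF invertible_fund[OF q], symmetric])
    finally show "(\<Sum>i\<in>UNIV. ?M $ a $ i * (\<Sum>j\<in>UNIV. christoffel section_metric i j k x * X x $ j)) =
      (\<Sum>i\<in>UNIV. ?M $ a $ i * (\<Sum>j\<in>UNIV. conn i j k x * X x $ j))" .
  qed
qed

text \<open>Both connections assign the same covariant derivative to the section, so their Ricci identities have
  the same derivative terms. In the remaining terms the coefficients occur either contracted with the
  section, where they agree, or next to the derivative of the section along itself, which vanishes.\<close>

lemma jacobi_operator_section:
  assumes x: "x \<in> V"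
  shows "(\<Sum>j\<in>UNIV. \<Sum>l\<in>UNIV. riem section_metric i j k l x * X x $ j * X x $ l) =
    (\<Sum>j\<in>UNIV. \<Sum>l\<in>UNIV. curv x i j k l * X x $ j * X x $ l)"
proof -
  have xU: "x \<in> U" using x V_subset by blast
  let ?C = "christoffel section_metric"
  define W where "W i l z = pd l (\<lambda>z. X z $ i) z + (\<Sum>j\<in>UNIV. ?C i j l z * X z $ j)" for i l z
  have W: "W i l z = cov i l z" if "z \<in> V" for i l z
    unfolding W_def cov_def christoffel_section_contract[OF that] ..
  have pdW: "pd k (W i l) x = pd k (cov i l) x" for k i l by (rule pd_cong[OF open_V x W])
  have C: "?C i j k differentiable (at x)" "conn i j k differentiable (at x)" for i j k
    by (rule smooth_on_differentiable[OF metric_on_section.smooth_christoffel x])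
      (rule smooth_on_differentiable[OF smooth_conn xU])
  define H where "H l = pd k (cov i l) x - pd l (cov i k) x" for l
  have R1: "(\<Sum>j\<in>UNIV. riem section_metric i j k l x * X x $ j) =
    H l + (\<Sum>m\<in>UNIV. ?C i m k x * cov m l x) - (\<Sum>m\<in>UNIV. ?C i m l x * cov m k x)" for l
    using ricci_identity[OF open_V x smooth_X C(1) W_def, of i k l]
    unfolding metric_on_section.riem_conn_curvature pdW H_def W[OF x] .
  have R2: "(\<Sum>j\<in>UNIV. curv x i j k l * X x $ j) =
    H l + (\<Sum>m\<in>UNIV. conn i m k x * cov m l x) - (\<Sum>m\<in>UNIV. conn i m l x * cov m k x)" for l
    using ricci_identity[OF open_V x smooth_X C(2) cov_def, of i k l]
    unfolding curv_def H_def .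
  have along: "(\<Sum>l\<in>UNIV. X x $ l * (\<Sum>m\<in>UNIV. f m * cov m l x)) = 0" for f
  proof -
    have "(\<Sum>l\<in>UNIV. X x $ l * (\<Sum>m\<in>UNIV. f m * cov m l x)) =
      (\<Sum>m\<in>UNIV. f m * (\<Sum>l\<in>UNIV. X x $ l * cov m l x))"
      unfolding sum_distrib_left by (subst sum.swap) (simp add: ac_simps)
    then show ?thesis by (simp only: cov_along_itself[OF x]) simp
  qed
  have across: "(\<Sum>l\<in>UNIV. X x $ l * (\<Sum>m\<in>UNIV. g m l * cov m k x)) =
    (\<Sum>m\<in>UNIV. (\<Sum>l\<in>UNIV. g m l * X x $ l) * cov m k x)" for g
    unfolding sum_distrib_left sum_distrib_right by (subst sum.swap) (simp add: ac_simps)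
  have same: "(\<Sum>l\<in>UNIV. ?C i m l x * X x $ l) = (\<Sum>l\<in>UNIV. conn i m l x * X x $ l)" for m
    using christoffel_section_contract[OF x, of i m] metric_on_section.christoffel_sym[OF x, of i m]
      conn_sym[OF xU, of i m] by simp
  have swap: "(\<Sum>j\<in>UNIV. \<Sum>l\<in>UNIV. R j l * X x $ j * X x $ l) =
    (\<Sum>l\<in>UNIV. X x $ l * (\<Sum>j\<in>UNIV. R j l * X x $ j))" for R
    unfolding sum_distrib_left by (subst sum.swap) (simp add: ac_simps)
  show ?thesis
    unfolding swap R1 R2 right_diff_distrib distrib_left sum_subtractf sum.distrib along across same ..
qed

end

section \<open>Berwald spaces of constant flag curvature\<close>

context berwald_chart
begin

lemma smooth_fund_fibre: "x \<in> U \<Longrightarrow> smooth_on (UNIV - {0}) (\<lambda>z. fund L i j (x, z))"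
  by (rule smooth_on_compose[OF open_punctured open_slit _ smooth_fund
        smooth_on_Pair[OF open_punctured smooth_on_const smooth_on_ident[OF open_punctured]]]) auto

lemma pd_fund_fibre:
  assumes "(x, z) \<in> slit"
  shows "pd b (\<lambda>z. fund L i j (x, z)) z = dy b (fund L i j) (x, z)"
  by (rule dy_slice[OF smooth_on_differentiable[OF smooth_fund assms], symmetric])

definition lowered :: "real ^ 'n \<Rightarrow> 'n \<Rightarrow> real ^ 'n \<Rightarrow> real" where
  "lowered x k z = (\<Sum>m\<in>UNIV. fund L k m (x, z) * z $ m)"

definition energy :: "real ^ 'n \<Rightarrow> real ^ 'n \<Rightarrow> real" where
  "energy x z = (\<Sum>k\<in>UNIV. lowered x k z * z $ k)"

lemma differentiable_lowered:
  assumes q: "(x, z) \<in> slit"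
  shows "lowered x k differentiable (at z)"
proof -
  have "(\<lambda>z. fund L k m (x, z)) differentiable (at z)" for m
    using q by (intro smooth_on_differentiable[OF smooth_fund_fibre]) auto
  then show ?thesis
    unfolding lowered_def[abs_def]
    by (intro differentiable_sum finite ballI differentiable_mult differentiable_nth)
qed

lemma pd_lowered:
  assumes q: "(x, z) \<in> slit"
  shows "pd b (lowered x k) z = fund L k b (x, z)"
proof -
  have f: "(\<lambda>z. fund L k m (x, z)) differentiable (at z)" for m
    using q by (intro smooth_on_differentiable[OF smooth_fund_fibre]) auto
  have "pd b (lowered x k) z = (\<Sum>m\<in>UNIV. z $ m * dy b (fund L k m) (x, z)) +
    (\<Sum>m\<in>UNIV. fund L k m (x, z) * (if m = b then 1 else 0))"
    unfolding lowered_def[abs_def] pd_sum_mult[OF f differentiable_nth] pd_fund_fibre[OF q] pd_nth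
      sum.distrib by (simp only: mult.commute)
  then show ?thesis unfolding dy_fund_euler2[OF q] sum_delta_mult by simp
qed

lemma differentiable_energy: "(x, z) \<in> slit \<Longrightarrow> energy x differentiable (at z)"
  unfolding energy_def[abs_def]
  by (intro differentiable_sum finite ballI differentiable_mult differentiable_nth differentiable_lowered)

lemma pd_energy:
  assumes q: "(x, z) \<in> slit"
  shows "pd b (energy x) z = 2 * lowered x b z"
proof -
  have "pd b (energy x) z = (\<Sum>k\<in>UNIV. fund L b k (x, z) * z $ k) +
    (\<Sum>k\<in>UNIV. lowered x k z * (if k = b then 1 else 0))"
    unfolding energy_def[abs_def] pd_sum_mult[OF differentiable_lowered[OF q] differentiable_nth]
      pd_lowered[OF q] pd_nth sum.distrib fund_sym[OF q, of b] ..
  then show ?thesis unfolding lowered_def[symmetric] sum_delta_mult by simp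
qed

text \<open>The Jacobi operators \<open>u \<mapsto> R(u, y) y\<close> are quadratic in \<open>y\<close> with coefficients independent of
  \<open>y\<close>. Two fibre derivatives of the constant curvature identity therefore express the symmetrised
  curvature by the fundamental tensor, up to a term with the Cartan tensor; the trace removes that
  term and shows that \<open>r\<close> times the fundamental tensor does not depend on \<open>y\<close> either, so that the
  Cartan term vanishes. The first Bianchi identity recovers the curvature from its symmetrisation.\<close>

lemma curv_of_constant_flag:
  assumes dim: "1 < CARD('n)"
    and jac: "\<And>x y i k. (x, y) \<in> slit \<Longrightarrow>
      (\<Sum>j\<in>UNIV. \<Sum>l\<in>UNIV. curv x i j k l * y $ j * y $ l) =
        r * ((if i = k then energy x y else 0) - y $ i * lowered x k y)"
    and q: "(x, y) \<in> slit"
  shows "curv x i j k l = r * ((if i = k then fund L j l (x, y) else 0)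
    - (if i = l then fund L j k (x, y) else 0))"
proof -
  define e :: "'n \<Rightarrow> 'n \<Rightarrow> real" where "e i k = (if i = k then 1 else 0)" for i k
  have in_slit: "(x, z) \<in> slit \<longleftrightarrow> z \<in> UNIV - {0}" for z using q by auto
  have first: "(\<Sum>l\<in>UNIV. (curv x i b k l + curv x i l k b) * z $ l) =
      r * (2 * e i k * lowered x b z - (e i b * lowered x k z + z $ i * fund L k b (x, z)))"
    if z: "z \<in> UNIV - {0}" for z i b k
  proof -
    have qz: "(x, z) \<in> slit" using z in_slit by blast
    have dz: "(\<lambda>z. e i k * energy x z) differentiable (at z)"
        "(\<lambda>z. z $ i * lowered x k z) differentiable (at z)"
      by (intro differentiable_mult differentiable_const differentiable_energy qz
          differentiable_nth differentiable_lowered)+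
    have "(\<Sum>l\<in>UNIV. (curv x i b k l + curv x i l k b) * z $ l) =
        pd b (\<lambda>z. \<Sum>j\<in>UNIV. \<Sum>l\<in>UNIV. curv x i j k l * z $ j * z $ l) z"
      by (rule pd_quadratic_form[symmetric])
    also have "\<dots> = pd b (\<lambda>z. r * (e i k * energy x z - z $ i * lowered x k z)) z"
      by (rule pd_cong[OF open_punctured z]) (subst jac, simp only: in_slit, simp add: e_def)
    also have "\<dots> = r * (e i k * pd b (energy x) z
        - (pd b (\<lambda>z. z $ i) z * lowered x k z + z $ i * pd b (lowered x k) z))"
      using pd_scale[OF differentiable_diff[OF dz], of b r] pd_diff[OF dz, of b]
        pd_scale[OF differentiable_energy[OF qz], of b "e i k"]
        pd_mult[OF differentiable_nth differentiable_lowered[OF qz], of b i k]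
      by (simp only:)
    finally show ?thesis
      unfolding pd_energy[OF qz] pd_nth pd_lowered[OF qz] by (simp add: e_def)
  qed
  have second: "curv x i b k a + curv x i a k b =
      r * (2 * e i k * fund L b a (x, z) - (e i b * fund L k a (x, z)
        + (e i a * fund L k b (x, z) + z $ i * dy a (fund L k b) (x, z))))"
    if z: "z \<in> UNIV - {0}" for z i b k a
  proof -
    have qz: "(x, z) \<in> slit" using z in_slit by blast
    have f: "(\<lambda>z. fund L k b (x, z)) differentiable (at z)"
      using qz z by (intro smooth_on_differentiable[OF smooth_fund_fibre]) auto
    have dz: "(\<lambda>z. 2 * e i k * lowered x b z) differentiable (at z)"
        "(\<lambda>z. e i b * lowered x k z) differentiable (at z)"
        "(\<lambda>z. z $ i * fund L k b (x, z)) differentiable (at z)"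
      by (intro differentiable_mult differentiable_const qz
          differentiable_nth differentiable_lowered f)+
    have "curv x i b k a + curv x i a k b =
        pd a (\<lambda>z. \<Sum>l\<in>UNIV. (curv x i b k l + curv x i l k b) * z $ l) z"
      by (rule pd_linear_form[symmetric])
    also have "\<dots> = pd a (\<lambda>z. r * (2 * e i k * lowered x b z
        - (e i b * lowered x k z + z $ i * fund L k b (x, z)))) z"
      by (rule pd_cong[OF open_punctured z first])
    also have "\<dots> = r * (2 * e i k * pd a (lowered x b) z - (e i b * pd a (lowered x k) z
        + (pd a (\<lambda>z. z $ i) z * fund L k b (x, z) + z $ i * pd a (\<lambda>z. fund L k b (x, z)) z)))"
      using pd_scale[OF differentiable_diff[OF dz(1) differentiable_add[OF dz(2,3)]], of a r]
        pd_diff[OF dz(1) differentiable_add[OF dz(2,3)], of a]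
        pd_add[OF dz(2,3), of a]
        pd_scale[OF differentiable_lowered[OF qz, of b], of a "2 * e i k"]
        pd_scale[OF differentiable_lowered[OF qz, of k], of a "e i b"]
        pd_mult[OF differentiable_nth f, of a i]
      by (simp only:)
    finally show ?thesis
      unfolding pd_lowered[OF qz] pd_nth pd_fund_fibre[OF qz] by (simp add: e_def)
  qed
  have trace: "(\<Sum>i\<in>UNIV. curv x i b i a + curv x i a i b) =
      (2 * CARD('n) - 2) * (r * fund L b a (x, z))" if z: "z \<in> UNIV - {0}" for z a b
  proof -
    have qz: "(x, z) \<in> slit" using z in_slit by blast
    have "(\<Sum>i\<in>UNIV. curv x i b i a + curv x i a i b) =
      (\<Sum>i\<in>UNIV. 2 * (r * fund L b a (x, z)) - r * (e i b * fund L i a (x, z))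
        - r * (e i a * fund L i b (x, z)) - r * (z $ i * dy a (fund L b i) (x, z)))"
      by (rule sum.cong[OF refl])
        (subst second[OF z], simp add: e_def dy_fund_sym[OF qz, of a _ b] algebra_simps)
    also have "\<dots> = CARD('n) * (2 * (r * fund L b a (x, z))) - r * fund L b a (x, z)
        - r * fund L a b (x, z) - r * 0"
      unfolding sum_subtractf sum_distrib_left[symmetric] dy_fund_euler2[OF qz]
      by (simp only: e_def sum_delta_mult sum_constant) (simp add: ac_simps)
    also have "\<dots> = (2 * CARD('n) - 2) * (r * fund L b a (x, z))"
      using dim by (simp add: fund_sym[OF qz, of a b] algebra_simps of_nat_diff)
    finally show ?thesis .
  qed
  \<comment> \<open>The left-hand side of the trace identity does not depend on the fibre coordinate.\<close>
  have cartan: "r * dy c (fund L b a) (x, y) = 0" for a b c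
  proof -
    have y: "y \<in> UNIV - {0}" using q by auto
    let ?n = "real (2 * CARD('n) - 2)"
    have f: "(\<lambda>z. fund L b a (x, z)) differentiable (at y)"
      using q y by (intro smooth_on_differentiable[OF smooth_fund_fibre]) auto
    have "?n * r * dy c (fund L b a) (x, y) = pd c (\<lambda>z. (?n * r) * fund L b a (x, z)) y"
      unfolding pd_scale[OF f] pd_fund_fibre[OF q] ..
    also have "\<dots> = pd c (\<lambda>z. \<Sum>i\<in>UNIV. curv x i b i a + curv x i a i b) y"
      by (rule pd_cong[OF open_punctured y]) (simp only: trace mult.assoc)
    also have "\<dots> = 0" by (rule pd_const)
    finally show ?thesis using dim by simp
  qed
  have sym: "curv x i b k a + curv x i a k b =
      r * (2 * e i k * fund L b a (x, y)) - r * (e i b * fund L k a (x, y))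
      - r * (e i a * fund L k b (x, y))" for i a b k
  proof -
    have "r * (y $ i * dy a (fund L k b) (x, y)) = 0" using cartan[of a k b] by auto
    then show ?thesis
      using second[of y i b k a] q unfolding right_diff_distrib distrib_left by auto
  qed
  have xU: "x \<in> U" using q by auto
  have bianchi: "curv x i j k l + curv x i k l j + curv x i l j k = 0"
    unfolding curv_def
    by (rule conn_curvature_bianchi) (rule conn_sym[OF xU] pd_cong[OF open_U xU conn_sym]; assumption)+
  have antisym: "curv x i j k l = - curv x i j l k" for i j k l
    unfolding curv_def by (rule conn_curvature_antisym)
  have "3 * curv x i j k l = (curv x i j k l + curv x i l k j) - (curv x i j l k + curv x i k l j)"
    using bianchi antisym[of i j k l] antisym[of i l k j] by linarith
  also have "\<dots> = 3 * (r * (e i k * fund L j l (x, y)) - r * (e i l * fund L j k (x, y)))"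
    unfolding sym[of i j k l] sym[of i j l k] fund_sym[OF q, of k l] fund_sym[OF q, of k j]
      fund_sym[OF q, of l j]
    by (simp add: algebra_simps)
  finally have "curv x i j k l = r * (e i k * fund L j l (x, y)) - r * (e i l * fund L j k (x, y))"
    by (simp only: mult_cancel_left) simp
  then show ?thesis by (simp add: e_def right_diff_distrib)
qed

text \<open>The Chern connection is horizontally metric, so a curvature tensor that is built from the
  fundamental tensor with constant coefficients is horizontally parallel.\<close>

lemma hcov_of_constant_curvature:
  assumes R: "\<And>q i j k l. q \<in> slit \<Longrightarrow> hh_curv L i j k l q =
      r * ((if i = k then fund L j l q else 0) - (if i = l then fund L j k q else 0))"
    and q: "q \<in> slit"
  shows "hcov L l (hh_curv L) i j k h q = 0"
proof -
  define e :: "'n \<Rightarrow> 'n \<Rightarrow> real" where "e i k = (if i = k then 1 else 0)" for i k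
  have R': "hh_curv L i j k l q = r * e i k * fund L j l q - r * e i l * fund L j k q"
    if "q \<in> slit" for q i j k l
    unfolding R[OF that] by (simp add: e_def algebra_simps)
  have f: "fund L i j differentiable (at q)" for i j
    by (rule smooth_on_differentiable[OF smooth_fund q])
  have comb: "frechet_derivative (\<lambda>q. a * fund L j h q - b * fund L j k q) (at q) v =
    a * frechet_derivative (fund L j h) (at q) v - b * frechet_derivative (fund L j k) (at q) v" for a b v
  proof -
    have "((\<lambda>q. a * fund L j h q - b * fund L j k q) has_derivative
      (\<lambda>v. a * frechet_derivative (fund L j h) (at q) v - b * frechet_derivative (fund L j k) (at q) v)) (at q)"
      by (intro has_derivative_diff has_derivative_mult_right f[unfolded frechet_derivative_works])
    then show ?thesis by (simp only: frechet_derivative_at[symmetric])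
  qed
  have D: "frechet_derivative (hh_curv L i j k h) (at q) v =
      r * e i k * frechet_derivative (fund L j h) (at q) v
      - r * e i h * frechet_derivative (fund L j k) (at q) v" for v
    unfolding comb[symmetric] by (simp only: frechet_derivative_cong_open[OF open_slit q R'])
  have hd: "hdelta L l (hh_curv L i j k h) q =
      r * e i k * hdelta L l (fund L j h) q - r * e i h * hdelta L l (fund L j k) q"
    unfolding hdelta_def dx_def dy_def D
    by (simp add: algebra_simps sum_subtractf sum_distrib_left)
  define G where "G a b = (\<Sum>s\<in>UNIV. fund L a s q * chern L s b l q)" for a b
  have T1: "(\<Sum>m\<in>UNIV. hh_curv L m j k h q * chern L i m l q) =
      r * fund L j h q * chern L i k l q - r * fund L j k q * chern L i h l q"
  proof -
    have "(\<Sum>m\<in>UNIV. hh_curv L m j k h q * chern L i m l q) =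
      r * fund L j h q * (\<Sum>m\<in>UNIV. e m k * chern L i m l q)
      - r * fund L j k q * (\<Sum>m\<in>UNIV. e m h * chern L i m l q)"
      unfolding R'[OF q] sum_distrib_left sum_subtractf[symmetric]
      by (rule sum.cong[OF refl]) (simp add: algebra_simps)
    then show ?thesis unfolding e_def sum_delta_mult .
  qed
  have T2: "(\<Sum>m\<in>UNIV. hh_curv L i m k h q * chern L m j l q) = r * e i k * G h j - r * e i h * G k j"
    unfolding R'[OF q] G_def sum_distrib_left sum_subtractf[symmetric]
    by (rule sum.cong[OF refl]) (simp add: fund_sym[OF q, of _ h] fund_sym[OF q, of _ k] algebra_simps)
  have T3: "(\<Sum>m\<in>UNIV. hh_curv L i j m h q * chern L m k l q) =
      r * fund L j h q * chern L i k l q - r * e i h * G j k"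
  proof -
    have "(\<Sum>m\<in>UNIV. hh_curv L i j m h q * chern L m k l q) =
      r * fund L j h q * (\<Sum>m\<in>UNIV. e i m * chern L m k l q) - r * e i h * G j k"
      unfolding R'[OF q] G_def sum_distrib_left sum_subtractf[symmetric]
      by (rule sum.cong[OF refl]) (simp add: algebra_simps)
    then show ?thesis unfolding e_def sum_delta_mult .
  qed
  have T4: "(\<Sum>m\<in>UNIV. hh_curv L i j k m q * chern L m h l q) =
      r * e i k * G j h - r * fund L j k q * chern L i h l q"
  proof -
    have "(\<Sum>m\<in>UNIV. hh_curv L i j k m q * chern L m h l q) =
      r * e i k * G j h - r * fund L j k q * (\<Sum>m\<in>UNIV. e i m * chern L m h l q)"
      unfolding R'[OF q] G_def sum_distrib_left sum_subtractf[symmetric]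
      by (rule sum.cong[OF refl]) (simp add: algebra_simps)
    then show ?thesis unfolding e_def sum_delta_mult .
  qed
  show ?thesis
    unfolding hcov_def hd T1 T2 T3 T4 hdelta_fund[OF q] G_def[symmetric]
    by (simp add: algebra_simps)
qed

text \<open>Different planes through the flagpole come with different geodesic fields, hence with different
  Riemannian metrics. These agree at the base point, and their Jacobi operators in the direction of
  the flagpole are all equal to that of the Berwald connection.\<close>

lemma jacobi_operator_of_constant_flag:
  assumes dim: "1 < CARD('n)"
    and flag: "\<And>x y u. (x, y) \<in> slit \<Longrightarrow> u \<noteq> y \<Longrightarrow> independent {u, y} \<Longrightarrow>
      \<exists>V X. geodesic_section L U V X \<and> x \<in> V \<and> X x = y \<and>
        sectional_curvature (\<lambda>i j z. fund L i j (z, X z)) x (span {u, y}) = r"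
    and q: "(x, y) \<in> slit"
  shows "(\<Sum>j\<in>UNIV. \<Sum>l\<in>UNIV. curv x i j k l * y $ j * y $ l) =
    r * ((if i = k then energy x y else 0) - y $ i * lowered x k y)"
proof -
  have y: "y \<noteq> 0" using q by simp
  define J where "J i k = (\<Sum>a\<in>UNIV. fund L i a (x, y) *
     (\<Sum>j\<in>UNIV. \<Sum>l\<in>UNIV. curv x a j k l * y $ j * y $ l))" for i k
  define g where "g i j = fund L i j (x, y)" for i j
  have common: "jacobi_form (geodesic_section.section_metric L X) y i k x = J i k"
    "geodesic_section.section_metric L X i k x = g i k"
    if X: "geodesic_section L U V X" "x \<in> V" "X x = y" for V X i k
  proof -
    interpret X: geodesic_section L U V X by (rule X(1))
    show "X.section_metric i k x = g i k" by (simp add: X.section_metric_def X(3) g_def)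
    show "jacobi_form X.section_metric y i k x = J i k"
      using X.jacobi_operator_section[OF X(2)] unfolding X(3)
      by (simp add: jacobi_form_def J_def X.section_metric_def X(3))
  qed
  have form: "metric_at (\<lambda>i k _. J i k) x u u = r * gram (\<lambda>i k _. g i k) x u y"
    if u: "u \<noteq> y" "independent {u, y}" for u
  proof -
    obtain V X where X: "geodesic_section L U V X" "x \<in> V" "X x = y"
      and K: "sectional_curvature (\<lambda>i j z. fund L i j (z, X z)) x (span {u, y}) = r"
      using flag[OF q u] by blast
    interpret X: geodesic_section L U V X by (rule X(1))
    have "sectional_curvature X.section_metric x (span {u, y}) = r"
      using K by (simp only: X.section_metric_def[abs_def])
    from X.metric_on_section.jacobi_form_of_sectional_curvature[OF X(2) u this]
    show ?thesis by (simp add: metric_at_def gram_def common[OF X])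
  qed
  have "\<exists>u. u \<notin> span {y}"
  proof (rule ccontr)
    assume "\<not> ?thesis"
    then have "span {y} = UNIV" by blast
    then have "dim (UNIV :: (real ^ 'n) set) \<le> card {y}" by (metis dim_le_card dim_span finite.intros order_refl)
    then show False using dim by simp
  qed
  then obtain u where "u \<notin> span {y}" by blast
  then have "u \<noteq> y" "independent {u, y}"
    using y by (auto simp: independent_insert span_base)
  then obtain V X where X: "geodesic_section L U V X" "x \<in> V" "X x = y"
    using flag[OF q] by blast
  interpret X: geodesic_section L U V X by (rule X(1))
  have "metric_at (jacobi_form X.section_metric y) x u u = r * gram X.section_metric x u y"
    if "u \<noteq> y" "independent {u, y}" for u
    using form[OF that] by (simp add: metric_at_def gram_def common[OF X])
  from X.metric_on_section.jacobi_operator_of_constant_form[OF X(2) y this, of i k]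
  have "(\<Sum>j\<in>UNIV. \<Sum>l\<in>UNIV. riem X.section_metric i j k l x * y $ j * y $ l) =
    r * ((if i = k then metric_at X.section_metric x y y else 0)
      - y $ i * (\<Sum>m\<in>UNIV. X.section_metric k m x * y $ m))" by blast
  moreover have "metric_at X.section_metric x y y = energy x y"
    by (simp add: metric_at_def energy_def lowered_def common[OF X] g_def sum_distrib_left ac_simps)
  moreover have "(\<Sum>m\<in>UNIV. X.section_metric k m x * y $ m) = lowered x k y"
    by (simp add: lowered_def common[OF X] g_def)
  ultimately show ?thesis using X.jacobi_operator_section[OF X(2), of i k] unfolding X(3) by simp
qed

theorem hcov_hh_curv_of_constant_flag:
  assumes "1 < CARD('n)"
    and "\<And>x y u. (x, y) \<in> slit \<Longrightarrow> u \<noteq> y \<Longrightarrow> independent {u, y} \<Longrightarrow>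
      \<exists>V X. geodesic_section L U V X \<and> x \<in> V \<and> X x = y \<and>
        sectional_curvature (\<lambda>i j z. fund L i j (z, X z)) x (span {u, y}) = r"
    and "q \<in> slit"
  shows "hcov L l (hh_curv L) i j k h q = 0"
proof (rule hcov_of_constant_curvature[OF _ assms(3)])
  fix q i j k l
  assume q: "q \<in> slit"
  obtain x y where xy: "q = (x, y)" by fastforce
  show "hh_curv L i j k l q = r * ((if i = k then fund L j l q else 0) - (if i = l then fund L j k q else 0))"
    using curv_of_constant_flag[OF assms(1) jacobi_operator_of_constant_flag[OF assms(1,2)]] q
    unfolding xy by (simp add: hh_curv_conn)
qed

end

section \<open>Charts and tangent vectors\<close>

locale smooth_atlas =
  fixes A :: "('m::topological_space, 'n::finite) chart set"
  assumes smooth_manifold: "smooth_manifold A"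
begin

lemma chart_basics:
  assumes "c \<in> A"
  shows "open (chart_dom c)" "open (chart_image c)"
    and "continuous_on (chart_dom c) (chart_map c)" "continuous_on (chart_image c) (chart_inv c)"
    and "p \<in> chart_dom c \<Longrightarrow> chart_inv c (chart_map c p) = p"
    and "x \<in> chart_image c \<Longrightarrow> chart_map c (chart_inv c x) = x"
    and "p \<in> chart_dom c \<Longrightarrow> chart_map c p \<in> chart_image c"
    and "x \<in> chart_image c \<Longrightarrow> chart_inv c x \<in> chart_dom c"
proof -
  have "is_chart c" using smooth_manifold assms by (simp add: smooth_manifold_def)
  then have *: "open (chart_dom c)" "open (chart_image c)"
    "homeomorphism (chart_dom c) (chart_image c) (chart_map c) (chart_inv c)"
    by (simp_all add: is_chart_def)
  show "open (chart_dom c)" "open (chart_image c)" by fact+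
  show "continuous_on (chart_dom c) (chart_map c)" "continuous_on (chart_image c) (chart_inv c)"
    using *(3) by (simp_all add: homeomorphism_def)
  show "p \<in> chart_dom c \<Longrightarrow> chart_inv c (chart_map c p) = p"
    "x \<in> chart_image c \<Longrightarrow> chart_map c (chart_inv c x) = x"
    using *(3) by (simp_all add: homeomorphism_def)
  show "p \<in> chart_dom c \<Longrightarrow> chart_map c p \<in> chart_image c"
    by (simp add: chart_image_def)
  show "x \<in> chart_image c \<Longrightarrow> chart_inv c x \<in> chart_dom c"
    using *(3) by (auto simp: homeomorphism_def)
qed

lemma chart_map_image_Int:
  assumes "c \<in> A"
  shows "chart_map c ` (chart_dom c \<inter> W) = {x \<in> chart_image c. chart_inv c x \<in> W}"
proof (intro equalityI subsetI)
  fix x assume "x \<in> chart_map c ` (chart_dom c \<inter> W)"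
  then obtain p where "p \<in> chart_dom c" "p \<in> W" "x = chart_map c p" by auto
  then show "x \<in> {x \<in> chart_image c. chart_inv c x \<in> W}"
    using chart_basics(5,7)[OF assms] by simp
next
  fix x assume x: "x \<in> {x \<in> chart_image c. chart_inv c x \<in> W}"
  then have "x = chart_map c (chart_inv c x)" "chart_inv c x \<in> chart_dom c \<inter> W"
    using chart_basics(6,8)[OF assms] by auto
  then show "x \<in> chart_map c ` (chart_dom c \<inter> W)" by (rule image_eqI)
qed

lemma open_chart_map_image:
  assumes "c \<in> A" "open W"
  shows "open (chart_map c ` (chart_dom c \<inter> W))"
proof -
  have "open (chart_image c \<inter> chart_inv c -` W)"
    using chart_basics(4,2)[OF assms(1)] assms(2) by (rule continuous_open_preimage)
  moreover have "chart_image c \<inter> chart_inv c -` W = {x \<in> chart_image c. chart_inv c x \<in> W}"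
    by auto
  ultimately show ?thesis by (simp only: chart_map_image_Int[OF assms(1)])
qed

lemma transition_has_derivative:
  assumes "c \<in> charts_at A p" "d \<in> charts_at A p"
  shows "(transition c d has_derivative frechet_derivative (transition c d) (at (chart_map c p)))
    (at (chart_map c p))"
proof (rule smooth_on_has_derivative)
  show "smooth_on (chart_map c ` (chart_dom c \<inter> chart_dom d)) (transition c d)"
    using smooth_manifold assms by (auto simp: smooth_manifold_def charts_at_def compatible_charts_def)
  show "chart_map c p \<in> chart_map c ` (chart_dom c \<inter> chart_dom d)"
    using assms by (auto simp: charts_at_def)
qed

lemma linear_transition:
  "c \<in> charts_at A p \<Longrightarrow> d \<in> charts_at A p \<Longrightarrow>
    linear (frechet_derivative (transition c d) (at (chart_map c p)))"
  using transition_has_derivative has_derivative_linear by blast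

lemma transition_cocycle:
  assumes c: "c \<in> charts_at A p" and d: "d \<in> charts_at A p" and e: "e \<in> charts_at A p"
  shows "frechet_derivative (transition d e) (at (chart_map d p))
      (frechet_derivative (transition c d) (at (chart_map c p)) y) =
    frechet_derivative (transition c e) (at (chart_map c p)) y"
proof -
  let ?S = "chart_map c ` (chart_dom c \<inter> (chart_dom d \<inter> chart_dom e))"
  have A: "c \<in> A" "d \<in> A" "e \<in> A" and p: "p \<in> chart_dom c" "p \<in> chart_dom d" "p \<in> chart_dom e"
    using c d e by (auto simp: charts_at_def)
  have S: "open ?S" "chart_map c p \<in> ?S"
    using open_chart_map_image[OF A(1) open_Int[OF chart_basics(1)[OF A(2)] chart_basics(1)[OF A(3)]]] p
    by auto
  have "transition c d (chart_map c p) = chart_map d p"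
    using chart_basics(5)[OF A(1) p(1)] by (simp add: transition_def)
  then have "((\<lambda>x. transition d e (transition c d x)) has_derivative
      (\<lambda>y. frechet_derivative (transition d e) (at (chart_map d p))
        (frechet_derivative (transition c d) (at (chart_map c p)) y))) (at (chart_map c p))"
    using diff_chain_at[OF transition_has_derivative[OF c d], of "transition d e"]
      transition_has_derivative[OF d e] by (simp add: o_def)
  moreover have "transition d e (transition c d x) = transition c e x" if "x \<in> ?S" for x
  proof -
    from that obtain z where "x = chart_map c z" "z \<in> chart_dom c" "z \<in> chart_dom d" by auto
    then show ?thesis
      using chart_basics(5)[OF A(1)] chart_basics(5)[OF A(2)] by (simp add: transition_def)
  qed
  ultimately have "(transition c e has_derivative
      (\<lambda>y. frechet_derivative (transition d e) (at (chart_map d p))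
        (frechet_derivative (transition c d) (at (chart_map c p)) y))) (at (chart_map c p))"
    using has_derivative_transform_within_open[OF _ S] by blast
  from has_derivative_unique[OF this transition_has_derivative[OF c e]]
  show ?thesis by (rule fun_cong)
qed

lemma transition_self:
  assumes c: "c \<in> charts_at A p"
  shows "frechet_derivative (transition c c) (at (chart_map c p)) y = y"
proof -
  have A: "c \<in> A" and p: "p \<in> chart_dom c" using c by (auto simp: charts_at_def)
  have "transition c c x = x" if "x \<in> chart_image c" for x
    using chart_basics(6)[OF A that] by (simp add: transition_def)
  from frechet_derivative_cong_open[OF chart_basics(2)[OF A] chart_basics(7)[OF A p] this]
  show ?thesis by simp
qed

lemma coord_tvec_apply:
  "d \<in> charts_at A p \<Longrightarrow>
    coord_tvec A c p y d = frechet_derivative (transition c d) (at (chart_map c p)) y"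
  by (simp add: coord_tvec_def)

lemma coord_tvec_self: "c \<in> charts_at A p \<Longrightarrow> coord_tvec A c p y c = y"
  by (simp add: coord_tvec_apply transition_self)

lemma coord_tvec_in_tangent_space:
  assumes "c \<in> charts_at A p"
  shows "coord_tvec A c p y \<in> tangent_space A p"
  unfolding tangent_space_def
  using transition_cocycle[OF assms] by (auto simp: coord_tvec_def)

lemma tangent_vector_coord:
  assumes "c \<in> charts_at A p" "v \<in> tangent_space A p"
  shows "v = coord_tvec A c p (v c)"
proof
  fix d
  have "d \<in> charts_at A p \<Longrightarrow> v d = frechet_derivative (transition c d) (at (chart_map c p)) (v c)"
    and "d \<notin> charts_at A p \<Longrightarrow> v d = 0"
    using assms unfolding tangent_space_def by blast+
  then show "v d = coord_tvec A c p (v c) d"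
    unfolding coord_tvec_def by (simp split: if_split)
qed

lemma coord_tvec_zero:
  assumes "c \<in> charts_at A p"
  shows "coord_tvec A c p 0 = (\<lambda>_. 0)"
  using linear_0[OF linear_transition[OF assms]] by (simp add: coord_tvec_def fun_eq_iff)

lemma coord_tvec_scale:
  assumes "c \<in> charts_at A p"
  shows "coord_tvec A c p (r *\<^sub>R y) = (\<lambda>d. r *\<^sub>R coord_tvec A c p y d)"
  using linear_scale[OF linear_transition[OF assms]] by (simp add: coord_tvec_def fun_eq_iff)

text \<open>Changes of coordinates act on coordinate columns by invertible linear maps, so a plane in one chart
  is a plane in all of them.\<close>

lemma tangent_plane_of_span:
  assumes c: "c \<in> charts_at A p" and uw: "u \<noteq> w" "independent {u, w}"
  shows "tangent_plane A p (coord_tvec A c p ` span {u, w})"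
  unfolding tangent_plane_def
proof (intro conjI ballI)
  show "coord_tvec A c p ` span {u, w} \<subseteq> tangent_space A p"
    using coord_tvec_in_tangent_space[OF c] by auto
  fix d assume d: "d \<in> charts_at A p"
  let ?T = "frechet_derivative (transition c d) (at (chart_map c p))"
  have image: "(\<lambda>v. v d) ` coord_tvec A c p ` span {u, w} = ?T ` span {u, w}"
    using coord_tvec_apply[OF d] by (simp add: image_image)
  have lin: "linear ?T" by (rule linear_transition[OF c d])
  have inj: "inj ?T"
  proof (rule inj_on_inverseI)
    show "frechet_derivative (transition d c) (at (chart_map d p)) (?T y) = y" for y
      using transition_cocycle[OF c d c] transition_self[OF c] by simp
  qed
  show "subspace ((\<lambda>v. v d) ` coord_tvec A c p ` span {u, w})"
    unfolding image by (rule linear_subspace_image[OF lin subspace_span])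
  have "dim (?T ` span {u, w}) = dim (span {u, w})"
    using dim_image_eq[OF lin] inj by (simp add: inj_on_subset)
  also have "\<dots> = 2" using uw by (simp add: dim_eq_card_independent)
  finally show "dim ((\<lambda>v. v d) ` coord_tvec A c p ` span {u, w}) = 2" unfolding image .
qed

section \<open>Geodesic fields in a chart\<close>

text \<open>A geodesic field is defined by its integral curves; as there is one through each point, the
  field satisfies a differential equation on its whole domain.\<close>

lemma geodesic_field_equation:
  assumes c: "c \<in> A" and W: "open W" and X: "geodesic_field A F W X"
    and z: "z \<in> chart_map c ` (chart_dom c \<inter> W)"
  defines "Xc \<equiv> \<lambda>x. X (chart_inv c x) c"
  shows "frechet_derivative Xc (at z) (Xc z) =
    (\<chi> i. - (\<Sum>j\<in>UNIV. \<Sum>k\<in>UNIV. chern (local_expr A F c) i j k (z, Xc z) * Xc z $ j * Xc z $ k))"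
proof -
  let ?V = "chart_map c ` (chart_dom c \<inter> W)"
  have V: "open ?V" by (rule open_chart_map_image[OF c W])
  have V_iff: "x \<in> ?V \<longleftrightarrow> x \<in> chart_image c \<and> chart_inv c x \<in> W" for x
    unfolding chart_map_image_Int[OF c] by simp
  have field: "nonzero_vector_field A W X"
    using X by (simp add: geodesic_field_def)
  have smooth: "smooth_on ?V Xc"
    using field c unfolding nonzero_vector_field_def Xc_def by blast
  obtain e \<gamma> where e: "0 < e" and \<gamma>: "\<gamma> 0 = z" "\<And>t. t \<in> {-e<..<e} \<Longrightarrow> \<gamma> t \<in> ?V"
    "\<And>t. t \<in> {-e<..<e} \<Longrightarrow> (\<gamma> has_vector_derivative Xc (\<gamma> t)) (at t)"
    using integral_curve_through_point_exists[OF V smooth z] by blast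
  let ?I = "{-e<..<e}"
  define \<Gamma> where "\<Gamma> t = chart_inv c (\<gamma> t)" for t
  have \<gamma>_image: "\<gamma> t \<in> chart_image c" and \<Gamma>_W: "\<Gamma> t \<in> W" if "t \<in> ?I" for t
    using \<gamma>(2)[OF that] unfolding V_iff \<Gamma>_def by auto
  have \<Gamma>_dom: "\<Gamma> t \<in> chart_dom c" and \<Gamma>_\<gamma>: "chart_map c (\<Gamma> t) = \<gamma> t" if "t \<in> ?I" for t
    using chart_basics(6,8)[OF c \<gamma>_image[OF that]] by (simp_all add: \<Gamma>_def)
  have \<Gamma>_cont: "continuous_on ?I \<Gamma>"
  proof -
    have "continuous_on ?I \<gamma>"
      by (rule continuous_on_vector_derivative) (rule has_vector_derivative_at_within[OF \<gamma>(3)])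
    then show ?thesis
      unfolding \<Gamma>_def using chart_basics(4)[OF c] \<gamma>_image
      by (auto intro!: continuous_on_compose2[of "chart_image c" "chart_inv c" ?I \<gamma>])
  qed
  have "integral_curve A W X ?I \<Gamma>"
    unfolding integral_curve_def
  proof (intro conjI ballI)
    show "continuous_on ?I \<Gamma>" by (rule \<Gamma>_cont)
    show "\<Gamma> ` ?I \<subseteq> W" using \<Gamma>_W by blast
    fix t d assume t: "t \<in> ?I" and d: "d \<in> charts_at A (\<Gamma> t)"
    have ct: "c \<in> charts_at A (\<Gamma> t)" using c \<Gamma>_dom[OF t] by (simp add: charts_at_def)
    have "((transition c d \<circ> \<gamma>) has_vector_derivative
        frechet_derivative (transition c d) (at (\<gamma> t)) (Xc (\<gamma> t))) (at t)"
      using transition_has_derivative[OF ct d] unfolding \<Gamma>_\<gamma>[OF t]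
      by (rule has_vector_derivative_compose_at[OF \<gamma>(3)[OF t]])
    moreover have "frechet_derivative (transition c d) (at (\<gamma> t)) (Xc (\<gamma> t)) = X (\<Gamma> t) d"
    proof -
      have "X (\<Gamma> t) \<in> tangent_space A (\<Gamma> t)"
        using field \<Gamma>_W[OF t] by (simp add: nonzero_vector_field_def)
      from fun_cong[OF tangent_vector_coord[OF ct this], of d]
      have "X (\<Gamma> t) d = frechet_derivative (transition c d) (at (\<gamma> t)) (X (\<Gamma> t) c)"
        unfolding coord_tvec_apply[OF d] \<Gamma>_\<gamma>[OF t] .
      moreover have "Xc (\<gamma> t) = X (\<Gamma> t) c" by (simp only: Xc_def \<Gamma>_def)
      ultimately show ?thesis by (simp only:)
    qed
    moreover have "transition c d \<circ> \<gamma> = (\<lambda>s. chart_map d (\<Gamma> s))"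
      by (simp add: transition_def o_def \<Gamma>_def)
    ultimately show "((\<lambda>s. chart_map d (\<Gamma> s)) has_vector_derivative X (\<Gamma> t) d) (at t)" by simp
  qed
  then have geo: "finsler_geodesic A F ?I \<Gamma>"
    using X by (simp add: geodesic_field_def is_interval_oo)
  have 0: "0 \<in> ?I" using e by simp
  define x where "x s = chart_map c (\<Gamma> s)" for s
  have c0: "c \<in> charts_at A (\<Gamma> 0)" using c \<Gamma>_dom[OF 0] by (simp add: charts_at_def)
  have x_\<gamma>: "x s = \<gamma> s" if "s \<in> ?I" for s unfolding x_def by (rule \<Gamma>_\<gamma>[OF that])
  have x': "vector_derivative x (at s) = Xc (\<gamma> s)" if "s \<in> ?I" for s
  proof (rule vector_derivative_at)
    show "(x has_vector_derivative Xc (\<gamma> s)) (at s)"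
      using \<gamma>(3)[OF that] by (rule has_vector_derivative_transform_within_open[OF _ open_greaterThanLessThan that])
        (simp only: x_\<gamma>)
  qed
  let ?rhs = "\<chi> i. - (\<Sum>j\<in>UNIV. \<Sum>k\<in>UNIV. chern (local_expr A F c) i j k (z, Xc z) * Xc z $ j * Xc z $ k)"
  have "((\<lambda>s. vector_derivative x (at s)) has_vector_derivative ?rhs) (at 0)"
  proof -
    have "((\<lambda>s. vector_derivative x (at s)) has_vector_derivative
      (\<chi> i. - (\<Sum>j\<in>UNIV. \<Sum>k\<in>UNIV. chern (local_expr A F c) i j k (x 0, vector_derivative x (at 0))
        * vector_derivative x (at 0) $ j * vector_derivative x (at 0) $ k))) (at 0)"
      using geo 0 c0 unfolding finsler_geodesic_def Let_def x_def by blast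
    then show ?thesis unfolding x'[OF 0] x_\<gamma>[OF 0] \<gamma>(1) .
  qed
  then have 1: "((\<lambda>s. Xc (\<gamma> s)) has_vector_derivative ?rhs) (at 0)"
    by (rule has_vector_derivative_transform_within_open[OF _ open_greaterThanLessThan 0]) (rule x')
  have "(Xc has_derivative frechet_derivative Xc (at z)) (at (\<gamma> 0))"
    unfolding \<gamma>(1) by (rule smooth_on_has_derivative[OF smooth z])
  then have "((Xc \<circ> \<gamma>) has_vector_derivative frechet_derivative Xc (at z) (Xc (\<gamma> 0))) (at 0)"
    by (rule has_vector_derivative_compose_at[OF \<gamma>(3)[OF 0]])
  then have 2: "((\<lambda>s. Xc (\<gamma> s)) has_vector_derivative frechet_derivative Xc (at z) (Xc z)) (at 0)"
    by (simp add: o_def \<gamma>(1))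
  show ?thesis by (rule vector_derivative_unique_at[OF 2 1])
qed

end

section \<open>Berwald manifolds of constant flag curvature\<close>

theorem corollary3p9:
  fixes A :: "('m::{t2_space, second_countable_topology}, 'n::finite) chart set"
    and F :: "'m \<Rightarrow> ('m, 'n) tvec \<Rightarrow> real"
  assumes "smooth_manifold A"
    and "finsler_structure A F"
    and "berwald A F"
    and "constant_flag_curvature A F"
    and "2 < CARD('n)"
  shows "symmetric_finsler A F"
  unfolding symmetric_finsler_def
proof (intro ballI allI)
  fix c q l i j k h
  assume c: "c \<in> A" and q: "q \<in> natural_dom c"
  interpret smooth_atlas A by unfold_locales (rule assms(1))
  let ?L = "local_expr A F c" and ?U = "chart_image c"
  have nat_dom: "natural_dom c = ?U \<times> (UNIV - {0})" by (simp add: natural_dom_def)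
  have at: "c \<in> charts_at A (chart_inv c x)" if "x \<in> ?U" for x
    using c chart_basics(8)[OF c that] by (simp add: charts_at_def)
  interpret berwald_chart ?L ?U
  proof
    show "open ?U" by (rule chart_basics(2)[OF c])
    show "smooth_on (?U \<times> (UNIV - {0})) ?L"
      using assms(2) c unfolding finsler_structure_def nat_dom[symmetric] by blast
    show "?L (x, r *\<^sub>R y) = r * ?L (x, y)" if x: "x \<in> ?U" and "y \<noteq> 0" "0 < r" for x y r
    proof -
      have "F p (\<lambda>c. r *\<^sub>R v c) = r * F p v" if "v \<in> tangent_space A p" for p v
        using assms(2) that \<open>0 < r\<close> unfolding finsler_structure_def by blast
      from this[OF coord_tvec_in_tangent_space[OF at[OF x]], of y]
      show ?thesis by (simp add: local_expr_def coord_tvec_scale[OF at[OF x]])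
    qed
    show "pos_def_matrix (\<chi> a b. fund ?L a b q)" if "q \<in> ?U \<times> (UNIV - {0})" for q
      using assms(2) c that unfolding finsler_structure_def nat_dom[symmetric] pos_def_matrix_def
      by simp
    show "chern ?L i j k (x, y) = chern ?L i j k (x, z)"
      if "x \<in> ?U" "y \<noteq> 0" "z \<noteq> 0" for x y z i j k
    proof -
      have "(x, y) \<in> natural_dom c" "(x, z) \<in> natural_dom c" using that nat_dom by auto
      then show ?thesis using assms(3) c unfolding berwald_def by blast
    qed
  qed
  obtain r where r: "\<And>p P v. tangent_plane A p P \<Longrightarrow> v \<in> P \<Longrightarrow> v \<noteq> (\<lambda>_. 0) \<Longrightarrow>
      has_flag_curvature A F p P v r"
    using assms(4) unfolding constant_flag_curvature_def by blast
  have flag: "\<exists>V X. geodesic_section ?L ?U V X \<and> x \<in> V \<and> X x = y \<and>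
        sectional_curvature (\<lambda>i j z. fund ?L i j (z, X z)) x (span {u, y}) = r"
    if xy: "(x, y) \<in> slit" and u: "u \<noteq> y" "independent {u, y}" for x y u
  proof -
    let ?p = "chart_inv c x"
    have x: "x \<in> ?U" and y: "y \<noteq> 0" using xy by auto
    note p = at[OF x]
    (* The hypothesis is applied to the plane that the chosen coordinate columns span; its basis
       inside the sectional curvature and the geodesic field depend on that plane. *)
    let ?P = "coord_tvec A c ?p ` span {u, y}" and ?v = "coord_tvec A c ?p y"
    have v: "?v \<noteq> (\<lambda>_. 0)" using coord_tvec_self[OF p, of y] y by metis
    have "?v \<in> ?P" by (simp add: span_base)
    from r[OF tangent_plane_of_span[OF p u] this v]
    obtain W X where W: "open W" "?p \<in> W" and X: "geodesic_field A F W X" "X ?p = ?v"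
      and K: "\<forall>c\<in>charts_at A ?p.
        sectional_curvature (field_metric A F X c) (chart_map c ?p) ((\<lambda>u. u c) ` ?P) = r"
      unfolding has_flag_curvature_def by blast
    define Xc where "Xc z = X (chart_inv c z) c" for z
    let ?V = "chart_map c ` (chart_dom c \<inter> W)"
    have field: "nonzero_vector_field A W X" using X(1) by (simp add: geodesic_field_def)
    have smooth: "smooth_on ?V Xc"
      using field c unfolding nonzero_vector_field_def Xc_def[abs_def] by blast
    have V_iff: "z \<in> ?V \<longleftrightarrow> z \<in> ?U \<and> chart_inv c z \<in> W" for z
      unfolding chart_map_image_Int[OF c] by simp
    have "geodesic_section ?L ?U ?V Xc"
    proof unfold_locales
      show "open ?V" by (rule open_chart_map_image[OF c W(1)])
      show "?V \<subseteq> ?U" using V_iff by blast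
      show "smooth_on ?V Xc" by (rule smooth)
      fix z assume z: "z \<in> ?V"
      then have zW: "chart_inv c z \<in> W" and zU: "z \<in> ?U" using V_iff by auto
      show "Xc z \<noteq> 0"
      proof
        assume "Xc z = 0"
        moreover have "X (chart_inv c z) \<in> tangent_space A (chart_inv c z)"
          "X (chart_inv c z) \<noteq> (\<lambda>_. 0)"
          using field zW by (simp_all add: nonzero_vector_field_def)
        ultimately show False
          using tangent_vector_coord[OF at[OF zU]] coord_tvec_zero[OF at[OF zU]]
          unfolding Xc_def by metis
      qed
      show "(\<Sum>m\<in>UNIV. Xc z $ m * pd m (\<lambda>z. Xc z $ i) z) =
        - (\<Sum>j\<in>UNIV. \<Sum>k\<in>UNIV. chern ?L i j k (z, Xc z) * Xc z $ j * Xc z $ k)" for i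
        using geodesic_field_equation[OF c W(1) X(1) z]
          frechet_derivative_components[OF smooth_on_differentiable[OF smooth z], of "Xc z" i]
        unfolding Xc_def by simp
    qed
    moreover have "x \<in> ?V" using V_iff x W(2) by blast
    moreover have "Xc x = y" by (simp add: Xc_def X(2) coord_tvec_self[OF p])
    moreover have "sectional_curvature (\<lambda>i j z. fund ?L i j (z, Xc z)) x (span {u, y}) = r"
    proof -
      have "(\<lambda>u. u c) ` ?P = span {u, y}"
        using coord_tvec_self[OF p] by (simp add: image_image)
      moreover have "field_metric A F X c = (\<lambda>i j z. fund ?L i j (z, Xc z))"
        by (simp add: fun_eq_iff field_metric_def Xc_def)
      moreover have "chart_map c ?p = x" by (rule chart_basics(6)[OF c x])
      ultimately show ?thesis using bspec[OF K p] by (simp only:)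
    qed
    ultimately show ?thesis by blast
  qed
  show "hcov ?L l (hh_curv ?L) i j k h q = 0"
    by (rule hcov_hh_curv_of_constant_flag[OF _ flag]) (use assms(5) q nat_dom in auto)
qed

end
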